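(* Let $F_5$ be the free group of rank $5$. Every action of $\operatorname{SAut}(F_5)$ on a set containing fewer than $18$ elements is trivial; that is, for every set $X$ with $|X| < 18$, every group homomorphism $\operatorname{SAut}(F_5) \to \operatorname{Sym}(X)$ is trivial.
   Context: $\operatorname{SAut}(F_n)$ denotes the kernel of the composition $\operatorname{Aut}(F_n) \to \operatorname{GL}_n(\mathbb{Z}) \xrightarrow{\det} \{\pm 1\}$, where the first map is induced by abelianizing $F_n$. *)

theory Defs
  imports
    "HOL-Algebra.Bij"
    "HOL-Algebra.Generated_Groups"
    "HOL-Algebra.Elementary_Groups"
    "HOL-Algebra.FiniteProduct"
    "HOL-Algebra.Sym_Groups"
    "Jordan_Normal_Form.Determinant"
begin

section \<open>Free groups\<close>

text \<open>
  Elements of the free group on \<open>S\<close> are the freely reduced words in the letters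
  \<open>(x, True)\<close>, standing for \<open>x\<close>, and \<open>(x, False)\<close>, standing for the inverse of \<open>x\<close>, where \<open>x \<in> S\<close>.
\<close>

type_synonym 'a letter = "'a \<times> bool"

definition inv_letter :: "'a letter \<Rightarrow> 'a letter" where
  "inv_letter a = (fst a, \<not> snd a)"

definition freely_reduced :: "'a letter list \<Rightarrow> bool" where
  "freely_reduced w \<longleftrightarrow> successively (\<lambda>a b. b \<noteq> inv_letter a) w"

text \<open>Left multiplication of a reduced word by a single letter; iterating it reduces a concatenation.\<close>

fun cons_reduce :: "'a letter \<Rightarrow> 'a letter list \<Rightarrow> 'a letter list" where
  "cons_reduce a [] = [a]"
| "cons_reduce a (b # w) = (if b = inv_letter a then w else a # b # w)"

definition free_group :: "'a set \<Rightarrow> 'a letter list monoid" where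
  "free_group S =
     \<lparr>carrier = {w. set w \<subseteq> S \<times> UNIV \<and> freely_reduced w},
      monoid.mult = (\<lambda>v w. foldr cons_reduce v w),
      one = []\<rparr>"

definition free_gen :: "'a \<Rightarrow> 'a letter list" where
  "free_gen x = [(x, True)]"


section \<open>Abelianization\<close>

definition abelianization :: "('a, 'b) monoid_scheme \<Rightarrow> 'a set monoid" where
  "abelianization G = G Mod (derived G (carrier G))"

definition abel_class :: "('a, 'b) monoid_scheme \<Rightarrow> 'a \<Rightarrow> 'a set" where
  "abel_class G x = derived G (carrier G) #>\<^bsub>G\<^esub> x"

text \<open>An automorphism permutes the cosets of the derived subgroup, so it acts on the abelianization
  by taking images of cosets.\<close>

definition abel_map :: "('a, 'b) monoid_scheme \<Rightarrow> ('a \<Rightarrow> 'a) \<Rightarrow> 'a set \<Rightarrow> 'a set" where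
  "abel_map G \<phi> = (\<lambda>C \<in> carrier (abelianization G). \<phi> ` C)"


section \<open>The special automorphism group of a free group\<close>

definition GL_int :: "nat \<Rightarrow> int mat monoid" where
  "GL_int n = units_of (ring_mat TYPE(int) n ())"

text \<open>The matrix of the induced map on the abelianization with respect to the basis formed by the
  classes of the free generators \<open>0, \<dots>, n - 1\<close>: column \<open>j\<close> holds the coordinates of the image of the
  \<open>j\<close>-th basis element (the abelianization being written multiplicatively).\<close>

definition abel_matrix :: "nat \<Rightarrow> (nat letter list \<Rightarrow> nat letter list) \<Rightarrow> int mat" where
  "abel_matrix n \<phi> =
     (let F = free_group {..<n}; A = abelianization F; e = (\<lambda>i. abel_class F (free_gen i)) in
      THE M. M \<in> carrier_mat n n \<and>
             (\<forall>j<n. abel_map F \<phi> (e j) = finprod A (\<lambda>i. e i [^]\<^bsub>A\<^esub> (M $$ (i, j))) {..<n}))"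

text \<open>\<^const>\<open>sign_img\<close> is the multiplicative group \<open>{-1, 1}\<close>.\<close>

definition SAut :: "nat \<Rightarrow> (nat letter list \<Rightarrow> nat letter list) monoid" where
  "SAut n = (AutoGroup (free_group {..<n}))
     \<lparr>carrier := kernel (AutoGroup (free_group {..<n})) sign_img (det \<circ> abel_matrix n)\<rparr>"

section \<open>Consistency of the definitions\<close>

subsection \<open>The free group and its universal property\<close>

lemma inv_letter_simps [simp]:
  "inv_letter (inv_letter a) = a" "fst (inv_letter a) = fst a" "snd (inv_letter a) = (\<not> snd a)"
  "inv_letter a \<noteq> a" "a \<noteq> inv_letter a"
  by (auto simp: inv_letter_def prod_eq_iff)

lemma inv_letter_eq_iff: "inv_letter a = b \<longleftrightarrow> a = inv_letter b"
  by auto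

lemma freely_reduced_Nil [simp]: "freely_reduced []"
  by (simp add: freely_reduced_def)

lemma freely_reduced_Cons:
  "freely_reduced (a # w) \<longleftrightarrow> (w = [] \<or> hd w \<noteq> inv_letter a) \<and> freely_reduced w"
  by (auto simp: freely_reduced_def successively_Cons)

lemma cons_reduce_reduced: "freely_reduced w \<Longrightarrow> freely_reduced (cons_reduce a w)"
  by (cases w) (auto simp: freely_reduced_Cons)

lemma cons_reduce_set: "set (cons_reduce a w) \<subseteq> insert a (set w)"
  by (cases w) auto

lemma cons_reduce_Cons: "freely_reduced (a # w) \<Longrightarrow> cons_reduce a w = a # w"
  by (cases w) (auto simp: freely_reduced_Cons)

lemma cons_reduce_inv: "freely_reduced w \<Longrightarrow> cons_reduce a (cons_reduce (inv_letter a) w) = w"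
  by (cases w) (auto simp: freely_reduced_Cons neq_Nil_conv cons_reduce_Cons)

lemma foldr_cons_reduce_reduced:
  "freely_reduced w \<Longrightarrow> freely_reduced (foldr cons_reduce v w)"
  by (induction v) (auto simp: cons_reduce_reduced)

lemma foldr_cons_reduce_set: "set (foldr cons_reduce v w) \<subseteq> set v \<union> set w"
  using cons_reduce_set by (induction v) fastforce+

lemma foldr_cons_reduce_Nil: "freely_reduced w \<Longrightarrow> foldr cons_reduce w [] = w"
  by (induction w) (auto simp: freely_reduced_Cons intro!: cons_reduce_Cons)

lemma foldr_cons_reduce_cons_reduce:
  assumes "freely_reduced v" "freely_reduced w"
  shows "foldr cons_reduce (cons_reduce a v) w = cons_reduce a (foldr cons_reduce v w)"
proof (cases v)
  case (Cons b u)
  then show ?thesis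
    using cons_reduce_inv[OF foldr_cons_reduce_reduced[OF assms(2)], of a u] by auto
qed auto

lemma foldr_cons_reduce_assoc:
  assumes "freely_reduced v" "freely_reduced w"
  shows "foldr cons_reduce (foldr cons_reduce u v) w = foldr cons_reduce u (foldr cons_reduce v w)"
  by (induction u)
     (auto simp: foldr_cons_reduce_cons_reduce foldr_cons_reduce_reduced assms)

lemma carrier_free_group:
  "w \<in> carrier (free_group S) \<longleftrightarrow> set w \<subseteq> S \<times> UNIV \<and> freely_reduced w"
  by (simp add: free_group_def)

lemma mult_free_group: "v \<otimes>\<^bsub>free_group S\<^esub> w = foldr cons_reduce v w"
  by (simp add: free_group_def)

lemma one_free_group: "\<one>\<^bsub>free_group S\<^esub> = []"
  by (simp add: free_group_def)

lemma foldr_cons_reduce_left_inv: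
  "freely_reduced w \<Longrightarrow> \<exists>v. set v \<subseteq> fst ` set w \<times> UNIV \<and> freely_reduced v \<and> foldr cons_reduce v w = []"
proof (induction w)
  case (Cons a w)
  then obtain v where v: "set v \<subseteq> fst ` set w \<times> UNIV" "freely_reduced v" "foldr cons_reduce v w = []"
    by (auto simp: freely_reduced_Cons)
  let ?v = "foldr cons_reduce v [inv_letter a]"
  have "foldr cons_reduce ?v (a # w) = foldr cons_reduce v (foldr cons_reduce [inv_letter a] (a # w))"
    using Cons.prems by (intro foldr_cons_reduce_assoc) (auto simp: freely_reduced_Cons)
  then have "foldr cons_reduce ?v (a # w) = []"
    using v by simp
  moreover have "freely_reduced ?v"
    by (intro foldr_cons_reduce_reduced) (auto simp: freely_reduced_Cons)
  moreover have "set ?v \<subseteq> fst ` set (a # w) \<times> UNIV"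
    using foldr_cons_reduce_set[of v "[inv_letter a]"] v(1)
    by (fastforce simp: inv_letter_def)
  ultimately show ?case by blast
qed auto

theorem group_free_group: "group (free_group S)"
proof (rule groupI)
  fix u v w
  assume "u \<in> carrier (free_group S)" "v \<in> carrier (free_group S)"
  then show "u \<otimes>\<^bsub>free_group S\<^esub> v \<in> carrier (free_group S)"
    using foldr_cons_reduce_set[of u v]
    by (auto simp: carrier_free_group mult_free_group foldr_cons_reduce_reduced)
  assume "w \<in> carrier (free_group S)"
  with \<open>v \<in> _\<close> show "u \<otimes>\<^bsub>free_group S\<^esub> v \<otimes>\<^bsub>free_group S\<^esub> w = u \<otimes>\<^bsub>free_group S\<^esub> (v \<otimes>\<^bsub>free_group S\<^esub> w)"
    by (auto simp: carrier_free_group mult_free_group foldr_cons_reduce_assoc)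
next
  fix w assume w: "w \<in> carrier (free_group S)"
  then obtain v where "set v \<subseteq> fst ` set w \<times> UNIV" "freely_reduced v" "foldr cons_reduce v w = []"
    using foldr_cons_reduce_left_inv[of w] unfolding carrier_free_group by blast
  with w show "\<exists>v\<in>carrier (free_group S). v \<otimes>\<^bsub>free_group S\<^esub> w = \<one>\<^bsub>free_group S\<^esub>"
    by (intro bexI[of _ v]) (fastforce simp: carrier_free_group mult_free_group one_free_group)+
qed (auto simp: carrier_free_group mult_free_group one_free_group)

lemma free_gen_closed [simp]: "free_gen x \<in> carrier (free_group S) \<longleftrightarrow> x \<in> S"
  by (auto simp: free_gen_def carrier_free_group freely_reduced_Cons)

lemma letter_in_generate:
  assumes "x \<in> S"
  shows "[(x, b)] \<in> generate (free_group S) (free_gen ` S)"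
proof (cases b)
  case True
  then show ?thesis
    using assms by (auto simp: free_gen_def intro!: generate.incl)
next
  case False
  have "inv\<^bsub>free_group S\<^esub> free_gen x = [(x, False)]"
    by (rule group.inv_equality[OF group_free_group])
       (use assms in \<open>auto simp: mult_free_group one_free_group carrier_free_group free_gen_def
          freely_reduced_Cons inv_letter_def\<close>)
  then show ?thesis
    using generate.inv[of "free_gen x" "free_gen ` S" "free_group S"] assms False by auto
qed

theorem generate_free_gen: "generate (free_group S) (free_gen ` S) = carrier (free_group S)"
proof
  show "generate (free_group S) (free_gen ` S) \<subseteq> carrier (free_group S)"
    by (rule group.generate_incl[OF group_free_group]) auto
  have "set w \<subseteq> S \<times> UNIV \<Longrightarrow> freely_reduced w \<Longrightarrow> w \<in> generate (free_group S) (free_gen ` S)" for w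
  proof (induction w)
    case Nil
    then show ?case
      using generate.one[of "free_group S"] by (simp add: one_free_group)
  next
    case (Cons a w)
    then have "[a] \<otimes>\<^bsub>free_group S\<^esub> w \<in> generate (free_group S) (free_gen ` S)"
      by (cases a) (auto intro!: generate.eng letter_in_generate simp: freely_reduced_Cons)
    then show ?case
      using cons_reduce_Cons[OF Cons.prems(2)] by (simp add: mult_free_group)
  qed
  then show "carrier (free_group S) \<subseteq> generate (free_group S) (free_gen ` S)"
    by (auto simp: carrier_free_group)
qed

lemma free_group_hom_eqI:
  assumes "group H" "h \<in> hom (free_group S) H" "k \<in> hom (free_group S) H"
    and eq: "\<And>x. x \<in> S \<Longrightarrow> h (free_gen x) = k (free_gen x)"
    and w: "w \<in> carrier (free_group S)"
  shows "h w = k w"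
proof -
  interpret h: group_hom "free_group S" H h
    using assms group_free_group by (simp add: group_hom_def group_hom_axioms_def)
  interpret k: group_hom "free_group S" H k
    using assms group_free_group by (simp add: group_hom_def group_hom_axioms_def)
  have gen: "g \<in> carrier (free_group S)" if "g \<in> generate (free_group S) (free_gen ` S)" for g
    using that by (simp add: generate_free_gen)
  have "w \<in> generate (free_group S) (free_gen ` S)"
    using w by (simp add: generate_free_gen)
  then show ?thesis
    by induction (auto simp: eq gen)
qed

definition free_lift :: "('b, 'c) monoid_scheme \<Rightarrow> ('a \<Rightarrow> 'b) \<Rightarrow> 'a letter list \<Rightarrow> 'b" where
  "free_lift H f w = foldr (\<lambda>(x, b) g. (if b then f x else inv\<^bsub>H\<^esub> f x) \<otimes>\<^bsub>H\<^esub> g) w \<one>\<^bsub>H\<^esub>"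

theorem free_lift:
  assumes H: "group H" and f: "f \<in> S \<rightarrow> carrier H"
  shows "free_lift H f \<in> hom (free_group S) H"
    and "x \<in> S \<Longrightarrow> free_lift H f (free_gen x) = f x"
proof -
  interpret H: group H by fact
  define val where "val = (\<lambda>(x, b). if b then f x else inv\<^bsub>H\<^esub> f x)"
  have lift_Cons: "free_lift H f (a # w) = val a \<otimes>\<^bsub>H\<^esub> free_lift H f w" for a w
    by (cases a) (simp add: free_lift_def val_def)
  have lift_Nil: "free_lift H f [] = \<one>\<^bsub>H\<^esub>"
    by (simp add: free_lift_def)
  have val_closed: "val a \<in> carrier H" if "fst a \<in> S" for a
    using that f by (cases a) (auto simp: val_def)
  have val_inv: "val (inv_letter a) = inv\<^bsub>H\<^esub> val a" if "fst a \<in> S" for a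
    using that f by (cases a) (auto simp: val_def inv_letter_def Pi_iff)
  have closed: "free_lift H f w \<in> carrier H" if "set w \<subseteq> S \<times> UNIV" for w
    using that by (induction w) (auto simp: lift_Cons lift_Nil intro!: H.m_closed val_closed)
  have cons: "free_lift H f (cons_reduce a w) = val a \<otimes>\<^bsub>H\<^esub> free_lift H f w"
    if "fst a \<in> S" "set w \<subseteq> S \<times> UNIV" for a w
  proof (cases w)
    case (Cons b u)
    with that have "free_lift H f u \<in> carrier H" by (auto intro: closed)
    with that Cons show ?thesis
      by (auto simp: lift_Cons val_inv val_closed H.m_assoc[symmetric])
  qed (simp add: lift_Cons)
  have mult: "free_lift H f (foldr cons_reduce v w) = free_lift H f v \<otimes>\<^bsub>H\<^esub> free_lift H f w"
    if "set v \<subseteq> S \<times> UNIV" "set w \<subseteq> S \<times> UNIV" for v w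
    using that(1)
  proof (induction v)
    case (Cons a v)
    then have a: "fst a \<in> S" and v: "set v \<subseteq> S \<times> UNIV" by auto
    have "set (foldr cons_reduce v w) \<subseteq> S \<times> UNIV"
      using foldr_cons_reduce_set[of v w] v that(2) by blast
    then show ?case
      using Cons.IH[OF v] a v that(2) by (simp add: cons lift_Cons val_closed closed H.m_assoc)
  qed (use that closed in \<open>simp add: lift_Nil\<close>)
  show "free_lift H f \<in> hom (free_group S) H"
    by (rule homI) (auto simp: carrier_free_group mult_free_group closed mult)
  show "free_lift H f (free_gen x) = f x" if "x \<in> S"
    using that f by (auto simp: free_gen_def lift_Cons lift_Nil val_def Pi_iff)
qed

subsection \<open>The action on the abelianization\<close>

lemma comm_group_abelianization: "group G \<Longrightarrow> comm_group (abelianization G)"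
  by (simp add: abelianization_def group.derived_quot_is_comm_group)

lemma abel_class_hom: "group G \<Longrightarrow> abel_class G \<in> hom G (abelianization G)"
  using normal.r_coset_hom_Mod[OF group.derived_self_is_normal, of G]
  by (simp add: abelianization_def abel_class_def[abs_def])

lemma carrier_abelianization: "carrier (abelianization G) = abel_class G ` carrier G"
  by (simp add: abelianization_def abel_class_def[abs_def] carrier_FactGroup)

lemma abel_class_in_carrier: "x \<in> carrier G \<Longrightarrow> abel_class G x \<in> carrier (abelianization G)"
  by (simp add: carrier_abelianization)

lemma abel_map_class:
  assumes "group G" "\<phi> \<in> auto G" "x \<in> carrier G"
  shows "abel_map G \<phi> (abel_class G x) = abel_class G (\<phi> x)"
proof -
  have \<phi>: "\<phi> \<in> hom G G" "\<phi> ` carrier G = carrier G"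
    using assms(2) by (auto simp: auto_def Bij_def bij_betw_def)
  interpret \<phi>: group_hom G G \<phi>
    using assms(1) \<phi>(1) by (simp add: group_hom_def group_hom_axioms_def)
  have D: "derived G (carrier G) \<subseteq> carrier G"
    by (simp add: group.derived_in_carrier assms(1))
  have "\<phi> ` derived G (carrier G) = derived G (carrier G)"
    using \<phi>.derived_img[of "carrier G"] by (simp add: \<phi>(2))
  moreover have "\<phi> ` (derived G (carrier G) #>\<^bsub>G\<^esub> x) = (\<phi> ` derived G (carrier G)) #>\<^bsub>G\<^esub> \<phi> x"
    using D assms(3) by (force simp: r_coset_def)
  ultimately show ?thesis
    using assms(3) by (simp add: abel_map_def abel_class_def abel_class_in_carrier[unfolded abel_class_def])
qed

definition exponent_sum :: "'a \<Rightarrow> 'a letter list \<Rightarrow> int" where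
  "exponent_sum x = free_lift integer_group (\<lambda>y. if y = x then 1 else 0)"

lemma exponent_sum_hom: "exponent_sum x \<in> hom (free_group S) integer_group"
  unfolding exponent_sum_def by (rule free_lift) auto

lemma exponent_sum_gen: "exponent_sum x (free_gen y) = (if y = x then 1 else 0)"
  unfolding exponent_sum_def by (rule free_lift(2)[where S = UNIV]) auto

lemma abel_class_coordinates:
  assumes w: "w \<in> carrier (free_group S)" and "finite S"
  shows "abel_class (free_group S) w =
    finprod (abelianization (free_group S))
      (\<lambda>x. abel_class (free_group S) (free_gen x) [^]\<^bsub>abelianization (free_group S)\<^esub> exponent_sum x w) S"
proof -
  let ?F = "free_group S" and ?e = "\<lambda>x. abel_class (free_group S) (free_gen x)"
  interpret A: comm_group "abelianization ?F"
    by (rule comm_group_abelianization[OF group_free_group])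
  have e: "?e x \<in> carrier (abelianization ?F)" if "x \<in> S" for x
    using that by (simp add: abel_class_in_carrier)
  show ?thesis
  proof (rule free_group_hom_eqI[OF A.is_group abel_class_hom[OF group_free_group] _ _ w])
    show "(\<lambda>w. finprod (abelianization ?F) (\<lambda>x. ?e x [^]\<^bsub>abelianization ?F\<^esub> exponent_sum x w) S)
            \<in> hom ?F (abelianization ?F)"
    proof (rule homI)
      fix u v assume uv: "u \<in> carrier ?F" "v \<in> carrier ?F"
      have "finprod (abelianization ?F)
              (\<lambda>x. ?e x [^]\<^bsub>abelianization ?F\<^esub> exponent_sum x (u \<otimes>\<^bsub>?F\<^esub> v)) S =
            finprod (abelianization ?F) (\<lambda>x. ?e x [^]\<^bsub>abelianization ?F\<^esub> exponent_sum x u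
              \<otimes>\<^bsub>abelianization ?F\<^esub> ?e x [^]\<^bsub>abelianization ?F\<^esub> exponent_sum x v) S"
        using uv e by (intro A.finprod_cong')
          (auto simp: hom_mult[OF exponent_sum_hom] A.int_pow_mult)
      then show "finprod (abelianization ?F)
              (\<lambda>x. ?e x [^]\<^bsub>abelianization ?F\<^esub> exponent_sum x (u \<otimes>\<^bsub>?F\<^esub> v)) S =
            finprod (abelianization ?F) (\<lambda>x. ?e x [^]\<^bsub>abelianization ?F\<^esub> exponent_sum x u) S
            \<otimes>\<^bsub>abelianization ?F\<^esub>
            finprod (abelianization ?F) (\<lambda>x. ?e x [^]\<^bsub>abelianization ?F\<^esub> exponent_sum x v) S"
        using e by (simp add: A.finprod_multf Pi_iff)
    qed (use e in \<open>auto intro!: A.finprod_closed\<close>)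
    fix y assume y: "y \<in> S"
    have "finprod (abelianization ?F) (\<lambda>x. ?e x [^]\<^bsub>abelianization ?F\<^esub> exponent_sum x (free_gen y)) S
        = finprod (abelianization ?F) (\<lambda>x. if y = x then ?e x else \<one>\<^bsub>abelianization ?F\<^esub>) S"
      using e by (intro A.finprod_cong') (auto simp: exponent_sum_gen)
    also have "\<dots> = ?e y"
      using y e \<open>finite S\<close> by (intro A.finprod_singleton) auto
    finally show "?e y =
      finprod (abelianization ?F) (\<lambda>x. ?e x [^]\<^bsub>abelianization ?F\<^esub> exponent_sum x (free_gen y)) S" ..
  qed
qed

lemma exponent_sum_factors:
  obtains k where "k \<in> hom (abelianization (free_group S)) integer_group"
    "\<And>w. w \<in> carrier (free_group S) \<Longrightarrow> k (abel_class (free_group S) w) = exponent_sum x w"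
proof -
  let ?F = "free_group S"
  interpret F: group ?F by (rule group_free_group)
  interpret x: group_hom ?F integer_group "exponent_sum x"
    by (simp add: group_hom_def group_hom_axioms_def group_free_group exponent_sum_hom)
  have D: "derived ?F (carrier ?F) \<subseteq> kernel ?F integer_group (exponent_sum x)"
    unfolding derived_def
    by (rule F.generate_subgroup_incl[OF _ x.subgroup_kernel]) (auto simp: kernel_def x.hom_mult)
  have "exponent_sum x u = exponent_sum x v"
    if uv: "u \<in> carrier ?F" "v \<in> carrier ?F"
      "derived ?F (carrier ?F) #>\<^bsub>?F\<^esub> u = derived ?F (carrier ?F) #>\<^bsub>?F\<^esub> v" for u v
  proof -
    have "u \<in> derived ?F (carrier ?F) #>\<^bsub>?F\<^esub> v"
      using F.rcos_self[OF uv(1) F.derived_is_subgroup[OF subset_refl]] uv(3) by simp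
    then obtain d where "d \<in> derived ?F (carrier ?F)" "u = d \<otimes>\<^bsub>?F\<^esub> v"
      by (auto simp: r_coset_def)
    with D uv(2) show ?thesis
      by (auto simp: kernel_def x.hom_mult)
  qed
  from FactGroup_universal[OF exponent_sum_hom F.derived_self_is_normal this] that show thesis
    unfolding abelianization_def abel_class_def by metis
qed

text \<open>The classes of the free generators are a basis of the abelianization, so the definite description
  in \<^const>\<open>abel_matrix\<close> is well defined.\<close>

lemma abel_coordinates_unique:
  fixes c d :: "'a \<Rightarrow> int"
  assumes "finite S" "x \<in> S"
    and eq: "finprod (abelianization (free_group S))
        (\<lambda>x. abel_class (free_group S) (free_gen x) [^]\<^bsub>abelianization (free_group S)\<^esub> c x) S =
      finprod (abelianization (free_group S))
        (\<lambda>x. abel_class (free_group S) (free_gen x) [^]\<^bsub>abelianization (free_group S)\<^esub> d x) S"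
  shows "c x = d x"
proof -
  let ?A = "abelianization (free_group S)" and ?e = "\<lambda>x. abel_class (free_group S) (free_gen x)"
  interpret A: comm_group ?A
    by (rule comm_group_abelianization[OF group_free_group])
  obtain k where k: "k \<in> hom ?A integer_group"
    "\<And>w. w \<in> carrier (free_group S) \<Longrightarrow> k (abel_class (free_group S) w) = exponent_sum x w"
    by (rule exponent_sum_factors[where S = S and x = x]) (rule that)
  interpret k: group_hom ?A integer_group k
    using k(1) by (simp add: group_hom_def group_hom_axioms_def)
  have "k (finprod ?A (\<lambda>x. ?e x [^]\<^bsub>?A\<^esub> c x) T) = (\<Sum>y\<in>T. c y * exponent_sum x (free_gen y))"
    if "T \<subseteq> S" for T and c :: "'a \<Rightarrow> int"
    using finite_subset[OF that \<open>finite S\<close>] that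
  proof (induction T rule: finite_induct)
    case empty
    show ?case using k.hom_one by simp
  next
    case (insert y T)
    then have "?e z \<in> carrier ?A" if "z \<in> insert y T" for z
      using that by (auto intro!: abel_class_in_carrier)
    with insert show ?case
      by (simp add: Pi_iff k.hom_mult k.hom_int_pow k(2))
  qed
  then have "k (finprod ?A (\<lambda>x. ?e x [^]\<^bsub>?A\<^esub> c x) S) = c x" for c :: "'a \<Rightarrow> int"
    using \<open>finite S\<close> \<open>x \<in> S\<close> by (simp add: exponent_sum_gen if_distrib cong: if_cong)
  from this[of c] this[of d] eq show ?thesis by simp
qed

theorem abel_matrix_eq:
  assumes "\<phi> \<in> auto (free_group {..<n})"
  shows "abel_matrix n \<phi> = mat n n (\<lambda>(i, j). exponent_sum i (\<phi> (free_gen j)))"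
proof -
  have im: "\<phi> (free_gen j) \<in> carrier (free_group {..<n})" if "j < n" for j
    using assms that by (auto simp: auto_def hom_def Pi_iff)
  interpret A: comm_group "abelianization (free_group {..<n})"
    by (rule comm_group_abelianization[OF group_free_group])
  have e: "abel_class (free_group {..<n}) (free_gen i) \<in> carrier (abelianization (free_group {..<n}))"
    if "i < n" for i
    using that by (simp add: abel_class_in_carrier)
  show ?thesis
    unfolding abel_matrix_def Let_def
  proof (rule the_equality, intro conjI allI impI)
    fix j assume "j < n"
    then show "abel_map (free_group {..<n}) \<phi> (abel_class (free_group {..<n}) (free_gen j)) =
      finprod (abelianization (free_group {..<n}))
        (\<lambda>i. abel_class (free_group {..<n}) (free_gen i) [^]\<^bsub>abelianization (free_group {..<n})\<^esub>
          (mat n n (\<lambda>(i, j). exponent_sum i (\<phi> (free_gen j))) $$ (i, j))) {..<n}"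
      using abel_map_class[OF group_free_group assms, of "free_gen j"] im e
      by (simp add: abel_class_coordinates[OF im finite_lessThan])
         (intro A.finprod_cong', auto)
  next
    fix M :: "int mat" assume M: "M \<in> carrier_mat n n \<and>
      (\<forall>j<n. abel_map (free_group {..<n}) \<phi> (abel_class (free_group {..<n}) (free_gen j)) =
        finprod (abelianization (free_group {..<n}))
          (\<lambda>i. abel_class (free_group {..<n}) (free_gen i)
            [^]\<^bsub>abelianization (free_group {..<n})\<^esub> (M $$ (i, j))) {..<n})"
    show "M = mat n n (\<lambda>(i, j). exponent_sum i (\<phi> (free_gen j)))"
    proof (rule eq_matI)
      fix i j assume "i < dim_row (mat n n (\<lambda>(i, j). exponent_sum i (\<phi> (free_gen j))))"
        "j < dim_col (mat n n (\<lambda>(i, j). exponent_sum i (\<phi> (free_gen j))))"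
      then have ij: "i < n" "j < n" by auto
      have "M $$ (i, j) = exponent_sum i (\<phi> (free_gen j))"
      proof (rule abel_coordinates_unique[where S = "{..<n}" and c = "\<lambda>i. M $$ (i, j)"])
        show "finprod (abelianization (free_group {..<n}))
            (\<lambda>i. abel_class (free_group {..<n}) (free_gen i)
              [^]\<^bsub>abelianization (free_group {..<n})\<^esub> (M $$ (i, j))) {..<n} =
          finprod (abelianization (free_group {..<n}))
            (\<lambda>i. abel_class (free_group {..<n}) (free_gen i)
              [^]\<^bsub>abelianization (free_group {..<n})\<^esub> exponent_sum i (\<phi> (free_gen j))) {..<n}"
          using M ij(2) abel_map_class[OF group_free_group assms, of "free_gen j"]
            abel_class_coordinates[OF im[OF ij(2)] finite_lessThan] by simp
      qed (use ij in auto)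
      then show "M $$ (i, j) = mat n n (\<lambda>(i, j). exponent_sum i (\<phi> (free_gen j))) $$ (i, j)"
        using ij by simp
    qed (use M in auto)
  qed simp
qed


subsection \<open>The maps to \<open>GL\<^sub>n(\<int>)\<close> and to \<open>{-1, 1}\<close>\<close>

lemma carrier_AutoGroup: "carrier (AutoGroup G) = auto G"
  by (simp add: AutoGroup_def)

lemma mult_AutoGroup:
  "\<phi> \<in> auto G \<Longrightarrow> \<psi> \<in> auto G \<Longrightarrow> \<phi> \<otimes>\<^bsub>AutoGroup G\<^esub> \<psi> = compose (carrier G) \<phi> \<psi>"
  by (simp add: AutoGroup_def BijGroup_def auto_def)

lemma one_AutoGroup: "\<one>\<^bsub>AutoGroup G\<^esub> = (\<lambda>x \<in> carrier G. x)"
  by (simp add: AutoGroup_def BijGroup_def)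

lemma exponent_sum_map:
  assumes "\<phi> \<in> hom (free_group S) (free_group S)" "finite S" "w \<in> carrier (free_group S)"
  shows "exponent_sum x (\<phi> w) = (\<Sum>y\<in>S. exponent_sum x (\<phi> (free_gen y)) * exponent_sum y w)"
proof (rule free_group_hom_eqI[OF group_integer_group _ _ _ assms(3)])
  show "(\<lambda>w. exponent_sum x (\<phi> w)) \<in> hom (free_group S) integer_group"
    using hom_compose[OF assms(1) exponent_sum_hom] by (simp add: comp_def)
  show "(\<lambda>w. \<Sum>y\<in>S. exponent_sum x (\<phi> (free_gen y)) * exponent_sum y w)
      \<in> hom (free_group S) integer_group"
    by (rule homI) (auto simp: hom_mult[OF exponent_sum_hom] algebra_simps sum.distrib)
qed (use assms(2) in \<open>simp add: exponent_sum_gen if_distrib cong: if_cong\<close>)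

lemma abel_matrix_carrier:
  "\<phi> \<in> auto (free_group {..<n}) \<Longrightarrow> abel_matrix n \<phi> \<in> carrier_mat n n"
  by (simp add: abel_matrix_eq)

lemma abel_matrix_one: "abel_matrix n \<one>\<^bsub>AutoGroup (free_group {..<n})\<^esub> = 1\<^sub>m n"
  by (rule eq_matI)
     (auto simp: abel_matrix_eq one_AutoGroup group.id_in_auto[OF group_free_group] exponent_sum_gen)

lemma abel_matrix_mult:
  assumes "\<phi> \<in> auto (free_group {..<n})" "\<psi> \<in> auto (free_group {..<n})"
  shows "abel_matrix n (\<phi> \<otimes>\<^bsub>AutoGroup (free_group {..<n})\<^esub> \<psi>) = abel_matrix n \<phi> * abel_matrix n \<psi>"
proof -
  have comp: "\<phi> \<otimes>\<^bsub>AutoGroup (free_group {..<n})\<^esub> \<psi> \<in> auto (free_group {..<n})"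
    using group.AutoGroup[OF group_free_group] assms
    by (metis carrier_AutoGroup group.is_monoid monoid.m_closed)
  have \<phi>: "\<phi> \<in> hom (free_group {..<n}) (free_group {..<n})"
    using assms by (simp add: auto_def)
  have \<psi>: "\<psi> (free_gen j) \<in> carrier (free_group {..<n})" if "j < n" for j
    using assms that by (auto simp: auto_def hom_def Pi_iff)
  show ?thesis
    by (rule eq_matI)
       (use assms comp in \<open>auto simp: abel_matrix_eq mult_AutoGroup compose_def scalar_prod_def
          exponent_sum_map[OF \<phi> finite_lessThan \<psi>] lessThan_atLeast0\<close>)
qed

theorem abel_matrix_hom: "abel_matrix n \<in> hom (AutoGroup (free_group {..<n})) (GL_int n)"
proof (rule homI)
  let ?Aut = "AutoGroup (free_group {..<n})"
  interpret Aut: group ?Aut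
    by (rule group.AutoGroup[OF group_free_group])
  fix \<phi> assume \<phi>: "\<phi> \<in> carrier ?Aut"
  have "abel_matrix n (inv\<^bsub>?Aut\<^esub> \<phi>) * abel_matrix n \<phi> = 1\<^sub>m n"
    "abel_matrix n \<phi> * abel_matrix n (inv\<^bsub>?Aut\<^esub> \<phi>) = 1\<^sub>m n"
    using \<phi> by (simp_all flip: abel_matrix_mult add: abel_matrix_one carrier_AutoGroup[symmetric])
  moreover have "abel_matrix n (inv\<^bsub>?Aut\<^esub> \<phi>) \<in> carrier_mat n n" "abel_matrix n \<phi> \<in> carrier_mat n n"
    using \<phi> by (simp_all add: abel_matrix_carrier carrier_AutoGroup[symmetric])
  ultimately show "abel_matrix n \<phi> \<in> carrier (GL_int n)"
    by (auto simp: GL_int_def units_of_def Units_def ring_mat_def)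
qed (simp add: GL_int_def units_of_def ring_mat_def abel_matrix_mult carrier_AutoGroup)

theorem det_hom: "det \<in> hom (GL_int n) sign_img"
proof (rule homI)
  fix M assume "M \<in> carrier (GL_int n)"
  then obtain N where M: "M \<in> carrier_mat n n" and N: "N \<in> carrier_mat n n" and "N * M = 1\<^sub>m n"
    by (auto simp: GL_int_def units_of_def Units_def ring_mat_def)
  then have "det N * det M = 1"
    by (metis det_mult det_one)
  then show "det M \<in> carrier sign_img"
    by (auto simp: sign_img_def zmult_eq_1_iff)
qed (auto simp: GL_int_def units_of_def Units_def ring_mat_def sign_img_def det_mult)

theorem SAut_subgroup: "subgroup (carrier (SAut n)) (AutoGroup (free_group {..<n}))"
proof -
  have "det \<circ> abel_matrix n \<in> hom (AutoGroup (free_group {..<n})) sign_img"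
    by (rule hom_compose[OF abel_matrix_hom det_hom])
  then have "group_hom (AutoGroup (free_group {..<n})) sign_img (det \<circ> abel_matrix n)"
    by (simp add: group_hom_def group_hom_axioms_def sign_img_is_group
        group.AutoGroup[OF group_free_group])
  from group_hom.subgroup_kernel[OF this] show ?thesis
    by (simp add: SAut_def)
qed

corollary group_SAut: "group (SAut n)"
  using subgroup.subgroup_is_group[OF SAut_subgroup group.AutoGroup[OF group_free_group]]
  by (simp add: SAut_def)

end

theory Submission
  imports Defs "HOL-Library.Z2" "HOL-Library.Product_Plus"
begin

text \<open>
  Nielsen reduction shows that \<open>SAut(F\<^sub>5)\<close> is generated by the transvections
  \<open>L\<^sub>i\<^sub>j: x\<^sub>i \<mapsto> x\<^sub>j x\<^sub>i\<close> and \<open>R\<^sub>i\<^sub>j: x\<^sub>i \<mapsto> x\<^sub>i x\<^sub>j\<close>; all \<open>L\<^sub>i\<^sub>j\<close> are conjugate. Let them act on fewer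
  than 18 points. If \<open>L\<^sub>0\<^sub>1\<close> acts with odd order, it has at most five nontrivial cycles, and the
  transvections commuting with it permute these cycles. In a symmetric group of degree five,
  commuting is transitive among nontrivial permutations of odd order, which makes \<open>L\<^sub>2\<^sub>1\<close> trivial on the
  support of \<open>L\<^sub>0\<^sub>1\<close>. But \<open>L\<^sub>0\<^sub>1 L\<^sub>2\<^sub>1\<close> is conjugate to \<open>L\<^sub>2\<^sub>1\<close>, so both have empty support.
  If the order is even, powers of \<open>L\<^sub>p\<^sub>a, L\<^sub>q\<^sub>a, L\<^sub>r\<^sub>a, L\<^sub>t\<^sub>a\<close> generate an elementary abelian group of
  order 16 whose nontrivial elements all move the same number of points. Burnside's lemma makes
  this number 16, so the group is regular on 16 points and contains everything that commutes with
  it. This forces \<open>L\<^sub>i\<^sub>j = R\<^sub>i\<^sub>j\<close> to be involutions; then \<open>L\<^sub>3\<^sub>4\<close> acts affinely on the 16 points, and it or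
  its product with \<open>L\<^sub>3\<^sub>0\<close>, both conjugates of \<open>L\<^sub>1\<^sub>0\<close>, has a fixed point there, a contradiction.
\<close>


section \<open>Transvections\<close>

text \<open>The bound 18 enters twice. Six nontrivial cycles of odd length would need 18 points; and
  a group regular on 16 of at most 17 points leaves at most one point over, so a permutation
  commuting with the group has no freedom outside its orbit. Rank five supplies four commuting
  transvections \<open>L i a\<close> for each \<open>a\<close>, whence 16 = 2^4, together with spare
  indices for conjugations. In the odd case the obstacle is that commuting is not transitive among
  permutations of 17 points. Passing to the cycles of one transvection lowers the degree to five;
  the way back from cycles to points is that permutations commuting with \<open>L 0 1\<close> and
  preserving each of its cycles act on every cycle as powers of \<open>L 0 1\<close>, so their
  commutators vanish on its support. In the even case the obstacle is that \<open>L i j\<close> and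
  \<open>L i k\<close> need not commute. Since \<open>L i j\<close> always commutes with
  \<open>R i k\<close>, the equality of left and right transvections removes it, and
  \<open>L 3 4\<close> then normalizes the group of order 16.\<close>

definition inv_word :: "'a letter list \<Rightarrow> 'a letter list" where
  "inv_word w = map inv_letter (rev w)"

lemma inv_word_simps [simp]:
  "inv_word [] = []" "inv_word (a # w) = inv_word w @ [inv_letter a]"
  "inv_word (v @ w) = inv_word w @ inv_word v" "length (inv_word w) = length w"
  "inv_word w = [] \<longleftrightarrow> w = []" "inv_word (inv_word w) = w"
  by (auto simp: inv_word_def rev_map comp_def)

lemma freely_reduced_append:
  "freely_reduced (v @ w) \<longleftrightarrow> freely_reduced v \<and> freely_reduced w \<and>
     (v = [] \<or> w = [] \<or> hd w \<noteq> inv_letter (last v))"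
  by (auto simp: freely_reduced_def successively_append_iff)

lemma freely_reduced_inv_word [simp]: "freely_reduced (inv_word w) \<longleftrightarrow> freely_reduced w"
proof -
  have "(\<lambda>a b. inv_letter a \<noteq> inv_letter (inv_letter b)) = (\<lambda>(a :: 'a letter) b. b \<noteq> inv_letter a)"
    by (auto simp: fun_eq_iff)
  then show ?thesis
    unfolding freely_reduced_def inv_word_def successively_map successively_rev by metis
qed

lemma set_inv_word: "set (inv_word w) \<subseteq> S \<times> UNIV \<longleftrightarrow> set w \<subseteq> S \<times> UNIV"
proof -
  have "A \<subseteq> S \<times> UNIV \<longleftrightarrow> (\<forall>a \<in> A. fst a \<in> S)" for A :: "'a letter set"
    by fastforce
  then show ?thesis
    by (simp add: inv_word_def)
qed

lemma inv_word_closed [simp]: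
  "inv_word w \<in> carrier (free_group S) \<longleftrightarrow> w \<in> carrier (free_group S)"
  by (simp add: carrier_free_group set_inv_word)

lemma foldr_cons_reduce_append:
  "freely_reduced (v @ w) \<Longrightarrow> foldr cons_reduce v w = v @ w"
  by (induction v) (auto simp: freely_reduced_Cons cons_reduce_Cons)

lemma foldr_cons_reduce_inv_cancel:
  "freely_reduced w \<Longrightarrow> foldr cons_reduce c (foldr cons_reduce (inv_word c) w) = w"
  by (induction c arbitrary: w) (auto simp: cons_reduce_inv cons_reduce_reduced)

lemma inv_free_group:
  assumes "w \<in> carrier (free_group S)"
  shows "inv\<^bsub>free_group S\<^esub> w = inv_word w"
proof (rule group.inv_equality[OF group_free_group])
  show "inv_word w \<otimes>\<^bsub>free_group S\<^esub> w = \<one>\<^bsub>free_group S\<^esub>"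
    using foldr_cons_reduce_inv_cancel[of "[]" "inv_word w"] assms
    by (simp add: mult_free_group one_free_group carrier_free_group foldr_cons_reduce_Nil)
qed (use assms in auto)

section \<open>Endomorphisms of the free group as word substitutions\<close>

fun subst_letter :: "('a \<Rightarrow> 'a letter list) \<Rightarrow> 'a letter \<Rightarrow> 'a letter list" where
  "subst_letter f (x, b) = (if b then f x else inv_word (f x))"

text \<open>On the carrier this agrees with \<open>free_lift\<close> into the free group itself, but
  formal inverses \<open>inv_word\<close> replace the group inverse, so that simplification can
  evaluate it on concrete words.\<close>

definition subst :: "('a \<Rightarrow> 'a letter list) \<Rightarrow> 'a letter list \<Rightarrow> 'a letter list" where
  "subst f w = foldr (\<lambda>a. foldr cons_reduce (subst_letter f a)) w []"

lemma subst_simps [simp]: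
  "subst f [] = []"
  "subst f (a # w) = foldr cons_reduce (subst_letter f a) (subst f w)"
  by (simp_all add: subst_def)

lemma hom_eq_subst:
  assumes "\<phi> \<in> hom (free_group S) (free_group S)" "w \<in> carrier (free_group S)"
  shows "\<phi> w = subst (\<lambda>x. \<phi> (free_gen x)) w"
proof -
  let ?F = "free_group S"
  interpret \<phi>: group_hom ?F ?F \<phi>
    using assms(1) by (simp add: group_hom_def group_hom_axioms_def group_free_group)
  have letter: "\<phi> [a] = subst_letter (\<lambda>x. \<phi> (free_gen x)) a" if "fst a \<in> S" for a
  proof (cases a)
    case (Pair x b)
    have "inv\<^bsub>?F\<^esub> free_gen x = inv_word (free_gen x)"
      using that Pair by (intro inv_free_group) simp
    then have "[(x, True)] = free_gen x" "[(x, False)] = inv\<^bsub>?F\<^esub> free_gen x"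
      by (simp_all add: free_gen_def inv_letter_def)
    then show ?thesis
      using that Pair \<phi>.hom_inv[of "free_gen x"] inv_free_group[of "\<phi> (free_gen x)" S]
      by (cases b) auto
  qed
  show ?thesis
    using assms(2)
  proof (induction w)
    case Nil
    then show ?case
      using \<phi>.hom_one by (simp add: one_free_group)
  next
    case (Cons a w)
    then have w: "w \<in> carrier ?F" and a: "fst a \<in> S" "[a] \<in> carrier ?F"
      by (auto simp: carrier_free_group freely_reduced_Cons)
    have "a # w = [a] \<otimes>\<^bsub>?F\<^esub> w"
      using Cons.prems by (simp add: mult_free_group carrier_free_group cons_reduce_Cons)
    then have "\<phi> (a # w) = \<phi> [a] \<otimes>\<^bsub>?F\<^esub> \<phi> w"
      using w a by simp
    then show ?case
      using Cons.IH[OF w] letter[OF a(1)] by (simp add: mult_free_group)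
  qed
qed

text \<open>The restriction to the carrier is there because members of \<open>auto\<close> must be
  extensional.\<close>

definition endo :: "'a set \<Rightarrow> ('a \<Rightarrow> 'a letter list) \<Rightarrow> 'a letter list \<Rightarrow> 'a letter list" where
  "endo S f = (\<lambda>w \<in> carrier (free_group S). free_lift (free_group S) f w)"

lemma endo_hom:
  assumes "f \<in> S \<rightarrow> carrier (free_group S)"
  shows "endo S f \<in> hom (free_group S) (free_group S)"
  using free_lift(1)[OF group_free_group assms] monoid.m_closed[OF group.is_monoid[OF group_free_group]]
  by (auto simp: endo_def hom_def)

lemma endo_gen:
  assumes "f \<in> S \<rightarrow> carrier (free_group S)" "x \<in> S"
  shows "endo S f (free_gen x) = f x"
  using free_lift(2)[OF group_free_group assms] assms(2) by (simp add: endo_def)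

lemma endo_subst:
  assumes "f \<in> S \<rightarrow> carrier (free_group S)" "w \<in> carrier (free_group S)"
  shows "endo S f w = subst f w"
proof -
  have "subst (\<lambda>x. endo S f (free_gen x)) w = subst f w"
    using assms(2) by (induction w) (auto simp: carrier_free_group freely_reduced_Cons endo_gen[OF assms(1)])
  then show ?thesis
    using hom_eq_subst[OF endo_hom[OF assms(1)] assms(2)] by simp
qed

lemma auto_eqI:
  assumes "\<phi> \<in> auto (free_group S)" "\<psi> \<in> auto (free_group S)"
    and "\<And>x. x \<in> S \<Longrightarrow> \<phi> (free_gen x) = \<psi> (free_gen x)"
  shows "\<phi> = \<psi>"
proof (rule extensionalityI)
  show "\<phi> w = \<psi> w" if "w \<in> carrier (free_group S)" for w
    by (rule free_group_hom_eqI[OF group_free_group _ _ _ that])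
       (use assms in \<open>auto simp: auto_def\<close>)
qed (use assms in \<open>auto simp: auto_def Bij_def\<close>)

lemma endo_auto:
  assumes f: "f \<in> S \<rightarrow> carrier (free_group S)" and g: "g \<in> S \<rightarrow> carrier (free_group S)"
    and fg: "\<And>x. x \<in> S \<Longrightarrow> subst f (g x) = free_gen x"
    and gf: "\<And>x. x \<in> S \<Longrightarrow> subst g (f x) = free_gen x"
  shows "endo S f \<in> auto (free_group S)"
proof -
  let ?F = "free_group S"
  have id: "endo S f (endo S g w) = w"
    if f: "f \<in> S \<rightarrow> carrier ?F" and g: "g \<in> S \<rightarrow> carrier ?F"
      and fg: "\<And>x. x \<in> S \<Longrightarrow> subst f (g x) = free_gen x" and w: "w \<in> carrier ?F" for f g w
  proof -
    have "(endo S f \<circ> endo S g) w = id w"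
    proof (rule free_group_hom_eqI[OF group_free_group _ _ _ w])
      show "endo S f \<circ> endo S g \<in> hom ?F ?F"
        by (intro hom_compose[OF endo_hom endo_hom] f g)
      show "id \<in> hom ?F ?F"
        by (simp add: hom_def)
      fix x assume "x \<in> S"
      then show "(endo S f \<circ> endo S g) (free_gen x) = id (free_gen x)"
        using fg g endo_subst[OF f, of "g x"] by (auto simp: endo_gen[OF g])
    qed
    then show ?thesis by simp
  qed
  have cl: "endo S f \<in> carrier ?F \<rightarrow> carrier ?F" "endo S g \<in> carrier ?F \<rightarrow> carrier ?F"
    using endo_hom[OF f] endo_hom[OF g] by (auto simp: hom_def)
  have "bij_betw (endo S f) (carrier ?F) (carrier ?F)"
    by (rule bij_betw_byWitness[where f' = "endo S g"])
       (use id[OF f g fg] id[OF g f gf] cl in auto)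
  then show ?thesis
    using endo_hom[OF f] by (auto simp: auto_def Bij_def endo_def)
qed

text \<open>The multiplier is a letter rather than a generator: inverting the letter inverts the
  map, and Nielsen moves come with both signs.\<close>

definition lmul :: "'a set \<Rightarrow> 'a letter \<Rightarrow> 'a \<Rightarrow> 'a letter list \<Rightarrow> 'a letter list" where
  "lmul S a i = endo S (\<lambda>m. if m = i then [a, (i, True)] else [(m, True)])"

definition rmul :: "'a set \<Rightarrow> 'a letter \<Rightarrow> 'a \<Rightarrow> 'a letter list \<Rightarrow> 'a letter list" where
  "rmul S a i = endo S (\<lambda>m. if m = i then [(i, True), a] else [(m, True)])"

lemma lmul_fun:
  "i \<in> S \<Longrightarrow> fst a \<in> S \<Longrightarrow> fst a \<noteq> i \<Longrightarrow>
    (\<lambda>m. if m = i then [a, (i, True)] else [(m, True)]) \<in> S \<rightarrow> carrier (free_group S)"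
  by (cases a) (auto simp: carrier_free_group freely_reduced_Cons inv_letter_def)

lemma rmul_fun:
  "i \<in> S \<Longrightarrow> fst a \<in> S \<Longrightarrow> fst a \<noteq> i \<Longrightarrow>
    (\<lambda>m. if m = i then [(i, True), a] else [(m, True)]) \<in> S \<rightarrow> carrier (free_group S)"
  by (cases a) (auto simp: carrier_free_group freely_reduced_Cons inv_letter_def)

lemma lmul_auto:
  assumes "i \<in> S" "fst a \<in> S" "fst a \<noteq> i"
  shows "lmul S a i \<in> auto (free_group S)"
  unfolding lmul_def
  by (rule endo_auto[OF lmul_fun lmul_fun[where a = "inv_letter a"]])
     (use assms in \<open>cases a; auto simp: free_gen_def inv_letter_def\<close>)+

lemma rmul_auto:
  assumes "i \<in> S" "fst a \<in> S" "fst a \<noteq> i"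
  shows "rmul S a i \<in> auto (free_group S)"
  unfolding rmul_def
  by (rule endo_auto[OF rmul_fun rmul_fun[where a = "inv_letter a"]])
     (use assms in \<open>cases a; auto simp: free_gen_def inv_letter_def\<close>)+

lemma mul_gen:
  assumes "i \<in> S" "fst a \<in> S" "fst a \<noteq> i" "x \<in> S"
  shows "lmul S a i (free_gen x) = (if x = i then [a, (i, True)] else [(x, True)])"
    and "rmul S a i (free_gen x) = (if x = i then [(i, True), a] else [(x, True)])"
  using endo_gen[OF lmul_fun[OF assms(1-3)] assms(4)] endo_gen[OF rmul_fun[OF assms(1-3)] assms(4)]
  by (auto simp: lmul_def rmul_def)

lemma mul_subst:
  assumes "i \<in> S" "fst a \<in> S" "fst a \<noteq> i" "w \<in> carrier (free_group S)"
  shows "lmul S a i w = subst (\<lambda>m. if m = i then [a, (i, True)] else [(m, True)]) w"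
    and "rmul S a i w = subst (\<lambda>m. if m = i then [(i, True), a] else [(m, True)]) w"
  using endo_subst[OF lmul_fun[OF assms(1-3)] assms(4)] endo_subst[OF rmul_fun[OF assms(1-3)] assms(4)]
  by (auto simp: lmul_def rmul_def)

lemma exponent_sum_letters:
  "exponent_sum x [] = 0"
  "exponent_sum x ((y, b) # w) = (if y = x then if b then 1 else - 1 else 0) + exponent_sum x w"
  by (auto simp: exponent_sum_def free_lift_def)

lemma carrier_SAut:
  "\<phi> \<in> carrier (SAut n) \<longleftrightarrow> \<phi> \<in> auto (free_group {..<n}) \<and> det (abel_matrix n \<phi>) = 1"
  by (auto simp: SAut_def kernel_def carrier_AutoGroup sign_img_def)

text \<open>The induced matrix is elementary, with a single off-diagonal entry \<open>1\<close> or
  \<open>- 1\<close>, hence of determinant 1.\<close>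

lemma mul_SAut:
  assumes "i < n" "fst a < n" "fst a \<noteq> i"
  shows "lmul {..<n} a i \<in> carrier (SAut n)" "rmul {..<n} a i \<in> carrier (SAut n)"
proof -
  obtain j b where a: "a = (j, b)" by (cases a)
  have "abel_matrix n (lmul {..<n} a i) = addrow_mat n (if b then 1 else - 1) j i"
    "abel_matrix n (rmul {..<n} a i) = addrow_mat n (if b then 1 else - 1) j i"
    using assms a
    by (auto simp: abel_matrix_eq lmul_auto rmul_auto addrow_mat_def mul_gen exponent_sum_letters
        intro!: cong_mat)
  with assms a show "lmul {..<n} a i \<in> carrier (SAut n)" "rmul {..<n} a i \<in> carrier (SAut n)"
    by (auto simp: carrier_SAut lmul_auto rmul_auto det_addrow_mat)
qed

lemma mult_SAut:
  "\<phi> \<in> carrier (SAut n) \<Longrightarrow> \<psi> \<in> carrier (SAut n) \<Longrightarrow>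
    \<phi> \<otimes>\<^bsub>SAut n\<^esub> \<psi> = compose (carrier (free_group {..<n})) \<phi> \<psi>"
  by (simp add: SAut_def kernel_def carrier_AutoGroup mult_AutoGroup)

lemma one_SAut: "\<one>\<^bsub>SAut n\<^esub> = (\<lambda>x \<in> carrier (free_group {..<n}). x)"
  by (simp add: SAut_def one_AutoGroup)

lemma mult_SAut_gen:
  "\<phi> \<in> carrier (SAut n) \<Longrightarrow> \<psi> \<in> carrier (SAut n) \<Longrightarrow> x < n \<Longrightarrow>
    (\<phi> \<otimes>\<^bsub>SAut n\<^esub> \<psi>) (free_gen x) = \<phi> (\<psi> (free_gen x))"
  by (simp add: mult_SAut compose_def)

lemma SAut_eqI:
  assumes "\<phi> \<in> carrier (SAut n)" "\<psi> \<in> carrier (SAut n)"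
    and "\<And>x. x < n \<Longrightarrow> \<phi> (free_gen x) = \<psi> (free_gen x)"
  shows "\<phi> = \<psi>"
  using assms by (intro auto_eqI[of _ "{..<n}"]) (auto simp: carrier_SAut)

lemma one_SAut_gen: "x < n \<Longrightarrow> \<one>\<^bsub>SAut n\<^esub> (free_gen x) = [(x, True)]"
  by (simp add: one_SAut) (simp add: free_gen_def)

lemma SAut_m_closed:
  "\<phi> \<in> carrier (SAut n) \<Longrightarrow> \<psi> \<in> carrier (SAut n) \<Longrightarrow> \<phi> \<otimes>\<^bsub>SAut n\<^esub> \<psi> \<in> carrier (SAut n)"
  by (rule monoid.m_closed[OF group.is_monoid[OF group_SAut]])

definition left_tv :: "nat \<Rightarrow> nat \<Rightarrow> nat \<Rightarrow> nat letter list \<Rightarrow> nat letter list" where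
  "left_tv n i j = lmul {..<n} (j, True) i"

definition right_tv :: "nat \<Rightarrow> nat \<Rightarrow> nat \<Rightarrow> nat letter list \<Rightarrow> nat letter list" where
  "right_tv n i j = rmul {..<n} (j, True) i"

lemma tv_closed:
  assumes "i < n" "j < n" "i \<noteq> j"
  shows "left_tv n i j \<in> carrier (SAut n)" "right_tv n i j \<in> carrier (SAut n)"
  using assms by (auto simp: left_tv_def right_tv_def intro!: mul_SAut)

text \<open>Together with \<open>SAut_eqI\<close> these rules prove an identity between products of
  transvections by computing both sides on each free generator, with symbolic distinct
  indices.\<close>

lemmas tv_eval = SAut_m_closed tv_closed mult_SAut_gen left_tv_def right_tv_def mul_gen mul_subst
  carrier_free_group freely_reduced_Cons inv_letter_def mul_SAut

section \<open>Commutation and Steinberg relations, signed swaps\<close>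

lemma tv_commute:
  assumes "i < n" "j < n" "k < n" "i \<noteq> j" "i \<noteq> k" "j \<noteq> k"
  shows "left_tv n i j \<otimes>\<^bsub>SAut n\<^esub> left_tv n k j = left_tv n k j \<otimes>\<^bsub>SAut n\<^esub> left_tv n i j"
    and "left_tv n i j \<otimes>\<^bsub>SAut n\<^esub> right_tv n k j = right_tv n k j \<otimes>\<^bsub>SAut n\<^esub> left_tv n i j"
    and "left_tv n i j \<otimes>\<^bsub>SAut n\<^esub> right_tv n i k = right_tv n i k \<otimes>\<^bsub>SAut n\<^esub> left_tv n i j"
  by (rule SAut_eqI[where n = n]; use assms in \<open>auto simp: tv_eval\<close>)+

lemma tv_commute_self:
  assumes "i < n" "j < n" "i \<noteq> j"
  shows "left_tv n i j \<otimes>\<^bsub>SAut n\<^esub> right_tv n i j = right_tv n i j \<otimes>\<^bsub>SAut n\<^esub> left_tv n i j"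
  by (rule SAut_eqI[where n = n]; use assms in \<open>auto simp: tv_eval\<close>)

lemma tv_commute_disjoint:
  assumes "i < n" "j < n" "k < n" "l < n" "distinct [i, j, k, l]"
  shows "left_tv n i j \<otimes>\<^bsub>SAut n\<^esub> left_tv n k l = left_tv n k l \<otimes>\<^bsub>SAut n\<^esub> left_tv n i j"
    and "left_tv n i j \<otimes>\<^bsub>SAut n\<^esub> right_tv n k l = right_tv n k l \<otimes>\<^bsub>SAut n\<^esub> left_tv n i j"
    and "right_tv n i j \<otimes>\<^bsub>SAut n\<^esub> right_tv n k l = right_tv n k l \<otimes>\<^bsub>SAut n\<^esub> right_tv n i j"
  by (rule SAut_eqI[where n = n]; use assms in \<open>auto simp: tv_eval\<close>)+

text \<open>In each relation one transvection conjugates another into a product of two. The form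
  without inverses transfers directly to compositions of permutations; the two mixed relations tie
  right transvections to left ones.\<close>

lemma tv_steinberg:
  assumes "i < n" "j < n" "k < n" "i \<noteq> j" "i \<noteq> k" "j \<noteq> k"
  shows "left_tv n j k \<otimes>\<^bsub>SAut n\<^esub> left_tv n i j = left_tv n i j \<otimes>\<^bsub>SAut n\<^esub> (left_tv n j k \<otimes>\<^bsub>SAut n\<^esub> left_tv n i k)"
    and "right_tv n j k \<otimes>\<^bsub>SAut n\<^esub> right_tv n i j = right_tv n i j \<otimes>\<^bsub>SAut n\<^esub> (right_tv n j k \<otimes>\<^bsub>SAut n\<^esub> right_tv n i k)"
    and "left_tv n j k \<otimes>\<^bsub>SAut n\<^esub> right_tv n i j = right_tv n i k \<otimes>\<^bsub>SAut n\<^esub> (right_tv n i j \<otimes>\<^bsub>SAut n\<^esub> left_tv n j k)"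
    and "right_tv n j k \<otimes>\<^bsub>SAut n\<^esub> left_tv n i j = left_tv n i k \<otimes>\<^bsub>SAut n\<^esub> (left_tv n i j \<otimes>\<^bsub>SAut n\<^esub> right_tv n j k)"
  by (rule SAut_eqI[where n = n]; use assms in \<open>auto simp: tv_eval\<close>)+

text \<open>The product sends the generator \<open>i\<close> to \<open>j\<close> and
  \<open>j\<close> to the inverse of \<open>i\<close>. The sign is forced: a plain transposition of
  generators has determinant -1.\<close>

definition signed_swap :: "nat \<Rightarrow> nat \<Rightarrow> nat \<Rightarrow> nat letter list \<Rightarrow> nat letter list" where
  "signed_swap n i j = right_tv n i j \<otimes>\<^bsub>SAut n\<^esub> (rmul {..<n} (i, False) j \<otimes>\<^bsub>SAut n\<^esub> left_tv n i j)"

lemma signed_swap_closed: "i < n \<Longrightarrow> j < n \<Longrightarrow> i \<noteq> j \<Longrightarrow> signed_swap n i j \<in> carrier (SAut n)"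
  by (auto simp: signed_swap_def intro!: SAut_m_closed tv_closed mul_SAut)

lemma signed_swap_gen:
  assumes "i < n" "j < n" "i \<noteq> j" "x < n"
  shows "signed_swap n i j (free_gen x) = (if x = i then [(j, True)] else if x = j then [(i, False)] else [(x, True)])"
  using assms by (auto simp: signed_swap_def tv_eval)

lemma SAut_subst:
  assumes "\<phi> \<in> carrier (SAut n)" "w \<in> carrier (free_group {..<n})"
  shows "\<phi> w = subst (\<lambda>x. \<phi> (free_gen x)) w"
  using assms by (intro hom_eq_subst) (auto simp: carrier_SAut auto_def)

text \<open>The swap fixes the generator \<open>k\<close> and sends \<open>i\<close> to
  \<open>j\<close> with positive sign, so conjugation replaces \<open>i\<close> by \<open>j\<close>
  without inverting a letter. These steps make all left transvections conjugate.\<close>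

lemma signed_swap_conj:
  assumes "i < n" "j < n" "k < n" "i \<noteq> j" "i \<noteq> k" "j \<noteq> k"
  shows "signed_swap n i j \<otimes>\<^bsub>SAut n\<^esub> left_tv n i k = left_tv n j k \<otimes>\<^bsub>SAut n\<^esub> signed_swap n i j"
    and "signed_swap n i j \<otimes>\<^bsub>SAut n\<^esub> left_tv n k i = left_tv n k j \<otimes>\<^bsub>SAut n\<^esub> signed_swap n i j"
  by (rule SAut_eqI[where n = n]; use assms in \<open>auto simp: SAut_m_closed signed_swap_closed tv_closed mult_SAut_gen
      left_tv_def mul_gen mul_subst mul_SAut signed_swap_gen SAut_subst[OF signed_swap_closed] carrier_free_group freely_reduced_Cons
      inv_letter_def\<close>)+


section \<open>Finite permutations\<close>

definition moved :: "('x \<Rightarrow> 'x) \<Rightarrow> 'x set" where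
  "moved f = {x. f x \<noteq> x}"

lemma moved_subset: "f permutes X \<Longrightarrow> moved f \<subseteq> X"
  by (auto simp: moved_def permutes_def)

lemma finite_moved: "finite X \<Longrightarrow> f permutes X \<Longrightarrow> finite (moved f)"
  by (meson finite_subset moved_subset)

lemma moved_empty_iff: "moved f = {} \<longleftrightarrow> f = id"
  by (auto simp: moved_def fun_eq_iff)

lemma card_moved_conj:
  assumes "g permutes X" "g \<circ> f = h \<circ> g"
  shows "card (moved h) = card (moved f)"
proof -
  have "moved h = g ` moved f"
  proof (intro equalityI subsetI)
    fix y assume y: "y \<in> moved h"
    obtain x where x: "y = g x"
      using assms(1) by (metis permutes_surj surjD)
    have "f x \<noteq> x"
      using y x fun_cong[OF assms(2), of x] by (auto simp: moved_def)
    then show "y \<in> g ` moved f"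
      using x by (auto simp: moved_def)
  next
    fix y assume "y \<in> g ` moved f"
    then obtain x where "y = g x" "f x \<noteq> x" by (auto simp: moved_def)
    then show "y \<in> moved h"
      using fun_cong[OF assms(2), of x] permutes_inj[OF assms(1)] by (auto simp: moved_def inj_eq)
  qed
  then show ?thesis
    using permutes_inj_on[OF assms(1)] by (simp add: card_image)
qed

lemma comp_conj_funpow:
  assumes "g \<circ> f = h \<circ> g"
  shows "g \<circ> f ^^ k = h ^^ k \<circ> g"
proof (induction k)
  case (Suc k)
  have "g \<circ> f ^^ Suc k = (g \<circ> f) \<circ> f ^^ k" by (simp only: funpow.simps comp_assoc)
  also have "\<dots> = h \<circ> (g \<circ> f ^^ k)" by (simp only: assms comp_assoc)
  also have "\<dots> = h ^^ Suc k \<circ> g" by (simp only: Suc funpow.simps comp_assoc)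
  finally show ?case .
qed simp

lemma comp_commute_funpow:
  assumes "f \<circ> g = g \<circ> f"
  shows "f ^^ k \<circ> g ^^ m = g ^^ m \<circ> f ^^ k"
  by (rule comp_conj_funpow) (rule comp_conj_funpow[OF assms[symmetric], symmetric])

lemma funpow_comp_distrib:
  assumes "f \<circ> g = g \<circ> f"
  shows "(f \<circ> g) ^^ k = f ^^ k \<circ> g ^^ k"
proof (induction k)
  case (Suc k)
  have "(f \<circ> g) ^^ Suc k = f \<circ> (g \<circ> f ^^ k) \<circ> g ^^ k"
    by (simp only: Suc funpow.simps comp_assoc)
  also have "g \<circ> f ^^ k = f ^^ k \<circ> g"
    using comp_conj_funpow[OF assms[symmetric]] .
  finally show ?case by (simp only: funpow.simps comp_assoc)
qed simp

lemma permutes_funpow: "f permutes X \<Longrightarrow> f ^^ k permutes X"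
  by (induction k) (auto intro: permutes_compose)

lemma permutes_comp_cancel:
  assumes "f permutes X"
  shows "f \<circ> g = f \<circ> h \<longleftrightarrow> g = h" "g \<circ> f = h \<circ> f \<longleftrightarrow> g = h" "f = f \<circ> g \<longleftrightarrow> g = id" "f = g \<circ> f \<longleftrightarrow> g = id"
proof -
  show *: "f \<circ> g = f \<circ> h \<longleftrightarrow> g = h" for g h
    using permutes_inj[OF assms] by (auto simp: fun_eq_iff inj_eq)
  show **: "g \<circ> f = h \<circ> f \<longleftrightarrow> g = h" for g h
    using permutes_surj[OF assms] by (auto simp: fun_eq_iff) (metis surjD)
  show "f = f \<circ> g \<longleftrightarrow> g = id" "f = g \<circ> f \<longleftrightarrow> g = id"
    using *[of id g] **[of id g] by auto
qed

lemma conj_funpow_id: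
  assumes "g permutes X" "g \<circ> f = h \<circ> g"
  shows "f ^^ k = id \<longleftrightarrow> h ^^ k = id"
  using comp_conj_funpow[OF assms(2), of k] permutes_comp_cancel[OF assms(1)]
  by (metis comp_id id_comp)

lemma permutes_funpow_eq_id:
  assumes "finite X" "f permutes X"
  obtains n where "n > 0" "f ^^ n = id"
proof -
  have "finite (range (\<lambda>k. f ^^ k))"
    by (rule finite_subset[OF _ finite_permutations[OF assms(1)]]) (auto intro: permutes_funpow assms(2))
  then obtain k where "infinite {a. f ^^ a = f ^^ k}"
    using pigeonhole_infinite[of UNIV "\<lambda>k. f ^^ k"] by auto
  then obtain m where m: "m > k" "f ^^ m = f ^^ k"
    by (metis (mono_tags, lifting) finite_nat_set_iff_bounded_le linorder_not_le mem_Collect_eq)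
  have "f ^^ k \<circ> f ^^ (m - k) = f ^^ k \<circ> id"
    using m funpow_add[of k "m - k" f] by simp
  then have "f ^^ (m - k) = id"
    using permutes_comp_cancel(1)[OF permutes_funpow[OF assms(2)]] by blast
  with m(1) that[of "m - k"] show thesis by simp
qed

text \<open>Halve the exponent while it is even: either an odd exponent is reached, or at some stage
  the halved power is not yet trivial and is then an involution.\<close>

lemma odd_or_involution:
  assumes "f ^^ n = id" "n > 0"
  shows "(\<exists>m. odd m \<and> f ^^ m = id) \<or> (\<exists>r. f ^^ r \<noteq> id \<and> f ^^ r \<circ> f ^^ r = id)"
  using assms
proof (induction n rule: less_induct)
  case (less n)
  show ?case
  proof (cases "odd n")
    case False
    then obtain r where r: "n = r + r" by (metis evenE mult_2)
    have "f ^^ r \<circ> f ^^ r = id"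
      using less.prems(1) unfolding r by (simp only: funpow_add)
    then show ?thesis
      using less.IH[of r] less.prems(2) r by (cases "f ^^ r = id") (simp, blast)
  qed (use less.prems in auto)
qed

lemma funpow_orbit_shift:
  assumes "f ^^ n = id" "n > 0" "(f ^^ k) x = (f ^^ m) y"
  shows "\<exists>j. x = (f ^^ j) y"
proof -
  \<comment> \<open>\<open>f ^^ (k * (n - 1))\<close> inverts \<open>f ^^ k\<close>, so steps
    backwards along an orbit have natural exponents as well.\<close>
  have "k * (n - 1) + k = n * k"
    using assms(2) by (cases n) auto
  then have "(f ^^ (k * (n - 1))) ((f ^^ k) x) = (f ^^ (n * k)) x"
    by (metis comp_apply funpow_add)
  also have "\<dots> = x"
    unfolding funpow_mult[symmetric] assms(1) by simp
  finally have "x = (f ^^ (k * (n - 1) + m)) y"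
    unfolding funpow_add comp_apply assms(3) by (rule sym)
  then show ?thesis by blast
qed

lemma funpow_apply_commute:
  assumes "f \<circ> g = g \<circ> f" shows "(f ^^ k) (g x) = g ((f ^^ k) x)"
  using fun_cong[OF comp_commute_funpow[OF assms, of k 1], of x] by simp

lemma funpow_apply_swap: "(f ^^ k) ((f ^^ m) x) = (f ^^ m) ((f ^^ k) x)"
  by (metis add.commute comp_apply funpow_add)

text \<open>The length of a cycle divides the odd exponent \<open>n\<close>, so it cannot be
  2.\<close>

lemma odd_orbit:
  assumes "odd n" "f ^^ n = id" "f x \<noteq> x"
  shows "card {x, f x, f (f x)} = 3"
proof -
  have "f (f x) \<noteq> x"
  proof
    assume ff: "f (f x) = x"
    obtain m where m: "n = Suc (2 * m)" using assms(1) by (auto elim: oddE)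
    have "(f ^^ (2 * m)) x = x"
      by (induction m) (auto simp: ff)
    then have "(f ^^ n) x = f x" by (simp add: m)
    with assms show False by simp
  qed
  moreover have "f (f x) \<noteq> f x"
  proof
    assume "f (f x) = f x"
    then have "(f ^^ k) (f x) = f x" for k by (induction k) auto
    from this[of "n - 1"] have "(f ^^ n) x = f x"
      using assms(1) by (metis funpow_swap1 Suc_pred' comp_apply funpow_Suc_right odd_pos)
    with assms show False by simp
  qed
  ultimately show ?thesis using assms(3) by auto
qed

text \<open>Two nontrivial cycles of odd length need six points, so on five points a permutation of odd order
  has only one nontrivial cycle, and the at most two points off it leave no room for another.\<close>

lemma odd_centralizer_five:
  assumes Y: "finite Y" "card Y \<le> 5" and t: "t permutes Y" and g: "g permutes Y"
    and n: "odd n" "t ^^ n = id" "g ^^ n = id"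
    and comm: "t \<circ> g = g \<circ> t" and y: "t y \<noteq> y"
  shows "\<exists>k. \<forall>z. g z = (if z \<in> range (\<lambda>j. (t ^^ j) y) then (t ^^ k) z else z)"
proof -
  define C where "C = range (\<lambda>j. (t ^^ j) y)"
  have yY: "y \<in> Y" using t y by (auto simp: permutes_def)
  have CY: "C \<subseteq> Y"
    using permutes_in_image[OF permutes_funpow[OF t]] yY by (auto simp: C_def)
  have sub: "{y, t y, t (t y)} \<subseteq> C"
  proof -
    have "y = (t ^^ 0) y" "t y = (t ^^ 1) y" "t (t y) = (t ^^ 2) y"
      by (auto simp: numeral_2_eq_2)
    then show ?thesis unfolding C_def by blast
  qed
  have c3: "card {y, t y, t (t y)} = 3"
    by (rule odd_orbit[OF n(1,2) y])
  have "g y \<in> C"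
  proof (rule ccontr)
    assume gy: "g y \<notin> C"
    have "g ((t ^^ k) y) \<notin> C" for k
    proof
      assume "g ((t ^^ k) y) \<in> C"
      then obtain m where "(t ^^ k) (g y) = (t ^^ m) y"
        by (auto simp: C_def funpow_apply_commute[OF comm])
      with funpow_orbit_shift[OF n(2) odd_pos[OF n(1)]] have "\<exists>j. g y = (t ^^ j) y" .
      with gy show False by (auto simp: C_def)
    qed
    then have "g x \<notin> C" if "x \<in> C" for x
      using that by (auto simp: C_def)
    then have disj: "g ` {y, t y, t (t y)} \<inter> {y, t y, t (t y)} = {}"
      using sub by blast
    have "card (g ` {y, t y, t (t y)}) = 3"
      using c3 by (simp only: card_image[OF permutes_inj_on[OF g]])
    with disj c3 have "card (g ` {y, t y, t (t y)} \<union> {y, t y, t (t y)}) = 6"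
      by (subst card_Un_disjoint) auto
    moreover have "g ` {y, t y, t (t y)} \<union> {y, t y, t (t y)} \<subseteq> Y"
      using sub CY permutes_in_image[OF g] by blast
    ultimately have "6 \<le> card Y"
      by (metis card_mono[OF Y(1)])
    with Y(2) show False by simp
  qed
  then obtain k where k: "g y = (t ^^ k) y" by (auto simp: C_def)
  \<comment> \<open>\<open>t\<close> is transitive on \<open>C\<close> and commutes with
    \<open>g\<close>, so the value of \<open>g\<close> at \<open>y\<close> determines
    \<open>g\<close> on \<open>C\<close>.\<close>
  have onC: "g z = (t ^^ k) z" if zC: "z \<in> C" for z
  proof -
    obtain j where z: "z = (t ^^ j) y" using zC unfolding C_def by blast
    have "g z = (t ^^ j) (g y)"
      unfolding z by (rule funpow_apply_commute[OF comm, symmetric])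
    also have "\<dots> = (t ^^ k) z"
      unfolding k z by (rule funpow_apply_swap)
    finally show ?thesis .
  qed
  have offC: "g z = z" if z: "z \<notin> C" for z
  proof (rule ccontr)
    assume gz: "g z \<noteq> z"
    then have zY: "z \<in> Y" using g by (auto simp: permutes_def)
    have gC: "g ` C = C"
    proof (rule endo_inj_surj)
      show "finite C" using CY Y(1) finite_subset by blast
      show "g ` C \<subseteq> C"
      proof
        fix x assume "x \<in> g ` C"
        then obtain j where "x = (t ^^ k) ((t ^^ j) y)" using onC by (auto simp: C_def)
        then have "x = (t ^^ (k + j)) y" by (simp add: funpow_add)
        then show "x \<in> C" by (auto simp: C_def)
      qed
    qed (rule permutes_inj_on[OF g])
    have off: "g x \<notin> C" if "x \<notin> C" for x
      using that gC permutes_inj[OF g] by (metis image_iff inj_eq)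
    have "{z, g z, g (g z)} \<subseteq> Y - C"
      using off z zY permutes_in_image[OF g] by auto
    then have "card {z, g z, g (g z)} \<le> card (Y - C)"
      using Y(1) by (intro card_mono) auto
    moreover have "card (Y - C) + card C \<le> 5"
      using Y CY card_Diff_subset[of C Y] card_mono[of Y C] finite_subset[OF CY] by auto
    moreover have "card C \<ge> 3"
      using card_mono[OF finite_subset[OF CY Y(1)] sub] c3 by simp
    moreover have "card {z, g z, g (g z)} = 3"
      by (rule odd_orbit[OF n(1,3) gz])
    ultimately show False by linarith
  qed
  show ?thesis
    using onC offC unfolding C_def by (intro exI[of _ k]) auto
qed

text \<open>Both \<open>g\<close> and \<open>h\<close> are powers of \<open>t\<close> on one cycle
  of \<open>t\<close> and the identity off it, so they commute.\<close>

lemma odd_commute_trans_five: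
  assumes Y: "finite Y" "card Y \<le> 5" and p: "t permutes Y" "g permutes Y" "h permutes Y"
    and n: "odd n" "t ^^ n = id" "g ^^ n = id" "h ^^ n = id"
    and comm: "t \<circ> g = g \<circ> t" "t \<circ> h = h \<circ> t" and t: "t \<noteq> id"
  shows "g \<circ> h = h \<circ> g"
proof -
  obtain y where y: "t y \<noteq> y" using t by (auto simp: fun_eq_iff)
  define C where "C = range (\<lambda>j. (t ^^ j) y)"
  obtain k where k: "\<And>z. g z = (if z \<in> C then (t ^^ k) z else z)"
    using odd_centralizer_five[OF Y p(1,2) n(1,2,3) comm(1) y] unfolding C_def by blast
  obtain m where m: "\<And>z. h z = (if z \<in> C then (t ^^ m) z else z)"
    using odd_centralizer_five[OF Y p(1,3) n(1,2,4) comm(2) y] unfolding C_def by blast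
  have C: "(t ^^ j) z \<in> C" if "z \<in> C" for j z
  proof -
    from that obtain i where "z = (t ^^ i) y" by (auto simp: C_def)
    then have "(t ^^ j) z = (t ^^ (j + i)) y" by (simp add: funpow_add)
    then show ?thesis by (auto simp: C_def)
  qed
  show ?thesis
  proof (rule ext)
    show "(g \<circ> h) z = (h \<circ> g) z" for z
      using C[of z k] C[of z m] funpow_apply_swap[of k t m z] by (cases "z \<in> C") (simp_all add: k m)
  qed
qed


section \<open>Cycles of a permutation of odd order; regular abelian groups\<close>

locale odd_permutation =
  fixes X :: "'x set" and b :: "'x \<Rightarrow> 'x" and n :: nat
  assumes finite_X: "finite X" and card_X: "card X < 18"
    and b: "b permutes X" and n: "odd n" "b ^^ n = id"
begin

definition cyc :: "'x \<Rightarrow> 'x set" where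
  "cyc x = range (\<lambda>j. (b ^^ j) x)"

definition cycles :: "'x set set" where
  "cycles = cyc ` moved b"

definition cent :: "('x \<Rightarrow> 'x) set" where
  "cent = {g. g permutes X \<and> g \<circ> b = b \<circ> g}"

text \<open>The identity outside \<open>cycles\<close> makes \<open>act g\<close> a permutation of
  \<open>cycles\<close> in the sense of \<open>permutes\<close>, as the lemmas on five points
  demand.\<close>

definition act :: "('x \<Rightarrow> 'x) \<Rightarrow> 'x set \<Rightarrow> 'x set" where
  "act g C = (if C \<in> cycles then g ` C else C)"

lemma cyc_self: "x \<in> cyc x"
  unfolding cyc_def by (rule range_eqI[of _ _ 0]) simp

lemma funpow_in_cyc: "(b ^^ k) x \<in> cyc x"
  by (simp add: cyc_def)

lemma cyc_eq:
  assumes "y \<in> cyc x"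
  shows "cyc y = cyc x"
proof -
  have *: "cyc z \<subseteq> cyc w" if zw: "z \<in> cyc w" for z w
  proof
    fix u assume "u \<in> cyc z"
    then obtain j k where "u = (b ^^ j) ((b ^^ k) w)"
      using zw unfolding cyc_def by blast
    then have "u = (b ^^ (j + k)) w" by (simp add: funpow_add)
    then show "u \<in> cyc w" unfolding cyc_def by blast
  qed
  obtain k where "y = (b ^^ k) x"
    using assms unfolding cyc_def by blast
  then have "(b ^^ k) x = (b ^^ 0) y" by simp
  from funpow_orbit_shift[OF n(2) odd_pos[OF n(1)] this] have "x \<in> cyc y"
    unfolding cyc_def by blast
  with * assms show ?thesis by blast
qed

lemma cyc_moved:
  assumes "x \<in> moved b"
  shows "cyc x \<subseteq> moved b"
proof
  fix y assume "y \<in> cyc x"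
  then obtain k where k: "y = (b ^^ k) x" unfolding cyc_def by blast
  have "b y = (b ^^ k) (b x)"
    unfolding k by (rule funpow_apply_commute[symmetric]) simp
  then show "y \<in> moved b"
    using assms k permutes_inj[OF permutes_funpow[OF b]] by (auto simp: moved_def inj_eq)
qed

lemma cent_image_cyc:
  assumes "g \<in> cent"
  shows "g ` cyc x = cyc (g x)"
proof -
  have "b \<circ> g = g \<circ> b" using assms by (simp add: cent_def)
  then have "g ((b ^^ j) x) = (b ^^ j) (g x)" for j
    by (rule funpow_apply_commute[symmetric])
  then show ?thesis by (simp add: cyc_def image_image)
qed

lemma cent_moved:
  assumes "g \<in> cent" "x \<in> moved b"
  shows "g x \<in> moved b"
proof -
  have g: "g permutes X" "g \<circ> b = b \<circ> g" using assms(1) by (simp_all add: cent_def)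
  have "b (g x) = g (b x)" "inj g"
    using fun_cong[OF g(2), of x] permutes_inj[OF g(1)] by simp_all
  then show ?thesis
    using assms(2) by (auto simp: moved_def inj_eq)
qed

lemma finite_cycles: "finite cycles"
  unfolding cycles_def by (intro finite_imageI finite_moved[OF finite_X b])

text \<open>The cycles are disjoint and have at least three points each; six of them would need 18
  points.\<close>

lemma card_cycles: "card cycles \<le> 5"
proof -
  have fin: "finite C" and c3: "card C \<ge> 3" and sub: "C \<subseteq> X" if C: "C \<in> cycles" for C
  proof -
    obtain x where x: "x \<in> moved b" "C = cyc x" using C by (auto simp: cycles_def)
    show "C \<subseteq> X" using cyc_moved[OF x(1)] x(2) moved_subset[OF b] by blast
    then show "finite C" using finite_X finite_subset by blast
    have "{x, b x, b (b x)} \<subseteq> C"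
      using funpow_in_cyc[of 0 x] funpow_in_cyc[of 1 x] funpow_in_cyc[of 2 x] x(2)
      by (simp add: numeral_2_eq_2)
    moreover have "card {x, b x, b (b x)} = 3"
      using x(1) by (intro odd_orbit[OF n]) (simp add: moved_def)
    ultimately show "card C \<ge> 3"
      using card_mono[OF \<open>finite C\<close>] by metis
  qed
  have disj: "C \<inter> D = {}" if "C \<in> cycles" "D \<in> cycles" "C \<noteq> D" for C D
  proof -
    from that(1,2) obtain x y where "C = cyc x" "D = cyc y" unfolding cycles_def by blast
    with that(3) show ?thesis using cyc_eq by blast
  qed
  have "3 * card cycles \<le> (\<Sum>C\<in>cycles. card C)"
    using sum_bounded_below[of cycles 3 card] c3 by (simp add: mult.commute)
  also have "\<dots> = card (\<Union>cycles)"
    by (rule card_Union_disjoint[symmetric]) (auto simp: pairwise_def disjnt_def disj fin)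
  also have "\<dots> \<le> card X"
    using sub by (intro card_mono finite_X) blast
  finally show ?thesis using card_X by linarith
qed

lemma act_closed:
  assumes "g \<in> cent" "C \<in> cycles"
  shows "g ` C \<in> cycles"
  using assms cent_image_cyc[OF assms(1)] cent_moved[OF assms(1)] by (auto simp: cycles_def)

lemma act_permutes:
  assumes "g \<in> cent"
  shows "act g permutes cycles"
proof (rule bij_imp_permutes)
  have "inj g" using assms permutes_inj unfolding cent_def by blast
  have "inj_on (act g) cycles"
    by (rule inj_onI) (use \<open>inj g\<close> in \<open>auto simp: act_def inj_image_eq_iff\<close>)
  moreover have "act g ` cycles \<subseteq> cycles"
    using act_closed[OF assms] by (auto simp: act_def)
  ultimately show "bij_betw (act g) cycles cycles"
    using endo_inj_surj[OF finite_cycles] by (auto simp: bij_betw_def)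
qed (simp add: act_def)

lemma cent_comp: "g \<in> cent \<Longrightarrow> h \<in> cent \<Longrightarrow> g \<circ> h \<in> cent"
  unfolding cent_def mem_Collect_eq by (metis comp_assoc permutes_compose)

lemma act_comp:
  assumes "g \<in> cent" "h \<in> cent"
  shows "act (g \<circ> h) = act g \<circ> act h"
  using act_closed[OF assms(2)] by (auto simp: act_def fun_eq_iff image_comp)

lemma cent_funpow: "g \<in> cent \<Longrightarrow> g ^^ k \<in> cent"
proof (induction k)
  case 0
  have "id \<in> cent"
    unfolding cent_def mem_Collect_eq by (metis permutes_id comp_id id_comp)
  then show ?case by (simp only: funpow.simps)
next
  case (Suc k)
  then show ?case using cent_comp by (simp only: funpow.simps)
qed

lemma act_id: "act id = id"
  by (auto simp: act_def fun_eq_iff)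

lemma act_funpow: "g \<in> cent \<Longrightarrow> act g ^^ k = act (g ^^ k)"
proof (induction k)
  case 0
  show ?case by (simp only: funpow.simps act_id)
next
  case (Suc k)
  then show ?case
    using act_comp[OF Suc.prems cent_funpow[OF Suc.prems, of k]] by (simp only: funpow.simps)
qed

lemma act_commute_trans:
  assumes "t \<in> cent" "g \<in> cent" "h \<in> cent" "t ^^ n = id" "g ^^ n = id" "h ^^ n = id"
    and "t \<circ> g = g \<circ> t" "t \<circ> h = h \<circ> t" "act t \<noteq> id"
  shows "act g \<circ> act h = act h \<circ> act g"
proof (rule odd_commute_trans_five[OF finite_cycles card_cycles _ _ _ n(1)])
  show "act t permutes cycles" "act g permutes cycles" "act h permutes cycles"
    by (intro act_permutes assms)+
  show "act t ^^ n = id" "act g ^^ n = id" "act h ^^ n = id"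
    using assms(1-6) by (simp_all only: act_funpow act_id)
  show "act t \<circ> act g = act g \<circ> act t" "act t \<circ> act h = act h \<circ> act t"
    using assms(1-3,7,8) act_comp by metis+
qed (fact assms)

text \<open>A map that preserves the cycle of \<open>x\<close> and commutes with \<open>b\<close>
  acts on that cycle as a power of \<open>b\<close>, and powers of \<open>b\<close> commute. This
  turns a statement about cycles into one about points.\<close>

lemma act_id_commute:
  assumes g: "g \<in> cent" "act g = id" and h: "h \<in> cent" "act h = id" and x: "x \<in> moved b"
  shows "g (h x) = h (g x)"
proof -
  have pw: "\<exists>k. f x = (b ^^ k) x" if "act f = id" for f
  proof -
    have "f ` cyc x = cyc x"
      using fun_cong[OF that, of "cyc x"] x by (auto simp: act_def cycles_def)
    then have "f x \<in> cyc x" using cyc_self by blast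
    then show ?thesis unfolding cyc_def by blast
  qed
  obtain k m where k: "g x = (b ^^ k) x" and m: "h x = (b ^^ m) x"
    using pw g h by metis
  have comm: "b \<circ> g = g \<circ> b" "b \<circ> h = h \<circ> b" using g h by (auto simp: cent_def)
  have "g (h x) = (b ^^ m) (g x)"
    unfolding m by (rule funpow_apply_commute[OF comm(1), symmetric])
  also have "\<dots> = (b ^^ k) (h x)"
    unfolding k m by (rule funpow_apply_swap)
  also have "\<dots> = h (g x)"
    unfolding k by (rule funpow_apply_commute[OF comm(2)])
  finally show ?thesis .
qed

end

text \<open>As the group is abelian, the stabilizer is constant along an orbit.\<close>

lemma abelian_burnside:
  fixes e :: "'v :: ab_group_add \<Rightarrow> 'x \<Rightarrow> 'x"
  assumes fin: "finite X" "finite (UNIV :: 'v set)"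
    and add: "\<And>v w. e (v + w) = e v \<circ> e w" and perm: "\<And>v. e v permutes X"
  shows "card (UNIV :: 'v set) dvd (\<Sum>v\<in>UNIV. card {x \<in> X. e v x = x})"
proof -
  have zero: "e 0 = id"
    using add[of 0 0] permutes_comp_cancel(3)[OF perm] by auto
  define orb where "orb x = range (\<lambda>v. e v x)" for x
  have orb_eq: "orb (e v x) = orb x" for v x
  proof
    show "orb (e v x) \<subseteq> orb x"
      by (auto simp: orb_def) (metis add comp_apply rangeI)
    show "orb x \<subseteq> orb (e v x)"
    proof
      fix y assume "y \<in> orb x"
      then obtain w where "y = e w x" by (auto simp: orb_def)
      then have "y = e (w - v) (e v x)"
        using add[of "w - v" v] by simp
      then show "y \<in> orb (e v x)" by (auto simp: orb_def)
    qed
  qed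
  have self: "x \<in> orb x" for x
    unfolding orb_def by (rule range_eqI[of _ _ 0]) (simp add: zero)
  have fiber: "{y \<in> X. orb y = orb x} = orb x" if "x \<in> X" for x
  proof
    show "{y \<in> X. orb y = orb x} \<subseteq> orb x" using self by blast
    show "orb x \<subseteq> {y \<in> X. orb y = orb x}"
      using that orb_eq permutes_in_image[OF perm] by (auto simp: orb_def[of x])
  qed
  have stab: "card {v. e v y = y} = card {v. e v x = y}" if "y \<in> orb x" for x y
  proof -
    obtain u where u: "y = e u x" using \<open>y \<in> orb x\<close> unfolding orb_def by blast
    \<comment> \<open>Translation by \<open>u\<close> carries the stabilizer of \<open>y\<close> to
      the set of elements taking \<open>x\<close> to \<open>y\<close>. Over the orbit of
      \<open>x\<close> these sets partition the group, so each orbit contributes exactly the order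
      of the group to the sum.\<close>
    have "bij_betw (\<lambda>v. v + u) {v. e v y = y} {v. e v x = y}"
      by (rule bij_betw_byWitness[where f' = "\<lambda>v. v - u"])
         (auto simp: u add permutes_inj[OF perm, THEN inj_eq], metis add comp_apply diff_add_cancel)
    then show ?thesis by (rule bij_betw_same_card)
  qed
  have orbit_sum: "(\<Sum>y\<in>orb x. card {v. e v y = y}) = card (UNIV :: 'v set)" for x
  proof -
    have "(\<Sum>y\<in>orb x. card {v. e v y = y}) = (\<Sum>y\<in>orb x. card {v. e v x = y})"
      by (rule sum.cong) (auto simp: stab)
    also have "\<dots> = (\<Sum>y\<in>orb x. \<Sum>v | v \<in> UNIV \<and> e v x = y. 1)"
      by simp
    also have "\<dots> = (\<Sum>v\<in>(UNIV :: 'v set). 1)"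
      by (rule sum.group) (auto simp: orb_def fin)
    finally show ?thesis by simp
  qed
  have "(\<Sum>v\<in>UNIV. card {x \<in> X. e v x = x}) = (\<Sum>v\<in>UNIV. \<Sum>x\<in>X. if e v x = x then 1 else 0)"
    using fin by (simp add: sum.If_cases Int_def)
  also have "\<dots> = (\<Sum>x\<in>X. \<Sum>v\<in>UNIV. if e v x = x then 1 else 0)"
    by (rule sum.swap)
  also have "\<dots> = (\<Sum>x\<in>X. card {v. e v x = x})"
    using fin by (simp add: sum.If_cases Int_def)
  also have "\<dots> = (\<Sum>C\<in>orb ` X. \<Sum>y | y \<in> X \<and> orb y = C. card {v. e v y = y})"
    by (rule sum.group[symmetric]) (auto simp: fin)
  also have "\<dots> = (\<Sum>C\<in>orb ` X. card (UNIV :: 'v set))"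
    by (rule sum.cong) (auto simp: fiber orbit_sum)
  finally show ?thesis by simp
qed

text \<open>The fixed-point counts add up to 16 |X| - 15 s, which Burnside makes divisible by 16.
  Hence 16 divides s, and 0 < s < 18 leaves only s = 16.\<close>

lemma regular_sixteen:
  fixes e :: "'v :: ab_group_add \<Rightarrow> 'x \<Rightarrow> 'x"
  assumes X: "finite X" "card X < 18" and V: "finite (UNIV :: 'v set)" "card (UNIV :: 'v set) = 16"
    and add: "\<And>v w. e (v + w) = e v \<circ> e w" and perm: "\<And>v. e v permutes X"
    and moved: "\<And>v. v \<noteq> 0 \<Longrightarrow> card (moved (e v)) = s" and s: "s > 0"
  obtains Y where "Y \<subseteq> X" "card Y = 16" "card (X - Y) \<le> 1" "\<And>v. v \<noteq> 0 \<Longrightarrow> moved (e v) = Y"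
    "\<And>x y. x \<in> Y \<Longrightarrow> y \<in> Y \<Longrightarrow> \<exists>v. y = e v x"
proof -
  have zero: "e 0 = id"
    using add[of 0 0] permutes_comp_cancel(3)[OF perm] by auto
  have fixed: "card {x \<in> X. e v x = x} = card X - (if v = 0 then 0 else s)" for v
  proof -
    have "{x \<in> X. e v x = x} = X - moved (e v)" by (auto simp: moved_def)
    then show ?thesis
      using card_Diff_subset[OF finite_moved[OF X(1) perm] moved_subset[OF perm], of v] moved[of v]
      by (auto simp: zero moved_def)
  qed
  obtain v0 :: 'v where v0: "v0 \<noteq> 0"
  proof -
    have "card {0 :: 'v} \<noteq> 16" by simp
    then have "(UNIV :: 'v set) \<noteq> {0}" using V(2) by metis
    then show thesis using that by blast
  qed
  have s_le: "s \<le> card X"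
    using card_mono[OF X(1) moved_subset[OF perm]] moved[OF v0] by metis
  have "(\<Sum>v\<in>UNIV. card {x \<in> X. e v x = x}) = card X + (\<Sum>v\<in>UNIV - {0 :: 'v}. card X - s)"
    using V(1) by (subst sum.remove[of _ 0]) (auto simp: fixed)
  also have "\<dots> = card X + 15 * (card X - s)"
    using V by simp
  finally have "16 dvd card X + 15 * (card X - s)"
    using abelian_burnside[OF X(1) V(1) add perm] V(2) by simp
  moreover have "card X + 15 * (card X - s) + 15 * s = 16 * card X"
    using s_le by (simp add: algebra_simps)
  ultimately have "16 dvd 15 * s"
    by (metis dvd_add_right_iff dvd_triv_left)
  then have "16 dvd s"
    using coprime_dvd_mult_right_iff[of "16 :: nat" 15 s] by (simp add: coprime_iff_gcd_eq_1 gcd_non_0_nat)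
  with s s_le X(2) have s16: "s = 16"
    by (auto elim!: dvdE)
  define Y where "Y = moved (e v0)"
  have Y: "Y \<subseteq> X" "card Y = 16"
    using moved_subset[OF perm] moved[OF v0] s16 by (auto simp: Y_def)
  have small: "card (X - moved (e v)) \<le> 1" if "v \<noteq> 0" for v
    using card_Diff_subset[OF finite_moved[OF X(1) perm] moved_subset[OF perm], of v] moved[OF that] s16 X(2)
    by auto
  have comm: "e v (e w x) = e w (e v x)" for v w x
    by (metis add add.commute comp_apply)
  \<comment> \<open>If \<open>e w\<close> fixed a point \<open>z\<close> moved by
    \<open>e v\<close>, it would also fix \<open>e v z\<close>, which is two points outside a
    support that misses at most one.\<close>
  have "moved (e v) \<subseteq> moved (e w)" if "v \<noteq> 0" "w \<noteq> 0" for v w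
  proof
    fix z assume z: "z \<in> moved (e v)"
    show "z \<in> moved (e w)"
    proof (rule ccontr)
      assume zw: "z \<notin> moved (e w)"
      have "z \<in> X" using z moved_subset[OF perm] by blast
      moreover have "e v z \<notin> moved (e w)"
        using zw comm[of w v z] by (simp add: moved_def)
      ultimately have "{z, e v z} \<subseteq> X - moved (e w)"
        using zw permutes_in_image[OF perm] by auto
      moreover have "card {z, e v z} = 2" using z by (auto simp: moved_def)
      ultimately show False
        using small[OF that(2)] card_mono[of "X - moved (e w)" "{z, e v z}"] X(1) by auto
    qed
  qed
  then have movedY: "moved (e v) = Y" if "v \<noteq> 0" for v
    using that v0 unfolding Y_def by blast
  have "\<exists>v. y = e v x" if xy: "x \<in> Y" "y \<in> Y" for x y
  proof -
    have inY: "e v x \<in> Y" for v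
      using xy(1) comm[of v0 v x] permutes_inj[OF perm, of v] by (auto simp: Y_def moved_def inj_eq)
    \<comment> \<open>Nonzero elements fix no point of \<open>Y\<close>, so the orbit of
      \<open>x\<close> has 16 points and fills \<open>Y\<close>.\<close>
    have "inj (\<lambda>v. e v x)"
    proof (rule injI)
      fix v w assume vw: "e v x = e w x"
      have "e (v - w) (e w x) = e v x"
        using add[of "v - w" w] by simp
      with vw have "e w x \<notin> moved (e (v - w))" by (simp add: moved_def)
      with inY movedY[of "v - w"] show "v = w" by auto
    qed
    then have "card (range (\<lambda>v. e v x)) = 16"
      using V(2) by (simp add: card_image)
    then have "range (\<lambda>v. e v x) = Y"
      using inY Y X(1) by (intro card_subset_eq) (auto intro: finite_subset)
    with xy(2) show ?thesis by auto
  qed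
  with Y small[OF v0] movedY that show thesis by (metis Y_def)
qed


section \<open>Permutation representations of transvections\<close>

definition indices :: "nat list \<Rightarrow> bool" where
  "indices is \<longleftrightarrow> distinct is \<and> set is \<subseteq> {..<5}"

text \<open>The combinatorial part sees only permutations subject to these relations and no free
  group. Conjugacy is assumed for \<open>L\<close> alone; \<open>R\<close> is reached through the
  mixed relations.\<close>

locale transvection_action =
  fixes X :: "'x set" and L R :: "nat \<Rightarrow> nat \<Rightarrow> 'x \<Rightarrow> 'x"
  assumes finite_X: "finite X" and card_X: "card X < 18"
    and perm: "indices [i, j] \<Longrightarrow> L i j permutes X" "indices [i, j] \<Longrightarrow> R i j permutes X"
    and comm: "indices [i, j] \<Longrightarrow> L i j \<circ> R i j = R i j \<circ> L i j"
      "indices [i, j, k] \<Longrightarrow> L i j \<circ> L k j = L k j \<circ> L i j"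
      "indices [i, j, k] \<Longrightarrow> L i j \<circ> R k j = R k j \<circ> L i j"
      "indices [i, j, k] \<Longrightarrow> L i j \<circ> R i k = R i k \<circ> L i j"
      "indices [i, j, k, l] \<Longrightarrow> L i j \<circ> L k l = L k l \<circ> L i j"
      "indices [i, j, k, l] \<Longrightarrow> L i j \<circ> R k l = R k l \<circ> L i j"
      "indices [i, j, k, l] \<Longrightarrow> R i j \<circ> R k l = R k l \<circ> R i j"
    and steinberg: "indices [i, j, k] \<Longrightarrow> L j k \<circ> L i j = L i j \<circ> (L j k \<circ> L i k)"
      "indices [i, j, k] \<Longrightarrow> R j k \<circ> R i j = R i j \<circ> (R j k \<circ> R i k)"
      "indices [i, j, k] \<Longrightarrow> L j k \<circ> R i j = R i k \<circ> (R i j \<circ> L j k)"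
      "indices [i, j, k] \<Longrightarrow> R j k \<circ> L i j = L i k \<circ> (L i j \<circ> R j k)"
    and conj: "indices [i, j, k] \<Longrightarrow> \<exists>g. g permutes X \<and> g \<circ> L i k = L j k \<circ> g"
      "indices [i, j, k] \<Longrightarrow> \<exists>g. g permutes X \<and> g \<circ> L k i = L k j \<circ> g"
begin

definition conjugate :: "('x \<Rightarrow> 'x) \<Rightarrow> ('x \<Rightarrow> 'x) \<Rightarrow> bool" where
  "conjugate f h \<longleftrightarrow> (\<exists>g. g permutes X \<and> g \<circ> f = h \<circ> g)"

lemma conjugate_trans:
  assumes "conjugate f g" "conjugate g h"
  shows "conjugate f h"
proof -
  obtain p q where "p permutes X" "p \<circ> f = g \<circ> p" "q permutes X" "q \<circ> g = h \<circ> q"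
    using assms unfolding conjugate_def by blast
  then have "q \<circ> p permutes X" "(q \<circ> p) \<circ> f = h \<circ> (q \<circ> p)"
    by (simp_all only: permutes_compose) (metis comp_assoc)
  then show ?thesis unfolding conjugate_def by blast
qed

lemma conjugate_refl: "conjugate f f"
  unfolding conjugate_def by (metis comp_id id_comp permutes_id)

lemma conjugate_funpow: "conjugate f h \<Longrightarrow> conjugate (f ^^ m) (h ^^ m)"
  unfolding conjugate_def using comp_conj_funpow by blast

lemma conjugate_card_moved: "conjugate f h \<Longrightarrow> card (moved f) = card (moved h)"
  unfolding conjugate_def using card_moved_conj by metis

lemma conjugate_funpow_id: "conjugate f h \<Longrightarrow> f ^^ m = id \<longleftrightarrow> h ^^ m = id"
  unfolding conjugate_def using conj_funpow_id by blast

lemma conjugate_L: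
  assumes ij: "indices [i, j]" and kl: "indices [k, l]"
  shows "conjugate (L i j) (L k l)"
proof -
  have row: "conjugate (L i k) (L j k)" if "i \<noteq> k" "j \<noteq> k" "i < 5" "j < 5" "k < 5" for i j k
    using conj(1)[of i j k] conjugate_refl[of "L i k"] that
    by (cases "i = j") (auto simp: indices_def conjugate_def)
  have col: "conjugate (L k i) (L k j)" if "i \<noteq> k" "j \<noteq> k" "i < 5" "j < 5" "k < 5" for i j k
    using conj(2)[of i j k] conjugate_refl[of "L k i"] that
    by (cases "i = j") (auto simp: indices_def conjugate_def)
  \<comment> \<open>Five indices leave an \<open>m\<close> outside \<open>i\<close>,
    \<open>k\<close>, \<open>l\<close>, through which the chain \<open>L i j\<close>,
    \<open>L i m\<close>, \<open>L k m\<close>, \<open>L k l\<close> changes one index at a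
    time.\<close>
  have "\<not> {..<5} \<subseteq> {i, k, l}"
    using card_mono[of "{i, k, l}" "{..<5}"] by (auto simp: card_insert_if split: if_splits)
  then obtain m where m: "m < 5" "m \<noteq> i" "m \<noteq> k" "m \<noteq> l" by blast
  have "conjugate (L i j) (L i m)" "conjugate (L i m) (L k m)" "conjugate (L k m) (L k l)"
    using ij kl m by (auto simp: indices_def intro!: row col)
  then show ?thesis
    using conjugate_trans by blast
qed

lemma L_funpow_id_iff:
  "indices [i, j] \<Longrightarrow> indices [k, l] \<Longrightarrow> L i j ^^ m = id \<longleftrightarrow> L k l ^^ m = id"
  by (rule conjugate_funpow_id[OF conjugate_L])

lemma conjugate_L_prod:
  assumes "indices [i, j, k]"
  shows "conjugate (L j k \<circ> L i k) (L j k)"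
  unfolding conjugate_def using steinberg(1)[OF assms] perm(1)[of i j] assms
  by (intro exI[of _ "L i j"]) (simp add: indices_def)

text \<open>A mixed Steinberg relation shows that \<open>R i j\<close> conjugates
  \<open>L j k\<close> into the inverse of \<open>R i k\<close> times \<open>L j k\<close>. This
  product is therefore killed by \<open>m\<close>; its factors commute and \<open>L j k\<close> is
  killed by \<open>m\<close>, so \<open>R i k\<close> is too.\<close>

lemma R_funpow_id:
  assumes id: "\<And>i j. indices [i, j] \<Longrightarrow> L i j ^^ m = id" and ik: "indices [i, k]"
  shows "R i k ^^ m = id"
proof -
  have "\<not> {..<5} \<subseteq> {i, k}"
    using card_mono[of "{i, k}" "{..<5}"] by (auto simp: card_insert_if split: if_splits)
  then obtain j where j: "j < 5" "j \<noteq> i" "j \<noteq> k" by blast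
  with ik have ijk: "indices [i, j, k]" "indices [i, j]" "indices [j, k]" "indices [j, k, i]"
    by (auto simp: indices_def)
  let ?S = "inv_into UNIV (R i k)"
  have Rp: "?S \<circ> R i k = id" "R i k \<circ> ?S = id"
    using permutes_inv_o[OF perm(2)[OF ik]] by simp_all
  have "R i j \<circ> L j k = (?S \<circ> L j k) \<circ> R i j"
    using steinberg(3)[OF ijk(1)] Rp by (metis comp_assoc id_comp)
  then have "(?S \<circ> L j k) ^^ m = id"
    using conj_funpow_id[OF perm(2)[OF ijk(2)]] id[OF ijk(3)] by metis
  moreover have "?S \<circ> L j k = L j k \<circ> ?S"
    using comm(3)[OF ijk(4)] Rp by (metis comp_assoc id_comp comp_id)
  ultimately have "?S ^^ m = id"
    using funpow_comp_distrib[of "?S" "L j k" m] id[OF ijk(3)] by (metis comp_id)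
  moreover have "(R i k \<circ> ?S) ^^ m = R i k ^^ m \<circ> ?S ^^ m"
    using Rp by (intro funpow_comp_distrib) simp
  ultimately show ?thesis
    using Rp by (metis comp_id id_funpow)
qed

lemma odd_order:
  assumes m: "odd m" "L 0 1 ^^ m = id"
  shows "L 0 1 = id"
proof -
  have ix: "indices [i, j]" if "i \<noteq> j" "i < 5" "j < 5" for i j
    using that by (simp add: indices_def)
  interpret odd_permutation X "L 0 1" m
    by unfold_locales (use m finite_X card_X perm ix in auto)
  have L_id: "L i j ^^ m = id" if "indices [i, j]" for i j
    using L_funpow_id_iff[OF _ that, of 0 1 m] m(2) by (simp add: indices_def)
  note R_id = R_funpow_id[OF L_id]
  have cent: "L 2 3 \<in> cent" "L 3 4 \<in> cent" "L 2 4 \<in> cent" "L 4 3 \<in> cent" "L 3 2 \<in> cent"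
    "L 3 1 \<in> cent" "L 2 1 \<in> cent" "R 2 4 \<in> cent" "R 3 2 \<in> cent" "R 3 4 \<in> cent"
    unfolding cent_def mem_Collect_eq
    using comm(2)[of 0 1] comm(5)[of 0 1] comm(6)[of 0 1] perm
    by (simp_all add: indices_def)
  have act_eq: "act a \<circ> act b = act c \<circ> (act d \<circ> act e)"
    if "a \<in> cent" "b \<in> cent" "c \<in> cent" "d \<in> cent" "e \<in> cent" "a \<circ> b = c \<circ> (d \<circ> e)" for a b c d e
    using that act_comp cent_comp by metis
  have st1: "act (L 3 4) \<circ> act (L 2 3) = act (L 2 3) \<circ> (act (L 3 4) \<circ> act (L 2 4))"
    and st2: "act (L 4 3) \<circ> act (L 2 4) = act (L 2 4) \<circ> (act (L 4 3) \<circ> act (L 2 3))"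
    and st3: "act (L 3 1) \<circ> act (L 2 3) = act (L 2 3) \<circ> (act (L 3 1) \<circ> act (L 2 1))"
    and st4: "act (L 2 1) \<circ> act (L 3 2) = act (L 3 2) \<circ> (act (L 2 1) \<circ> act (L 3 1))"
    and st5: "act (R 2 4) \<circ> act (R 3 2) = act (R 3 2) \<circ> (act (R 2 4) \<circ> act (R 3 4))"
    and st6: "act (R 3 4) \<circ> act (L 2 3) = act (L 2 4) \<circ> (act (L 2 3) \<circ> act (R 3 4))"
    by (intro act_eq cent steinberg; simp add: indices_def)+
  note cancel = permutes_comp_cancel[OF act_permutes]
  \<comment> \<open>If \<open>R 2 4\<close> acts nontrivially on the cycles, it commutes with both
    \<open>L 2 3\<close> and \<open>L 3 4\<close>, which then commute on cycles, so their commutator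
    \<open>L 2 4\<close> dies. If it acts trivially, the relations \<open>st5\<close> and
    \<open>st6\<close> pass the triviality on to \<open>R 3 4\<close> and to
    \<open>L 2 4\<close>.\<close>
  have L24: "act (L 2 4) = id"
  proof (cases "act (R 2 4) = id")
    case True
    then have "act (R 3 4) = id"
      using st5 cancel(3)[OF cent(9)] by (metis comp_id id_comp)
    then show ?thesis
      using st6 cancel(4)[OF cent(1)] by (metis comp_id id_comp)
  next
    case False
    have "act (L 2 3) \<circ> act (L 3 4) = act (L 3 4) \<circ> act (L 2 3)"
      using comm(4)[of 2 3 4] comm(3)[of 3 4 2]
      by (intro act_commute_trans[OF cent(8,1,2) R_id L_id L_id _ _ False]) (auto simp: indices_def)
    then have "act (L 3 4) = act (L 3 4) \<circ> act (L 2 4)"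
      using st1 cancel(1)[OF cent(1)] by metis
    then show ?thesis
      using cancel(3)[OF cent(2)] by blast
  qed
  then have L23: "act (L 2 3) = id"
    using st2 cancel(3)[OF cent(4)] by (metis comp_id id_comp)
  then have L21: "act (L 2 1) = id"
    using st3 cancel(3)[OF cent(6)] by (metis comp_id id_comp)
  then have L31: "act (L 3 1) = id"
    using st4 cancel(3)[OF cent(5)] by (metis comp_id id_comp)
  \<comment> \<open>\<open>L 2 1\<close> measures the failure of \<open>L 3 1\<close> and
    \<open>L 2 3\<close> to commute. Both preserve every cycle of \<open>L 0 1\<close>, so on its
    support they commute.\<close>
  have fixed: "L 2 1 x = x" if x: "x \<in> moved (L 0 1)" for x
  proof -
    have "L 3 1 (L 2 3 x) = L 2 3 (L 3 1 (L 2 1 x))"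
      using fun_cong[OF steinberg(1)[of 2 3 1], of x] by (simp add: indices_def)
    also have "\<dots> = L 3 1 (L 2 3 (L 2 1 x))"
      by (rule act_id_commute[OF cent(1) L23 cent(6) L31 cent_moved[OF cent(7) x]])
    finally show ?thesis
      using permutes_inj[OF perm(1)[of 3 1]] permutes_inj[OF perm(1)[of 2 3]]
      by (simp add: inj_eq indices_def)
  qed
  \<comment> \<open>The two supports are disjoint, so the product moves as many points as both
    factors together; being conjugate to \<open>L 0 1\<close>, it moves no more than
    \<open>L 0 1\<close> does.\<close>
  have "moved (L 0 1 \<circ> L 2 1) = moved (L 0 1) \<union> moved (L 2 1)"
  proof (intro equalityI subsetI)
    fix x assume x: "x \<in> moved (L 0 1) \<union> moved (L 2 1)"
    show "x \<in> moved (L 0 1 \<circ> L 2 1)"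
    proof (cases "x \<in> moved (L 0 1)")
      case True
      with fixed[OF True] show ?thesis by (simp add: moved_def)
    next
      case False
      then have "L 0 1 (L 2 1 x) = L 2 1 x"
        using fun_cong[OF comm(2)[of 0 1 2], of x] by (simp add: moved_def indices_def)
      with x False show ?thesis by (auto simp: moved_def)
    qed
  qed (auto simp: moved_def)
  moreover have "moved (L 0 1) \<inter> moved (L 2 1) = {}"
    using fixed by (auto simp: moved_def)
  moreover have "finite (moved (L 0 1))" "finite (moved (L 2 1))"
    using finite_moved[OF finite_X] perm(1) ix by auto
  ultimately have "card (moved (L 0 1 \<circ> L 2 1)) = card (moved (L 0 1)) + card (moved (L 2 1))"
    by (simp add: card_Un_disjoint)
  moreover have "card (moved (L 0 1 \<circ> L 2 1)) = card (moved (L 0 1))"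
    by (rule conjugate_card_moved[OF conjugate_L_prod]) (simp add: indices_def)
  ultimately have "card (moved (L 2 1)) = 0" by simp
  moreover have "card (moved (L 0 1)) = card (moved (L 2 1))"
    by (rule conjugate_card_moved[OF conjugate_L]) (simp_all add: indices_def)
  ultimately have "moved (L 0 1) = {}"
    using \<open>finite (moved (L 0 1))\<close> by simp
  then show ?thesis by (simp only: moved_empty_iff)
qed

end

lemma commute_moved_iff:
  assumes "g permutes X" "g \<circ> f = f \<circ> g"
  shows "g x \<in> moved f \<longleftrightarrow> x \<in> moved f"
  using fun_cong[OF assms(2), of x] permutes_inj[OF assms(1)] by (auto simp: moved_def inj_eq)

text \<open>On \<open>Y\<close> the map \<open>g\<close> is determined by its value at one point,
  where by transitivity it agrees with some \<open>e v\<close>.\<close>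

lemma regular_centralizer:
  fixes e :: "'v :: ab_group_add \<Rightarrow> 'x \<Rightarrow> 'x"
  assumes X: "finite X" and Y: "Y \<subseteq> X" "Y \<noteq> {}" "card (X - Y) \<le> 1"
    and add: "\<And>v w. e (v + w) = e v \<circ> e w" and perm: "\<And>v. e v permutes X"
    and moved: "\<And>v. v \<noteq> 0 \<Longrightarrow> moved (e v) = Y"
    and trans: "\<And>x y. x \<in> Y \<Longrightarrow> y \<in> Y \<Longrightarrow> \<exists>v. y = e v x"
    and v0: "(v0 :: 'v) \<noteq> 0" and g: "g permutes X" "\<And>v. g \<circ> e v = e v \<circ> g"
  shows "\<exists>v. g = e v"
proof -
  have comm: "e v \<circ> e w = e w \<circ> e v" for v w
    by (metis add add.commute)
  obtain x where x: "x \<in> Y" using Y(2) by blast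
  have gY: "g y \<in> Y \<longleftrightarrow> y \<in> Y" and eY: "e v y \<in> Y \<longleftrightarrow> y \<in> Y" for v y
    using commute_moved_iff[OF g(1) g(2)[of v0]] commute_moved_iff[OF perm comm] moved[OF v0] by metis+
  obtain v where v: "g x = e v x" using trans x gY by metis
  have "g y = e v y" for y
  proof (cases "y \<in> Y")
    case True
    then obtain w where w: "y = e w x" using trans x by metis
    have "g y = e w (g x)" using fun_cong[OF g(2)[of w], of x] by (simp add: w)
    also have "\<dots> = e v y" using fun_cong[OF comm[of w v], of x] by (simp add: w v)
    finally show ?thesis .
  next
    case False
    show ?thesis
    proof (cases "y \<in> X")
      case True
      \<comment> \<open>Both images of \<open>y\<close> stay in \<open>X - Y\<close>, which has at
        most one point, so they coincide.\<close>
      have "{g y, e v y} \<subseteq> X - Y"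
        using True False gY eY permutes_in_image[OF g(1)] permutes_in_image[OF perm] by auto
      then have "card {g y, e v y} \<le> 1"
        using card_mono[of "X - Y"] X Y(3) by (meson finite_Diff le_trans)
      then show ?thesis by (auto simp: card_insert_if split: if_splits)
    next
      case False
      then show ?thesis using permutes_not_in g(1) perm by metis
    qed
  qed
  then show ?thesis by blast
qed

definition pw :: "bit \<Rightarrow> ('x \<Rightarrow> 'x) \<Rightarrow> 'x \<Rightarrow> 'x" where
  "pw v f = (if v = 1 then f else id)"

text \<open>For commuting involutions this is a homomorphism from the vector space of dimension four
  over the field of two elements; \<open>bit\<close> provides the addition.\<close>

fun quad :: "('x \<Rightarrow> 'x) \<Rightarrow> ('x \<Rightarrow> 'x) \<Rightarrow> ('x \<Rightarrow> 'x) \<Rightarrow> ('x \<Rightarrow> 'x) \<Rightarrow> bit \<times> bit \<times> bit \<times> bit \<Rightarrow> 'x \<Rightarrow> 'x" where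
  "quad f1 f2 f3 f4 (v1, v2, v3, v4) = pw v1 f1 \<circ> (pw v2 f2 \<circ> (pw v3 f3 \<circ> pw v4 f4))"

lemma pw_simps [simp]: "pw 0 f = id" "pw 1 f = f"
  by (simp_all add: pw_def)

lemma pw_add: "f \<circ> f = id \<Longrightarrow> pw (v + w) f = pw v f \<circ> pw w f"
  by (cases v; cases w) simp_all

lemma pw_commute: "f \<circ> g = g \<circ> f \<Longrightarrow> pw v f (pw w g x) = pw w g (pw v f x)"
  by (cases v; cases w) (auto dest: fun_cong[of _ _ x])

lemma pw_permutes: "f permutes X \<Longrightarrow> pw v f permutes X"
  unfolding pw_def using permutes_id by metis

lemma quad_add:
  assumes "f1 \<circ> f1 = id" "f2 \<circ> f2 = id" "f3 \<circ> f3 = id" "f4 \<circ> f4 = id"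
    and "f2 \<circ> f1 = f1 \<circ> f2" "f3 \<circ> f1 = f1 \<circ> f3" "f4 \<circ> f1 = f1 \<circ> f4"
    and "f3 \<circ> f2 = f2 \<circ> f3" "f4 \<circ> f2 = f2 \<circ> f4" "f4 \<circ> f3 = f3 \<circ> f4"
  shows "quad f1 f2 f3 f4 (v + w) = quad f1 f2 f3 f4 v \<circ> quad f1 f2 f3 f4 w"
proof -
  obtain v1 v2 v3 v4 w1 w2 w3 w4 where vw: "v = (v1, v2, v3, v4)" "w = (w1, w2, w3, w4)"
    by (metis prod.exhaust)
  note swap = assms(5-10)[THEN pw_commute]
  show ?thesis
    unfolding vw
    \<comment> \<open>Each instance of \<open>swap\<close> moves a factor of \<open>w\<close> to the
      left past a factor of \<open>v\<close>; naming the exponents keeps the rewriting from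
      looping.\<close>
    by (rule ext) (simp only: add_Pair quad.simps comp_apply assms(1-4)[THEN pw_add] swap[of v2 w1] swap[of v3 w1] swap[of v4 w1]
      swap[of v3 w2] swap[of v4 w2] swap[of v4 w3])
qed

lemma quad_permutes:
  "f1 permutes X \<Longrightarrow> f2 permutes X \<Longrightarrow> f3 permutes X \<Longrightarrow> f4 permutes X \<Longrightarrow> quad f1 f2 f3 f4 v permutes X"
  by (cases v) (auto intro!: permutes_compose pw_permutes simp del: pw_simps)

lemma quad_commute:
  assumes "g \<circ> f1 = f1 \<circ> g" "g \<circ> f2 = f2 \<circ> g" "g \<circ> f3 = f3 \<circ> g" "g \<circ> f4 = f4 \<circ> g"
  shows "g \<circ> quad f1 f2 f3 f4 v = quad f1 f2 f3 f4 v \<circ> g"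
proof -
  have "g (pw v f x) = pw v f (g x)" if "g \<circ> f = f \<circ> g" for v f x
    using fun_cong[OF that, of x] by (simp add: pw_def)
  with assms show ?thesis
    by (cases v) (auto simp: fun_eq_iff)
qed

lemma UNIV_bit: "(UNIV :: bit set) = {0, 1}"
  by (auto intro: bit.exhaust)

lemma finite_card_bit4:
  "finite (UNIV :: (bit \<times> bit \<times> bit \<times> bit) set)" "card (UNIV :: (bit \<times> bit \<times> bit \<times> bit) set) = 16"
  by (simp_all add: UNIV_bit finite_prod card_cartesian_product flip: UNIV_Times_UNIV)

section \<open>The groups of order 16 generated by powers of transvections with a common
  multiplier\<close>

context transvection_action
begin

text \<open>The Steinberg relation says that \<open>L i j\<close> conjugates
  \<open>L j a \<circ> L i a\<close> into \<open>L j a\<close>, and likewise their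
  \<open>m\<close>-th powers. \<open>Z\<close> collects further factors that this conjugation leaves
  alone.\<close>

lemma card_moved_drop:
  assumes ix: "indices [a, i, j]" and Z: "L i j \<circ> Z = Z \<circ> L i j"
  shows "card (moved (L j a ^^ m \<circ> (L i a ^^ m \<circ> Z))) = card (moved (L j a ^^ m \<circ> Z))"
proof (rule card_moved_conj[symmetric])
  have ix': "indices [i, j, a]" "indices [j, a, i]" using ix by (auto simp: indices_def)
  show "L i j permutes X" using ix by (intro perm) (simp add: indices_def)
  have "L i j \<circ> (L j a \<circ> L i a) ^^ m = L j a ^^ m \<circ> L i j"
    by (rule comp_conj_funpow) (rule steinberg(1)[OF ix'(1), symmetric])
  then have "L i j \<circ> (L j a ^^ m \<circ> L i a ^^ m) = L j a ^^ m \<circ> L i j"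
    using funpow_comp_distrib[OF comm(2)[OF ix'(2)]] by simp
  then show "L i j \<circ> (L j a ^^ m \<circ> (L i a ^^ m \<circ> Z)) = (L j a ^^ m \<circ> Z) \<circ> L i j"
    using Z by (metis comp_assoc)
qed


text \<open>The exponent \<open>m\<close> is there to produce involutions out of transvections of
  even order; commutation and the conjugations of \<open>card_moved_drop\<close> survive the passage
  to \<open>m\<close>-th powers.\<close>

abbreviation row_prod :: "nat \<Rightarrow> nat \<Rightarrow> nat \<Rightarrow> nat \<Rightarrow> nat \<Rightarrow> nat \<Rightarrow> bit \<times> bit \<times> bit \<times> bit \<Rightarrow> 'x \<Rightarrow> 'x" where
  "row_prod m a p q r t \<equiv> quad (L p a ^^ m) (L q a ^^ m) (L r a ^^ m) (L t a ^^ m)"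

lemma row_prod_permutes:
  "indices [a, p, q, r, t] \<Longrightarrow> row_prod m a p q r t v permutes X"
  by (intro quad_permutes permutes_funpow perm) (auto simp: indices_def)

lemma L_funpow_commute:
  "indices [a, i, j] \<Longrightarrow> L i a ^^ m \<circ> L j a ^^ m = L j a ^^ m \<circ> L i a ^^ m"
  using comm(2)[of i a j] by (intro comp_commute_funpow) (auto simp: indices_def)

lemma row_prod_add:
  assumes ix: "indices [a, p, q, r, t]"
    and inv: "\<And>i j. indices [i, j] \<Longrightarrow> L i j ^^ m \<circ> L i j ^^ m = id"
  shows "row_prod m a p q r t (v + w) = row_prod m a p q r t v \<circ> row_prod m a p q r t w"
  using ix by (intro quad_add inv L_funpow_commute) (auto simp: indices_def)

text \<open>\<open>card_moved_drop\<close> removes the second factor of a product again and again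
  until a single power remains, and single powers are conjugate to each other. The fifteen nonzero
  vectors are treated one by one.\<close>

lemma card_moved_row_prod:
  assumes ix: "indices [a, p, q, r, t]" and v: "v \<noteq> 0"
  shows "card (moved (row_prod m a p q r t v)) = card (moved (L p a ^^ m))"
proof -
  have single: "card (moved (L i a ^^ m)) = card (moved (L p a ^^ m))" if "i \<in> {q, r, t}" for i
    using that ix by (intro conjugate_card_moved conjugate_funpow conjugate_L) (auto simp: indices_def)
  have far: "L i j \<circ> L k a ^^ m = L k a ^^ m \<circ> L i j" if "indices [a, i, j, k]" for i j k
    using comp_conj_funpow[OF comm(5)[of i j k a]] that by (auto simp: indices_def)
  have two: "card (moved (L j a ^^ m \<circ> L i a ^^ m)) = card (moved (L j a ^^ m))"
    if "indices [a, i, j]" for i j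
    using card_moved_drop[OF that, of id m] by (simp only: comp_id id_comp)
  have three: "card (moved (L j a ^^ m \<circ> (L i a ^^ m \<circ> L k a ^^ m))) = card (moved (L j a ^^ m \<circ> L k a ^^ m))"
    if "indices [a, i, j, k]" for i j k
    using that by (intro card_moved_drop far) (auto simp: indices_def)
  have four: "card (moved (L j a ^^ m \<circ> (L i a ^^ m \<circ> (L k a ^^ m \<circ> L l a ^^ m)))) =
      card (moved (L j a ^^ m \<circ> (L k a ^^ m \<circ> L l a ^^ m)))"
    if "indices [a, i, j, k, l]" for i j k l
  proof (intro card_moved_drop)
    have "indices [a, i, j, k]" "indices [a, i, j, l]" using that by (auto simp: indices_def)
    then show "L i j \<circ> (L k a ^^ m \<circ> L l a ^^ m) = L k a ^^ m \<circ> L l a ^^ m \<circ> L i j"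
      using far by (metis comp_assoc)
  qed (use that in \<open>auto simp: indices_def\<close>)
  obtain v1 v2 v3 v4 where v': "v = (v1, v2, v3, v4)" by (metis prod.exhaust)
  note pw_id = pw_simps comp_id id_comp
  have ix': "indices [a, q, p]" "indices [a, r, p]" "indices [a, t, p]" "indices [a, r, q]" "indices [a, t, q]"
     "indices [a, t, r]" "indices [a, q, p, r]" "indices [a, q, p, t]" "indices [a, r, p, t]" "indices [a, r, q, t]"
     "indices [a, q, p, r, t]"
    using ix by (auto simp: indices_def)
  show ?thesis
    using v unfolding v'
    by (cases v1; cases v2; cases v3; cases v4)
       (simp_all only: quad.simps pw_id single two three four ix' insertCI insertI1 insertI2, simp add: zero_prod_def)
qed

lemma row_prod_regular:
  assumes ix: "indices [a, p, q, r, t]"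
    and inv: "\<And>i j. indices [i, j] \<Longrightarrow> L i j ^^ m \<circ> L i j ^^ m = id" and ne: "L p a ^^ m \<noteq> id"
  obtains Y where "Y \<subseteq> X" "card Y = 16" "card (X - Y) \<le> 1" "\<And>v. v \<noteq> 0 \<Longrightarrow> moved (row_prod m a p q r t v) = Y"
    "\<And>x y. x \<in> Y \<Longrightarrow> y \<in> Y \<Longrightarrow> \<exists>v. y = row_prod m a p q r t v x"
proof (rule regular_sixteen[where e = "row_prod m a p q r t", OF finite_X card_X finite_card_bit4 row_prod_add[OF ix inv]
      row_prod_permutes[OF ix] card_moved_row_prod[OF ix]])
  have "finite (moved (L p a ^^ m))"
    using ix by (intro finite_moved[OF finite_X] permutes_funpow perm) (auto simp: indices_def)
  then show "card (moved (L p a ^^ m)) > 0"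
    using ne by (simp only: card_gt_0_iff moved_empty_iff simp_thms not_False_eq_True)
next
  fix Y assume Y: "Y \<subseteq> X" "card Y = 16" "card (X - Y) \<le> 1"
    "\<And>v. v \<noteq> 0 \<Longrightarrow> moved (row_prod m a p q r t v) = Y"
    "\<And>x y. x \<in> Y \<Longrightarrow> y \<in> Y \<Longrightarrow> \<exists>v. y = row_prod m a p q r t v x"
  show thesis by (rule that[OF Y])
qed

lemma row_prod_centralizer:
  assumes ix: "indices [a, p, q, r, t]"
    and inv: "\<And>i j. indices [i, j] \<Longrightarrow> L i j ^^ m \<circ> L i j ^^ m = id" and ne: "L p a ^^ m \<noteq> id"
    and g: "g permutes X" "\<And>i. i \<in> {p, q, r, t} \<Longrightarrow> g \<circ> L i a = L i a \<circ> g"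
  shows "\<exists>v. g = row_prod m a p q r t v"
proof (rule row_prod_regular[OF ix inv ne])
  fix Y assume Y: "Y \<subseteq> X" "card Y = 16" "card (X - Y) \<le> 1"
    "\<And>v. v \<noteq> 0 \<Longrightarrow> moved (row_prod m a p q r t v) = Y"
    "\<And>x y. x \<in> Y \<Longrightarrow> y \<in> Y \<Longrightarrow> \<exists>v. y = row_prod m a p q r t v x"
  have "Y \<noteq> {}" using Y(2) by auto
  show ?thesis
  proof (rule regular_centralizer[where e = "row_prod m a p q r t" and ?v0.0 = "(1, 1, 1, 1)", OF finite_X Y(1) \<open>Y \<noteq> {}\<close> Y(3)
      row_prod_add[OF ix inv] row_prod_permutes[OF ix] Y(4) Y(5)])
    show "g \<circ> row_prod m a p q r t v = row_prod m a p q r t v \<circ> g" for v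
      by (intro quad_commute comp_conj_funpow g(2)) auto
  qed (auto simp: zero_prod_def g(1))
qed

text \<open>\<open>L 0 1\<close> commutes with all \<open>L i 1\<close> and so belongs to the
  regular group built from their \<open>m\<close>-th powers; every member of that group squares to
  the identity.\<close>

lemma even_order:
  assumes m: "L 0 1 ^^ m \<noteq> id" "L 0 1 ^^ m \<circ> L 0 1 ^^ m = id"
    and ij: "indices [i, j]"
  shows "L i j \<circ> L i j = id"
proof -
  have ix: "indices [1, 0, 2, 3, 4]" by (simp add: indices_def)
  have m2: "L 0 1 ^^ (m + m) = id" using m(2) by (simp only: funpow_add)
  have "L k l ^^ (m + m) = id" if "indices [k, l]" for k l
    using L_funpow_id_iff[OF _ that, of 0 1 "m + m"] m2 by (simp only: indices_def) simp
  then have inv: "L k l ^^ m \<circ> L k l ^^ m = id" if "indices [k, l]" for k l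
    using that by (simp only: funpow_add)
  have "\<exists>v. L 0 1 = row_prod m 1 0 2 3 4 v"
  proof (rule row_prod_centralizer[OF ix inv m(1)])
    show "L 0 1 permutes X" by (rule perm) (simp add: indices_def)
    show "L 0 1 \<circ> L i 1 = L i 1 \<circ> L 0 1" if "i \<in> {0, 2, 3, 4}" for i
      using that comm(2)[of 0 1 i] by (auto simp: indices_def)
  qed
  then obtain v where v: "L 0 1 = row_prod m 1 0 2 3 4 v" by blast
  have "v + v = 0"
    by (cases v) (simp add: zero_prod_def)
  then have "L 0 1 \<circ> L 0 1 = row_prod m 1 0 2 3 4 0"
    using row_prod_add[OF ix inv, of v v] v by (simp only:)
  also have "\<dots> = id"
    by (simp only: zero_prod_def quad.simps pw_simps comp_id)
  finally have "L 0 1 ^^ 2 = id"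
    unfolding numeral_2_eq_2 funpow.simps comp_id .
  moreover have "indices [0, 1]" by (simp add: indices_def)
  ultimately have "L i j ^^ 2 = id"
    using L_funpow_id_iff[OF _ ij] by blast
  then show ?thesis
    unfolding numeral_2_eq_2 funpow.simps comp_id .
qed

end

section \<open>Equality of left and right transvections, and the exclusion of involutions\<close>

context transvection_action
begin

lemma R_nontrivial:
  assumes ne: "\<And>i j. indices [i, j] \<Longrightarrow> L i j \<noteq> id" and ijk: "indices [i, j, k]"
  shows "R j k \<noteq> id"
proof
  assume "R j k = id"
  have ij: "indices [i, j]" "indices [i, k]" using ijk by (auto simp: indices_def)
  have "L i j = L i k \<circ> L i j"
    using steinberg(4)[OF ijk] unfolding \<open>R j k = id\<close> comp_id id_comp .
  then have "L i k = id"
    by (simp only: permutes_comp_cancel(4)[OF perm(1)[OF ij(1)]])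
  with ne[OF ij(2)] show False ..
qed

lemma pw_comp_commute: "f \<circ> g = g \<circ> f \<Longrightarrow> pw v f \<circ> g = g \<circ> pw v f"
  unfolding pw_def by (cases "v = 1") (simp_all only: if_True if_False comp_id id_comp simp_thms)

text \<open>Suppose \<open>L q a\<close> occurs, so that \<open>R p a\<close> is
  \<open>L q a \<circ> M\<close>. Here \<open>R t q\<close> commutes with \<open>M\<close>, hence by
  the mixed Steinberg relation its commutator with \<open>R p a\<close> is \<open>R t a\<close>. But
  \<open>R t q\<close> commutes with \<open>R p a\<close>, which would make \<open>R t a\<close>
  trivial.\<close>

lemma R_coordinate:
  assumes ne: "\<And>i j. indices [i, j] \<Longrightarrow> L i j \<noteq> id" and ix: "indices [a, p, q, r, t]"
    and R: "R p a = quad (L p a) (L q a) (L r a) (L t a) (v1, v2, v3, v4)"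
  shows "v2 = 0"
proof (rule ccontr)
  assume "v2 \<noteq> 0"
  then have v2: "v2 = 1" by simp
  have sub: "indices [p, a, q]" "indices [p, a, t, q]" "indices [r, a, t, q]" "indices [t, a, q]" "indices [t, q, a]"
    "indices [t, q]" "indices [p, a]" "indices [p, t, a]"
    using ix by (auto simp: indices_def)
  define M where "M = pw v1 (L p a) \<circ> (pw v3 (L r a) \<circ> pw v4 (L t a))"
  have "pw v1 (L p a) \<circ> L q a = L q a \<circ> pw v1 (L p a)"
    by (rule pw_comp_commute[OF comm(2)[OF sub(1)]])
  then have RM: "R p a = L q a \<circ> M"
    unfolding R quad.simps v2 pw_simps M_def by (metis comp_assoc)
  have "M \<circ> R t q = R t q \<circ> M"
    using pw_comp_commute[OF comm(6)[OF sub(2)], of v1] pw_comp_commute[OF comm(6)[OF sub(3)], of v3]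
      pw_comp_commute[OF comm(4)[OF sub(4)], of v4]
    unfolding M_def by (metis comp_assoc)
  then have "R p a \<circ> R t q = R t a \<circ> (R t q \<circ> R p a)"
    using steinberg(3)[OF sub(5)] unfolding RM by (metis comp_assoc)
  also have "R t q \<circ> R p a = R p a \<circ> R t q"
    using comm(7)[OF sub(2)] by (rule sym)
  finally have "R t a = id"
    by (simp only: permutes_comp_cancel(4)[OF permutes_compose[OF perm(2)[OF sub(6)] perm(2)[OF sub(7)]]])
  with R_nontrivial[OF ne sub(8)] show False ..
qed

lemma R_eq_L:
  assumes inv: "\<And>i j. indices [i, j] \<Longrightarrow> L i j \<circ> L i j = id"
    and ne: "\<And>i j. indices [i, j] \<Longrightarrow> L i j \<noteq> id" and ix: "indices [a, p, q, r, t]"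
  shows "R p a = L p a"
proof -
  have one: "f ^^ 1 = f" for f :: "'x \<Rightarrow> 'x" by simp
  have pa: "indices [p, a]" "indices [q, p, a]" and ix': "indices [a, p, r, q, t]" "indices [a, p, t, r, q]"
    using ix by (auto simp: indices_def)
  have "\<exists>v. R p a = row_prod 1 a p q r t v"
  proof (rule row_prod_centralizer[OF ix])
    show "L i j ^^ 1 \<circ> L i j ^^ 1 = id" if "indices [i, j]" for i j
      unfolding one by (rule inv[OF that])
    show "L p a ^^ 1 \<noteq> id"
      unfolding one by (rule ne[OF pa(1)])
    show "R p a permutes X" by (rule perm[OF pa(1)])
    show "R p a \<circ> L i a = L i a \<circ> R p a" if "i \<in> {p, q, r, t}" for i
      using that comm(1)[OF pa(1)] comm(3)[of i a p] ix by (auto simp: indices_def)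
  qed
  then obtain v1 v2 v3 v4 where v: "R p a = quad (L p a) (L q a) (L r a) (L t a) (v1, v2, v3, v4)"
    unfolding one by auto
  have v2: "v2 = 0" by (rule R_coordinate[OF ne ix v])
  \<comment> \<open>A factor with exponent 0 can be written anywhere, so the next coordinate may be
    moved into the second position, where \<open>R_coordinate\<close> applies.\<close>
  have "R p a = quad (L p a) (L r a) (L q a) (L t a) (v1, v3, v2, v4)"
    unfolding v v2 quad.simps pw_simps id_comp ..
  from R_coordinate[OF ne ix'(1) this] have v3: "v3 = 0" .
  have "R p a = quad (L p a) (L t a) (L r a) (L q a) (v1, v4, v3, v2)"
    unfolding v v2 v3 quad.simps pw_simps id_comp comp_id ..
  from R_coordinate[OF ne ix'(2) this] have v4: "v4 = 0" .
  have "R p a = pw v1 (L p a)"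
    unfolding v v2 v3 v4 quad.simps pw_simps id_comp comp_id ..
  with R_nontrivial[OF ne pa(2)] show ?thesis
    by (auto simp: pw_def)
qed

lemma no_involution:
  assumes inv: "\<And>i j. indices [i, j] \<Longrightarrow> L i j \<circ> L i j = id"
    and ne: "\<And>i j. indices [i, j] \<Longrightarrow> L i j \<noteq> id"
  shows False
proof -
  have one: "f ^^ 1 = f" for f :: "'x \<Rightarrow> 'x" by simp
  have RL: "R i j = L i j" if "i \<noteq> j" "i < 5" "j < 5" for i j
  proof -
    have "card ({..<5} - {i, j}) = 3"
      using that by (subst card_Diff_subset) auto
    then obtain q r t where "{..<5} - {i, j} = {q, r, t}" "q \<noteq> r" "q \<noteq> t" "r \<noteq> t"
      unfolding card_3_iff by blast
    then have "indices [j, i, q, r, t]"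
      using that by (auto simp: indices_def set_eq_iff)
    from R_eq_L[OF inv ne this] show ?thesis by simp
  qed
  \<comment> \<open>This is what the equality of \<open>R\<close> and \<open>L\<close> buys:
    \<open>L i j\<close> commutes with \<open>R i k\<close> in any case.\<close>
  have same_row: "L i j \<circ> L i k = L i k \<circ> L i j" if "indices [i, j, k]" for i j k
    using comm(4)[OF that] RL[of i k] that by (simp add: indices_def)
  have ix: "indices [0, 1, 2, 3, 4]" by (simp add: indices_def)
  define e where "e = quad (L 1 0) (L 2 0) (L 3 0) (L 4 0)"
  have e: "e = row_prod 1 0 1 2 3 4" unfolding e_def one ..
  have inv1: "L i j ^^ 1 \<circ> L i j ^^ 1 = id" if "indices [i, j]" for i j
    unfolding one by (rule inv[OF that])
  have ne1: "L 1 0 ^^ 1 \<noteq> id"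
    unfolding one by (rule ne) (simp add: indices_def)
  obtain Y where Y: "Y \<subseteq> X" "card Y = 16" "card (X - Y) \<le> 1" and movedY: "\<And>v. v \<noteq> 0 \<Longrightarrow> moved (e v) = Y"
    and trans: "\<And>x y. x \<in> Y \<Longrightarrow> y \<in> Y \<Longrightarrow> \<exists>v. y = e v x"
    unfolding e by (rule row_prod_regular[OF ix inv1 ne1]) auto
  have add: "e (v + w) = e v \<circ> e w" for v w
    unfolding e by (rule row_prod_add[OF ix inv1])
  have e_perm: "e v permutes X" for v
    unfolding e by (rule row_prod_permutes[OF ix])
  have L10: "moved (L 1 0) = Y"
    using movedY[of "(1, 0, 0, 0)"] unfolding e_def quad.simps pw_simps comp_id by (simp add: zero_prod_def)
  have perm': "L i j permutes X" if "i \<noteq> j" "i < 5" "j < 5" for i j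
    using that by (intro perm) (simp add: indices_def)
  have com: "L i j (L k l x) = L k l (L i j x)"
    if "i \<noteq> j" "k \<noteq> l" "i \<noteq> l" "k \<noteq> j" "i < 5" "j < 5" "k < 5" "l < 5" for i j k l x
  proof -
    have "L i j \<circ> L k l = L k l \<circ> L i j"
      using that comm(2)[of i j k] comm(5)[of i j k l] same_row[of i j l]
      by (cases "i = k"; cases "j = l") (auto simp: indices_def)
    from fun_cong[OF this, of x] show ?thesis by simp
  qed
  have invol: "L i j (L i j x) = x" if "i \<noteq> j" "i < 5" "j < 5" for i j x
    using fun_cong[OF inv[of i j], of x] that by (simp add: indices_def)
  \<comment> \<open>Moving \<open>L i j\<close> through \<open>L j 0\<close> creates one factor
    \<open>L i 0\<close>, so \<open>L i j\<close> normalizes the group of all \<open>e v\<close> and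
    acts on it as an elementary matrix.\<close>
  have shift: "L i j (L j 0 x) = L i 0 (L j 0 (L i j x))" if "indices [i, j, 0]" for i j x
  proof -
    have ij: "i \<noteq> j" "i \<noteq> 0" "j \<noteq> 0" "i < 5" "j < 5" using that by (auto simp: indices_def)
    have "L i j (L j 0 x) = L i j (L j 0 (L i 0 (L i 0 x)))"
      using ij by (simp add: invol)
    also have "\<dots> = L j 0 (L i j (L i 0 x))"
      using fun_cong[OF steinberg(1)[OF that], of "L i 0 x"] by simp
    also have "L i j (L i 0 x) = L i 0 (L i j x)"
      using ij by (intro com) auto
    also have "L j 0 (L i 0 (L i j x)) = L i 0 (L j 0 (L i j x))"
      using ij by (intro com) auto
    finally show ?thesis .
  qed
  have in_Y: "g x \<in> Y \<longleftrightarrow> x \<in> Y" if "g permutes X" "g \<circ> L 1 0 = L 1 0 \<circ> g" for g x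
    using commute_moved_iff[OF that] L10 by simp
  \<comment> \<open>Commuting with \<open>L 1 0\<close> means preserving \<open>Y\<close>, hence
    fixing the at most one remaining point; with 16 moved points the support must be all of
    \<open>Y\<close>.\<close>
  have full: "moved g = Y"
    if g: "g permutes X" "g \<circ> L 1 0 = L 1 0 \<circ> g" "card (moved g) = 16" for g
  proof (rule card_subset_eq)
    show "finite Y" using Y(1) finite_X finite_subset by blast
    show "moved g \<subseteq> Y"
    proof (rule ccontr)
      assume "\<not> moved g \<subseteq> Y"
      then obtain x where x: "g x \<noteq> x" "x \<notin> Y" by (auto simp: moved_def)
      then have "{g x, x} \<subseteq> X - Y"
        using in_Y[OF g(1,2), of x] permutes_in_image[OF g(1), of x] permutes_not_in[OF g(1), of x] by auto
      then have "card {g x, x} \<le> 1"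
        using card_mono[of "X - Y"] finite_X Y(3) by (meson finite_Diff le_trans)
      with x(1) show False by simp
    qed
  qed (use g(3) Y(2) in simp)
  have faithful: "v = w" if "e v x = e w x" "x \<in> Y" for v w x
  proof (rule ccontr)
    assume "v \<noteq> w"
    then have "v - w \<noteq> 0" by simp
    have "e (v - w) \<circ> e w = e w \<circ> e (v - w)"
      by (metis add add.commute)
    then have "e w x \<in> Y"
      using commute_moved_iff[OF e_perm, of w "e (v - w)" x] movedY[OF \<open>v - w \<noteq> 0\<close>] that(2) by simp
    moreover have "e (v - w) (e w x) = e w x"
      using add[of "v - w" w] that(1) by (simp add: fun_eq_iff)
    ultimately show False
      using movedY[OF \<open>v - w \<noteq> 0\<close>] by (auto simp: moved_def)
  qed
  \<comment> \<open>The linear part of \<open>L 3 4\<close> in the coordinates \<open>v1\<close> to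
    \<open>v4\<close>, which are the exponents of \<open>L 1 0\<close> to \<open>L 4 0\<close>.
    Taking \<open>x\<close> as origin identifies \<open>Y\<close> with the vector space, and
    \<open>L 3 4\<close> becomes this linear map followed by a translation.\<close>
  have L34: "L 3 4 (e (v1, v2, v3, v4) x) = e (v1, v2, v3 + v4, v4) (L 3 4 x)" for v1 v2 v3 v4 x
    using com[of 3 4 1 0] com[of 3 4 2 0] com[of 3 4 3 0] shift[of 3 4] invol[of 3 0]
    by (cases v1; cases v2; cases v3; cases v4) (simp_all add: e_def indices_def)
  have L12: "L 1 2 (e (v1, v2, v3, v4) x) = e (v1 + v2, v2, v3, v4) (L 1 2 x)" for v1 v2 v3 v4 x
    using com[of 1 2 1 0] com[of 1 2 3 0] com[of 1 2 4 0] shift[of 1 2] invol[of 1 0]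
    by (cases v1; cases v2; cases v3; cases v4) (simp_all add: e_def indices_def)
  have L21: "L 2 1 (e (v1, v2, v3, v4) x) = e (v1, v1 + v2, v3, v4) (L 2 1 x)" for v1 v2 v3 v4 x
    using com[of 2 1 2 0] com[of 2 1 3 0] com[of 2 1 4 0] shift[of 2 1] invol[of 2 0] com[of 2 0 1 0]
    by (cases v1; cases v2; cases v3; cases v4) (simp_all add: e_def indices_def)
  obtain x where x: "x \<in> Y" using Y(2) by (metis card.empty ex_in_conv zero_neq_numeral)
  have comL10: "L i j \<circ> L 1 0 = L 1 0 \<circ> L i j" if "i \<noteq> 0" "j \<noteq> 1" "i \<noteq> j" "i < 5" "j < 5" for i j
    using com[of i 0 1 j] that by (auto simp: fun_eq_iff intro: com)
  have L20: "moved (L 2 0) = Y"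
    using movedY[of "(0, 1, 0, 0)"] unfolding e_def quad.simps pw_simps comp_id id_comp by (simp add: zero_prod_def)
  have "L 3 4 x \<in> Y" "L 1 2 x \<in> Y"
    using in_Y[OF perm' comL10] x by auto
  \<comment> \<open>\<open>L 2 1\<close> is not covered by \<open>comL10\<close>; it commutes with
    \<open>L 2 0\<close>, which has the same support \<open>Y\<close>.\<close>
  moreover have "L 2 1 x \<in> Y"
    using commute_moved_iff[OF perm'[of 2 1], of "L 2 0" x] same_row[of 2 1 0] L20 x by (simp add: indices_def)
  ultimately obtain i j k where "L 3 4 x = e i x" "L 1 2 x = e j x" "L 2 1 x = e k x"
    using trans[OF x] by metis
  then obtain i1 i2 i3 i4 j1 j2 j3 j4 k1 k2 k3 k4 where
    i: "L 3 4 x = e (i1, i2, i3, i4) x" and j: "L 1 2 x = e (j1, j2, j3, j4) x" and k: "L 2 1 x = e (k1, k2, k3, k4) x"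
    by (metis prod.exhaust)
  have ee: "e v (e w y) = e (v + w) y" for v w y
    by (simp add: add)
  \<comment> \<open>As \<open>L 3 4\<close> squares to the identity, its linear part must cancel its
    translation vector against itself; in characteristic 2 the third coordinate of the sum is
    \<open>i4\<close>.\<close>
  have "e ((i1, i2, i3 + i4, i4) + (i1, i2, i3, i4)) x = L 3 4 (L 3 4 x)"
    unfolding i L34 ee ..
  also have "\<dots> = e 0 x"
    by (simp add: invol e_def zero_prod_def)
  finally have i4: "i4 = 0"
    using faithful[OF _ x] by (fastforce simp: zero_prod_def)
  \<comment> \<open>\<open>L 1 2\<close> and \<open>L 2 1\<close> commute with \<open>L 3 4\<close>,
    so their linear parts fix its translation vector in the first two coordinates; this kills
    \<open>i2\<close> and \<open>i1\<close>.\<close>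
  have "L 3 4 (L 1 2 x) = L 1 2 (L 3 4 x)" "L 3 4 (L 2 1 x) = L 2 1 (L 3 4 x)"
    by (rule com; simp)+
  then have "e ((j1, j2, j3 + j4, j4) + (i1, i2, i3, i4)) x = e ((i1 + i2, i2, i3, i4) + (j1, j2, j3, j4)) x"
    "e ((k1, k2, k3 + k4, k4) + (i1, i2, i3, i4)) x = e ((i1, i1 + i2, i3, i4) + (k1, k2, k3, k4)) x"
    by (simp_all only: i j k L34 L12 L21 ee)
  then have "(j1, j2, j3 + j4, j4) + (i1, i2, i3, i4) = (i1 + i2, i2, i3, i4) + (j1, j2, j3, j4)"
    "(k1, k2, k3 + k4, k4) + (i1, i2, i3, i4) = (i1, i1 + i2, i3, i4) + (k1, k2, k3, k4)"
    using faithful[OF _ x] by blast+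
  then have "j1 + i1 = i1 + i2 + j1" "k2 + i2 = i1 + i2 + k2"
    by (simp_all only: add_Pair prod.inject)
  then have i12: "i1 = 0" "i2 = 0"
    by (cases i1; cases i2; cases j1; cases k2; simp)+
  have m16: "card (moved (L i j)) = 16" if "i \<noteq> j" "i < 5" "j < 5" for i j
    using conjugate_card_moved[OF conjugate_L[of i j 1 0]] L10 Y(2) that by (simp add: indices_def)
  have "moved (L 3 4) = Y"
    using full[OF perm' comL10 m16] by simp
  moreover have "moved (L 3 0 \<circ> L 3 4) = Y"
  proof (rule full)
    show "L 3 0 \<circ> L 3 4 permutes X"
      by (intro permutes_compose perm') auto
    show "L 3 0 \<circ> L 3 4 \<circ> L 1 0 = L 1 0 \<circ> (L 3 0 \<circ> L 3 4)"
      using com[of 3 4 1 0] com[of 3 0 1 0] by (simp add: fun_eq_iff)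
    have "L 0 4 \<circ> L 3 0 = (L 3 0 \<circ> L 3 4) \<circ> L 0 4"
      using steinberg(1)[of 3 0 4] com[of 0 4 3 4] by (simp add: indices_def fun_eq_iff)
    from card_moved_conj[OF perm' this] m16[of 3 0] show "card (moved (L 3 0 \<circ> L 3 4)) = 16"
      by simp
  qed
  \<comment> \<open>Only \<open>i3\<close> is left, so \<open>L 3 4 x\<close> is \<open>x\<close> or
    \<open>L 3 0 x\<close>; in the second case \<open>L 3 0 \<circ> L 3 4\<close> fixes
    \<open>x\<close>.\<close>
  ultimately have "L 3 4 x \<noteq> x" "L 3 0 (L 3 4 x) \<noteq> x"
    using x by (auto simp: moved_def)
  then show False
    using i invol[of 3 0 x] unfolding i12 i4 e_def by (cases i3) simp_all
qed

theorem L_trivial: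
  assumes ij: "indices [i, j]"
  shows "L i j = id"
proof (rule ccontr)
  assume ne: "L i j \<noteq> id"
  have id1: "f = id \<longleftrightarrow> f ^^ 1 = id" for f :: "'x \<Rightarrow> 'x" by simp
  have nontriv: "L k l \<noteq> id" if "indices [k, l]" for k l
    using ne L_funpow_id_iff[OF ij that, of 1] unfolding id1[symmetric] by simp
  have ix: "indices [0, 1]" by (simp add: indices_def)
  obtain n where n: "n > 0" "L 0 1 ^^ n = id"
    using permutes_funpow_eq_id[OF finite_X perm(1)[OF ix]] by blast
  then consider m where "odd m" "L 0 1 ^^ m = id" | m where "L 0 1 ^^ m \<noteq> id" "L 0 1 ^^ m \<circ> L 0 1 ^^ m = id"
    using odd_or_involution[OF n(2,1)] by blast
  then show False
  proof cases
    case 1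
    then show False using odd_order nontriv[OF ix] by blast
  next
    case 2
    show False using no_involution[OF even_order[OF 2] nontriv] .
  qed
qed

end


section \<open>Nielsen reduction\<close>

fun common_prefix_length :: "'a list \<Rightarrow> 'a list \<Rightarrow> nat" where
  "common_prefix_length (x # xs) (y # ys) = (if x = y then Suc (common_prefix_length xs ys) else 0)"
| "common_prefix_length _ _ = 0"

lemma common_prefix_length_commute: "common_prefix_length v w = common_prefix_length w v"
  by (induction v w rule: common_prefix_length.induct) auto

lemma take_common_prefix_length: "take (common_prefix_length v w) v = take (common_prefix_length v w) w"
  by (induction v w rule: common_prefix_length.induct) auto

lemma common_prefix_length_le: "common_prefix_length v w \<le> length v" "common_prefix_length v w \<le> length w"
  by (induction v w rule: common_prefix_length.induct) auto

lemma drop_common_prefix_length: "drop (common_prefix_length v w) v = [] \<or> drop (common_prefix_length v w) w = [] \<or> hd (drop (common_prefix_length v w) v) \<noteq> hd (drop (common_prefix_length v w) w)"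
  by (induction v w rule: common_prefix_length.induct) auto

text \<open>The number of letters that cancel from each factor when the product of two reduced words
  is formed.\<close>

definition canc :: "'a letter list \<Rightarrow> 'a letter list \<Rightarrow> nat" where
  "canc v w = common_prefix_length (inv_word v) w"

lemma canc_inv: "canc (inv_word w) (inv_word v) = canc v w"
  by (simp add: canc_def common_prefix_length_commute)

lemma canc_le: "canc v w \<le> length v" "canc v w \<le> length w"
  using common_prefix_length_le[of "inv_word v" w] by (simp_all add: canc_def)

lemma canc_decomp:
  assumes "freely_reduced v" "freely_reduced w"
  obtains x p y where "v = x @ inv_word p" "w = p @ y" "length p = canc v w" "freely_reduced (x @ y)"
    "foldr cons_reduce v w = x @ y"
proof -
  let ?k = "canc v w"
  define p y x where "p = take ?k w" and "y = drop ?k w" and "x = inv_word (drop ?k (inv_word v))"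
  have w: "w = p @ y" by (simp add: p_def y_def)
  have "inv_word v = p @ inv_word x"
    unfolding p_def x_def canc_def by (metis append_take_drop_id inv_word_simps(6) take_common_prefix_length)
  then have v: "v = x @ inv_word p"
    by (metis inv_word_simps(3,6))
  have p: "length p = ?k"
    using canc_le(2)[of v w] by (simp add: p_def)
  have red: "freely_reduced (x @ y)"
  proof -
    have "inv_word x = [] \<or> y = [] \<or> hd (inv_word x) \<noteq> hd y"
      using drop_common_prefix_length[of "inv_word v" w] by (simp add: x_def y_def canc_def)
    moreover have "hd (inv_word x) = inv_letter (last x)" if "x \<noteq> []"
      using that by (simp add: inv_word_def hd_map hd_rev)
    ultimately show ?thesis
      using assms v w by (auto simp: freely_reduced_append)
  qed
  have "freely_reduced y" "freely_reduced (p @ y)"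
    using assms(2) w by (auto simp: freely_reduced_append)
  then have "foldr cons_reduce (inv_word p) (p @ y) = y"
    using foldr_cons_reduce_inv_cancel[of y "inv_word p"] foldr_cons_reduce_append[of p y] by simp
  then have "foldr cons_reduce v w = x @ y"
    using foldr_cons_reduce_append[OF red] by (simp add: v w)
  with v w p red that show thesis by blast
qed

text \<open>If half of \<open>u\<close> cancelled against itself, the two middle letters would be
  mutually inverse, or the one middle letter its own inverse.\<close>

lemma canc_self:
  assumes u: "freely_reduced u" "u \<noteq> []"
  shows "2 * canc u u < length u"
proof (rule ccontr)
  assume "\<not> ?thesis"
  then have le: "length u \<le> 2 * canc u u" by simp
  have nth: "u ! i = inv_letter (u ! (length u - 1 - i))" if "i < canc u u" for i
  proof -
    have i: "i < length u" using that canc_le(1)[of u u] by simp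
    have "u ! i = inv_word u ! i"
      using arg_cong[OF take_common_prefix_length[of "inv_word u" u], of "\<lambda>l. l ! i"] that by (simp add: canc_def)
    also have "\<dots> = inv_letter (u ! (length u - 1 - i))"
      using i by (simp add: inv_word_def rev_nth)
    finally show ?thesis .
  qed
  show False
  proof (cases "even (length u)")
    case True
    then obtain k where k: "length u = 2 * k" by blast
    with u(2) have k0: "k > 0" by (cases k) auto
    have "u ! (k - 1) = inv_letter (u ! k)"
      using nth[of "k - 1"] k0 le k by (simp add: mult_2)
    moreover have "u ! Suc (k - 1) \<noteq> inv_letter (u ! (k - 1))"
      using u(1) k k0 unfolding freely_reduced_def successively_conv_nth
      by (metis Suc_diff_1 less_add_same_cancel1 mult_2)
    ultimately show False using k0 by simp
  next
    case False
    then obtain k where k: "length u = 2 * k + 1" by (blast elim: oddE)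
    then have "u ! k = inv_letter (u ! k)"
      using nth[of k] le by simp
    then show False by simp
  qed
qed

fun digit :: "nat letter \<Rightarrow> nat" where
  "digit (x, b) = 2 * x + (if b then 1 else 0)"

text \<open>Words are read as numerals in base \<open>2 * n\<close>, a lexicographic order on words
  of equal length whose values can be added up over a basis.\<close>

fun code :: "nat \<Rightarrow> nat letter list \<Rightarrow> nat" where
  "code n [] = 0"
| "code n (a # w) = digit a * (2 * n) ^ length w + code n w"

lemma code_append: "code n (p @ r) = code n p * (2 * n) ^ length r + code n r"
  by (induction p) (auto simp: power_add algebra_simps)

lemma digit_less: "fst a < n \<Longrightarrow> digit a < 2 * n"
  by (cases a) auto

lemma code_less: "set w \<subseteq> {..<n} \<times> UNIV \<Longrightarrow> code n w < (2 * n) ^ length w"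
proof (induction w)
  case (Cons a w)
  then have "digit a + 1 \<le> 2 * n" using digit_less[of a n] by auto
  then have "(digit a + 1) * (2 * n) ^ length w \<le> (2 * n) ^ length (a # w)"
    by (metis length_Cons mult_le_mono1 power_Suc)
  with Cons show ?case by simp
qed simp

lemma code_inject:
  assumes "set v \<subseteq> {..<n} \<times> UNIV" "set w \<subseteq> {..<n} \<times> UNIV" "length v = length w" "code n v = code n w"
  shows "v = w"
  using assms(3,1,2,4)
proof (induction v w rule: list_induct2)
  case (Cons a v b w)
  define B where "B = (2 * n) ^ length w"
  have l: "code n v < B" "code n w < B"
    using code_less[of v n] code_less[of w n] Cons by (auto simp: B_def)
  have eq: "digit a * B + code n v = digit b * B + code n w"
    using Cons by (simp add: B_def)
  then have "(digit a * B + code n v) div B = (digit b * B + code n w) div B" by simp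
  with l have "digit a = digit b" by simp
  then have "a = b"
    by (cases a; cases b) (auto split: if_splits, presburger+)
  with eq Cons show ?case by simp
qed simp

text \<open>Among words of the same length the weight singles out one with small initial halves; this breaks the
  ties that length alone leaves in the reduction of a basis.\<close>

definition half :: "'a list \<Rightarrow> 'a list" where
  "half w = take ((length w + 1) div 2) w"

definition weight :: "nat \<Rightarrow> nat letter list \<Rightarrow> nat" where
  "weight n w = code n (half w) + code n (half (inv_word w))"

lemma weight_inv [simp]: "weight n (inv_word w) = weight n w"
  by (simp add: weight_def)

text \<open>The initial halves of \<open>x @ inv_word p\<close> and \<open>x @ inv_word q\<close>
  lie inside \<open>x\<close> and agree. Those of the inverses are \<open>p\<close> and
  \<open>q\<close> followed by the same word, so the weights compare exactly as the codes of
  \<open>p\<close> and \<open>q\<close>.\<close>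

lemma weight_exchange:
  assumes n: "n > 0" and len: "length p = length q" "length p \<le> length x"
    and le: "weight n (x @ inv_word p) \<le> weight n (x @ inv_word q)"
  shows "code n p \<le> code n q"
proof -
  define h where "h = (length x + length p + 1) div 2"
  have h: "h \<le> length x" "length p \<le> h" using len(2) by (auto simp: h_def)
  have half: "half (x @ inv_word r) = take h x" "half (inv_word (x @ inv_word r)) = r @ take (h - length p) (inv_word x)"
    if "length r = length p" for r
    using that h by (simp_all add: half_def h_def add.commute)
  have "code n (p @ take (h - length p) (inv_word x)) \<le> code n (q @ take (h - length p) (inv_word x))"
    using le half[of p] half[of q] len(1) by (simp add: weight_def)
  then have "code n p * (2 * n) ^ length (take (h - length p) (inv_word x)) \<le>
      code n q * (2 * n) ^ length (take (h - length p) (inv_word x))"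
    unfolding code_append by linarith
  then show ?thesis using n by simp
qed

text \<open>Minimality under replacing \<open>u a\<close> by its product with \<open>u b\<close>.
  Indexing by letters instead of generators lets right multiplication cover left multiplication as
  well, by passing to inverses.\<close>

locale nielsen_reduced =
  fixes n :: nat and u :: "nat letter \<Rightarrow> nat letter list"
  assumes inv: "u (inv_letter a) = inv_word (u a)"
    and closed: "fst a < n \<Longrightarrow> u a \<in> carrier (free_group {..<n})"
    and nonempty: "fst a < n \<Longrightarrow> u a \<noteq> []"
    and min_length: "fst a < n \<Longrightarrow> fst b < n \<Longrightarrow> fst a \<noteq> fst b \<Longrightarrow>
      length (u a) \<le> length (foldr cons_reduce (u a) (u b))"
    and min_weight: "fst a < n \<Longrightarrow> fst b < n \<Longrightarrow> fst a \<noteq> fst b \<Longrightarrow>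
      length (foldr cons_reduce (u a) (u b)) = length (u a) \<Longrightarrow>
      weight n (u a) \<le> weight n (foldr cons_reduce (u a) (u b))"
begin

lemma reduced: "fst a < n \<Longrightarrow> freely_reduced (u a)"
  using closed by (auto simp: carrier_free_group)

text \<open>Were more than half of \<open>u b\<close> to cancel, the product with \<open>u b\<close>
  would be shorter than \<open>u a\<close>.\<close>

lemma canc_half_right:
  assumes "fst a < n" "fst b < n" "fst a \<noteq> fst b"
  shows "2 * canc (u a) (u b) \<le> length (u b)"
proof -
  obtain x p y where "u a = x @ inv_word p" "u b = p @ y" "length p = canc (u a) (u b)"
    "foldr cons_reduce (u a) (u b) = x @ y"
    using canc_decomp[OF reduced[OF assms(1)] reduced[OF assms(2)]] by metis
  with min_length[OF assms] show ?thesis by simp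
qed

lemma canc_half_left:
  assumes "fst a < n" "fst b < n" "fst a \<noteq> fst b"
  shows "2 * canc (u a) (u b) \<le> length (u a)"
  using canc_half_right[of "inv_letter b" "inv_letter a"] assms by (simp add: inv canc_inv)

lemma canc_same:
  assumes "fst a < n" "fst b = fst a" "b \<noteq> inv_letter a"
  shows "2 * canc (u a) (u b) < length (u b)" "2 * canc (u a) (u b) < length (u a)"
proof -
  have "b = a" using assms(2,3) by (auto simp: inv_letter_def prod_eq_iff)
  with canc_self[OF reduced[OF assms(1)] nonempty[OF assms(1)]]
  show "2 * canc (u a) (u b) < length (u b)" "2 * canc (u a) (u b) < length (u a)" by simp_all
qed

text \<open>If \<open>u a\<close> cancels exactly the first half \<open>p\<close> of
  \<open>u b\<close>, multiplying it by \<open>u b\<close> keeps the length and exchanges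
  \<open>p\<close> for \<open>q\<close> at its end. Minimal weight then orders the codes.\<close>

lemma code_half:
  assumes "fst a < n" "fst b < n" "b \<noteq> inv_letter a" and b: "u b = p @ inv_word q" "length p = length q"
    and c: "canc (u a) (u b) = length p"
  shows "code n p \<le> code n q"
proof -
  have ne: "fst a \<noteq> fst b"
    using canc_same(1)[OF assms(1) _ assms(3)] b c by auto
  obtain x p' y where d: "u a = x @ inv_word p'" "u b = p' @ y" "length p' = canc (u a) (u b)"
    "foldr cons_reduce (u a) (u b) = x @ y"
    using canc_decomp[OF reduced[OF assms(1)] reduced[OF assms(2)]] by metis
  with b c have "p' = p" "y = inv_word q" by auto
  note d = d[unfolded this]
  have "length p \<le> length x"
    using canc_half_left[OF assms(1,2) ne] d(1,3) by simp
  moreover have "weight n (x @ inv_word p) \<le> weight n (x @ inv_word q)"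
    using min_weight[OF assms(1,2) ne] d(1,4) b(2) by simp
  ultimately show ?thesis
    using weight_exchange[OF _ b(2)] assms(1) by simp
qed

text \<open>Each neighbour cancels at most half of \<open>u b\<close>, so total cancellation would
  mean exactly one half on either side. Applying \<open>code_half\<close> from both sides makes the
  halves mutually inverse, and \<open>u b\<close> would not be reduced.\<close>

lemma canc_sum:
  assumes abc: "fst a < n" "fst b < n" "fst c < n" and red: "b \<noteq> inv_letter a" "c \<noteq> inv_letter b"
  shows "canc (u a) (u b) + canc (u b) (u c) < length (u b)"
proof (rule ccontr)
  assume ge: "\<not> ?thesis"
  have ab: "2 * canc (u a) (u b) \<le> length (u b)"
    using canc_half_right[OF abc(1,2)] canc_same(1)[OF abc(1) _ red(1)] by fastforce
  have bc: "2 * canc (u b) (u c) \<le> length (u b)"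
    using canc_half_left[OF abc(2,3)] canc_same(2)[OF abc(2) _ red(2)] by fastforce
  define k where "k = canc (u a) (u b)"
  have k: "canc (u a) (u b) = k" "canc (u b) (u c) = k" "length (u b) = k + k"
    using ab bc ge by (auto simp: k_def)
  define p q where "p = take k (u b)" and "q = inv_word (drop k (u b))"
  have pq: "u b = p @ inv_word q" "length p = k" "length q = k"
    using k(3) by (simp_all add: p_def q_def)
  have "code n p \<le> code n q"
    using code_half[OF abc(1,2) red(1) pq(1)] pq k by simp
  moreover have "code n q \<le> code n p"
  proof (rule code_half[of "inv_letter c" "inv_letter b"])
    show "u (inv_letter b) = q @ inv_word p" by (simp add: inv pq(1))
    show "canc (u (inv_letter c)) (u (inv_letter b)) = length q"
      by (simp only: inv canc_inv k pq(3))
  qed (use abc red pq in \<open>auto simp: inv_letter_eq_iff\<close>)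
  moreover have "set (u b) \<subseteq> {..<n} \<times> UNIV"
    using closed[OF abc(2)] by (simp add: carrier_free_group)
  then have "set p \<subseteq> {..<n} \<times> UNIV" "set q \<subseteq> {..<n} \<times> UNIV"
    by (simp_all add: pq(1) set_inv_word)
  ultimately have "p = q"
    using code_inject pq(2,3) by (metis le_antisym)
  moreover have "p \<noteq> []"
    using nonempty[OF abc(2)] k(3) pq(2) by auto
  moreover have "hd (inv_word p) = inv_letter (last p)"
    using \<open>p \<noteq> []\<close> by (simp add: inv_word_def hd_map hd_rev)
  ultimately show False
    using reduced[OF abc(2)] by (auto simp: pq(1) freely_reduced_append)
qed

definition ev :: "nat letter list \<Rightarrow> nat letter list" where
  "ev w = foldr (\<lambda>a. foldr cons_reduce (u a)) w []"

lemma ev_simps [simp]: "ev [] = []" "ev (a # w) = foldr cons_reduce (u a) (ev w)"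
  by (simp_all add: ev_def)

lemma ev_reduced: "freely_reduced (ev w)"
  by (induction w) (auto intro: foldr_cons_reduce_reduced)

text \<open>The claim is strengthened for the induction: the part of \<open>u a\<close> that
  survives its right neighbour stands untouched at the front, and every later letter of the word
  contributes at least one letter.\<close>

lemma ev_prefix:
  assumes "freely_reduced (a # w)" "set (a # w) \<subseteq> {..<n} \<times> UNIV"
  shows "\<exists>z. ev (a # w) = take (length (u a) - (if w = [] then 0 else canc (u a) (u (hd w)))) (u a) @ z \<and>
    length w \<le> length z"
  using assms
proof (induction w arbitrary: a)
  case Nil
  then have "fst a < n" by auto
  then show ?case using reduced by (simp add: foldr_cons_reduce_Nil)
next
  case (Cons b w)
  have abn: "fst a < n" "fst b < n" using Cons.prems(2) by auto
  have ab: "b \<noteq> inv_letter a" using Cons.prems(1) by (simp add: freely_reduced_Cons)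
  define c where "c = (if w = [] then 0 else canc (u b) (u (hd w)))"
  obtain z where z: "ev (b # w) = take (length (u b) - c) (u b) @ z" "length w \<le> length z"
    using Cons.IH[of b] Cons.prems unfolding c_def by (auto simp: freely_reduced_Cons)
  obtain x p y where d: "u a = x @ inv_word p" "u b = p @ y" "length p = canc (u a) (u b)"
    "freely_reduced (x @ y)"
    using canc_decomp[OF reduced[OF abn(1)] reduced[OF abn(2)]] by metis
  have lt: "canc (u a) (u b) + c < length (u b)"
  proof (cases "w = []")
    case True
    have "2 * canc (u a) (u b) \<le> length (u b)"
      using canc_half_right[OF abn] canc_same(1)[OF abn(1) _ ab] by fastforce
    moreover have "length (u b) > 0" using nonempty[OF abn(2)] by simp
    moreover have "c = 0" using True by (simp add: c_def)
    ultimately show ?thesis by linarith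
  next
    case False
    then have "fst (hd w) < n" "hd w \<noteq> inv_letter b"
      using Cons.prems by (auto simp: freely_reduced_Cons neq_Nil_conv)
    with canc_sum[OF abn] ab False show ?thesis by (simp add: c_def)
  qed
  \<comment> \<open>\<open>t\<close> is what both neighbours leave of \<open>u b\<close>. Being
    nonempty, it separates \<open>x\<close> from \<open>z\<close>, so nothing further
    cancels.\<close>
  define t where "t = take (length y - c) y"
  have t: "take (length (u b) - c) (u b) = p @ t" "t \<noteq> []"
    using lt d(2,3) by (auto simp: t_def)
  have evb: "ev (b # w) = p @ t @ z" using z(1) t(1) by simp
  have "freely_reduced (p @ t @ z)"
    using ev_reduced[of "b # w"] unfolding evb .
  then have tz: "freely_reduced (t @ z)" by (simp add: freely_reduced_append)
  have "hd (t @ z) = hd y"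
    using t(2) by (auto simp: t_def hd_append hd_take)
  then have red: "freely_reduced (x @ t @ z)"
    using d(4) tz t(2) by (auto simp: freely_reduced_append t_def)
  have "foldr cons_reduce (inv_word p) (p @ t @ z) = t @ z"
    using foldr_cons_reduce_inv_cancel[of "t @ z" "inv_word p"] foldr_cons_reduce_append[of p "t @ z"] tz
      \<open>freely_reduced (p @ t @ z)\<close> by simp
  then have "ev (a # b # w) = x @ t @ z"
    using foldr_cons_reduce_append[OF red] evb by (simp only: ev_simps(2)[of a] d(1) foldr_append comp_apply)
  moreover have "take (length (u a) - canc (u a) (u b)) (u a) = x"
    using d(1,3) by simp
  moreover have "length (b # w) \<le> length (t @ z)"
    using z(2) t(2) by (cases t) auto
  ultimately show ?case by auto
qed

theorem length_ev:
  assumes "freely_reduced w" "set w \<subseteq> {..<n} \<times> UNIV"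
  shows "length w \<le> length (ev w)"
proof (cases w)
  case (Cons a v)
  obtain z where z: "ev (a # v) = take (length (u a) - (if v = [] then 0 else canc (u a) (u (hd v)))) (u a) @ z"
    "length v \<le> length z"
    using ev_prefix assms unfolding Cons by metis
  have a: "fst a < n" using assms(2) Cons by auto
  have "(if v = [] then 0 else canc (u a) (u (hd v))) < length (u a)"
  proof (cases "v = []")
    case False
    then have h: "fst (hd v) < n" "hd v \<noteq> inv_letter a"
      using assms Cons by (auto simp: freely_reduced_Cons neq_Nil_conv)
    have "2 * canc (u a) (u (hd v)) \<le> length (u a)"
      using canc_half_left[OF a h(1)] canc_same(2)[OF a _ h(2)] by fastforce
    moreover have "length (u a) > 0" using nonempty[OF a] by simp
    ultimately have "canc (u a) (u (hd v)) < length (u a)" by linarith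
    then show ?thesis using False by simp
  qed (use nonempty[OF a] in simp)
  then show ?thesis
    using z(2) unfolding Cons z(1) by simp
qed simp

end


section \<open>Generation by transvections\<close>

lemma inv_word_mult:
  assumes "v \<in> carrier (free_group S)" "w \<in> carrier (free_group S)"
  shows "inv_word (foldr cons_reduce v w) = foldr cons_reduce (inv_word w) (inv_word v)"
proof -
  have "v \<otimes>\<^bsub>free_group S\<^esub> w \<in> carrier (free_group S)"
    using assms by (rule monoid.m_closed[OF group.is_monoid[OF group_free_group]])
  then show ?thesis
    using group.inv_mult_group[OF group_free_group assms] assms by (simp add: inv_free_group mult_free_group)
qed

lemma subst_letter_inv: "subst_letter f (inv_letter a) = inv_word (subst_letter f a)"
  by (cases a) (simp add: inv_letter_def)

definition total_length :: "nat \<Rightarrow> (nat letter list \<Rightarrow> nat letter list) \<Rightarrow> nat" where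
  "total_length n g = (\<Sum>x<n. length (g (free_gen x)))"

definition total_weight :: "nat \<Rightarrow> (nat letter list \<Rightarrow> nat letter list) \<Rightarrow> nat" where
  "total_weight n g = (\<Sum>x<n. weight n (g (free_gen x)))"

definition reducible :: "nat \<Rightarrow> (nat letter list \<Rightarrow> nat letter list) \<Rightarrow> (nat letter list \<Rightarrow> nat letter list) \<Rightarrow> bool" where
  "reducible n h g \<longleftrightarrow> total_length n h < total_length n g \<or>
     total_length n h = total_length n g \<and> total_weight n h < total_weight n g"

text \<open>Only surjectivity up to sign is recorded, the form in which the length estimate delivers
  it; with \<open>n\<close> generators on either side it is a bijection up to sign.\<close>

definition signed_perm :: "nat \<Rightarrow> (nat letter list \<Rightarrow> nat letter list) \<Rightarrow> bool" where
  "signed_perm n g \<longleftrightarrow> (\<forall>x<n. \<exists>y<n. \<exists>b. g (free_gen y) = [(x, b)])"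

lemma SAut_closed:
  "g \<in> carrier (SAut n) \<Longrightarrow> w \<in> carrier (free_group {..<n}) \<Longrightarrow> g w \<in> carrier (free_group {..<n})"
  by (auto simp: carrier_SAut auto_def hom_def)

lemma SAut_inj:
  "g \<in> carrier (SAut n) \<Longrightarrow> v \<in> carrier (free_group {..<n}) \<Longrightarrow> w \<in> carrier (free_group {..<n}) \<Longrightarrow>
    g v = g w \<Longrightarrow> v = w"
  by (auto simp: carrier_SAut auto_def Bij_def bij_betw_def inj_on_def)

lemma SAut_surj:
  assumes "g \<in> carrier (SAut n)" "w \<in> carrier (free_group {..<n})"
  obtains v where "v \<in> carrier (free_group {..<n})" "g v = w"
proof -
  have "g ` carrier (free_group {..<n}) = carrier (free_group {..<n})"
    using assms(1) by (auto simp: carrier_SAut auto_def Bij_def bij_betw_def)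
  with assms(2) that show thesis by (metis imageE)
qed

lemma SAut_Nil: "g \<in> carrier (SAut n) \<Longrightarrow> g [] = []"
  by (simp add: SAut_subst carrier_free_group)

lemma SAut_letter:
  assumes "g \<in> carrier (SAut n)" "fst a < n"
  shows "g [a] = subst_letter (\<lambda>x. g (free_gen x)) a"
proof -
  have "g (free_gen (fst a)) \<in> carrier (free_group {..<n})"
    using SAut_closed[OF assms(1)] assms(2) by simp
  then have "freely_reduced (subst_letter (\<lambda>x. g (free_gen x)) a)"
    by (cases a) (auto simp: carrier_free_group)
  moreover have "[a] \<in> carrier (free_group {..<n})"
    using assms(2) by (cases a) (simp add: carrier_free_group freely_reduced_Cons)
  ultimately show ?thesis
    using SAut_subst[OF assms(1), of "[a]"] by (simp add: foldr_cons_reduce_Nil)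
qed

text \<open>Irreducibility makes the images of the letters Nielsen reduced. The preimage of a
  generator is then no longer than its image, so it is a single letter.\<close>

lemma irreducible_signed_perm:
  assumes g: "g \<in> carrier (SAut n)"
    and irr: "\<And>i a. i < n \<Longrightarrow> fst a < n \<Longrightarrow> fst a \<noteq> i \<Longrightarrow>
      \<not> reducible n (g \<otimes>\<^bsub>SAut n\<^esub> lmul {..<n} a i) g \<and> \<not> reducible n (g \<otimes>\<^bsub>SAut n\<^esub> rmul {..<n} a i) g"
  shows "signed_perm n g"
proof -
  define u where "u = subst_letter (\<lambda>x. g (free_gen x))"
  have gc: "g (free_gen x) \<in> carrier (free_group {..<n})" if "x < n" for x
    using SAut_closed[OF g] that by simp
  have u_closed: "u a \<in> carrier (free_group {..<n})" if "fst a < n" for a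
    using gc that by (cases a) (auto simp: u_def)
  have u_inv: "u (inv_letter a) = inv_word (u a)" for a
    by (simp add: u_def subst_letter_inv)
  have u_nonempty: "u a \<noteq> []" if "fst a < n" for a
  proof
    assume "u a = []"
    then have "g (free_gen (fst a)) = g []"
      using SAut_Nil[OF g] by (cases a) (auto simp: u_def split: if_splits)
    moreover have "free_gen (fst a) \<in> carrier (free_group {..<n})" using that by simp
    moreover have "[] \<in> carrier (free_group {..<n})" by (simp add: carrier_free_group)
    ultimately have "free_gen (fst a) = []"
      using SAut_inj[OF g] by blast
    then show False by (simp add: free_gen_def)
  qed
  have pair: "g [a, b] = foldr cons_reduce (u a) (u b)"
    if "fst a < n" "fst b < n" "fst a \<noteq> fst b" for a b
  proof -
    have "[a, b] \<in> carrier (free_group {..<n})"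
      using that by (cases a; cases b) (auto simp: carrier_free_group freely_reduced_Cons inv_letter_def)
    then show ?thesis
      using SAut_subst[OF g, of "[a, b]"] u_closed[OF that(2)]
      by (simp add: u_def foldr_cons_reduce_Nil carrier_free_group)
  qed
  \<comment> \<open>A transvection changes one generator only, so comparing totals amounts to
    comparing a single term.\<close>
  have sum_upd: "(\<Sum>x<n. f x) + h i = (\<Sum>x<n. h x) + f i"
    if "i < n" "\<And>x. x < n \<Longrightarrow> x \<noteq> i \<Longrightarrow> f x = h x" for f h :: "nat \<Rightarrow> nat" and i
  proof -
    have "(\<Sum>x\<in>{..<n} - {i}. f x) = (\<Sum>x\<in>{..<n} - {i}. h x)"
      using that by (intro sum.cong) auto
    then show ?thesis
      using that(1) by (simp add: sum.remove[of "{..<n}" i])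
  qed
  have irr': "length (g (free_gen i)) \<le> length v \<and>
      (length v = length (g (free_gen i)) \<longrightarrow> weight n (g (free_gen i)) \<le> weight n v)"
    if i: "i < n" and h: "h (free_gen i) = v" "\<And>x. x < n \<Longrightarrow> x \<noteq> i \<Longrightarrow> h (free_gen x) = g (free_gen x)"
      and nr: "\<not> reducible n h g" for h i v
    using nr sum_upd[OF i, of "\<lambda>x. length (h (free_gen x))" "\<lambda>x. length (g (free_gen x))"]
      sum_upd[OF i, of "\<lambda>x. weight n (h (free_gen x))" "\<lambda>x. weight n (g (free_gen x))"] h
    by (auto simp: reducible_def total_length_def total_weight_def)
  \<comment> \<open>A positive letter \<open>a\<close> corresponds to right multiplication by
    \<open>b\<close>; for a negative one the product is inverted and becomes left multiplication by
    the inverse of \<open>b\<close>.\<close>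
  have min: "length (u a) \<le> length (foldr cons_reduce (u a) (u b)) \<and>
      (length (foldr cons_reduce (u a) (u b)) = length (u a) \<longrightarrow>
       weight n (u a) \<le> weight n (foldr cons_reduce (u a) (u b)))"
    if ab: "fst a < n" "fst b < n" "fst a \<noteq> fst b" for a b
  proof (cases "snd a")
    case True
    then have a: "a = (fst a, True)" by (simp add: prod_eq_iff)
    have pr: "g [(fst a, True), b] = foldr cons_reduce (u a) (u b)"
      using pair[OF ab] unfolding a[symmetric] .
    have "u a = g (free_gen (fst a))"
      by (subst a) (simp add: u_def)
    moreover have "(g \<otimes>\<^bsub>SAut n\<^esub> rmul {..<n} b (fst a)) (free_gen (fst a)) = foldr cons_reduce (u a) (u b)"
      using ab g pr by (simp add: mult_SAut_gen mul_SAut mul_gen)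
    moreover have "(g \<otimes>\<^bsub>SAut n\<^esub> rmul {..<n} b (fst a)) (free_gen x) = g (free_gen x)" if "x < n" "x \<noteq> fst a" for x
      using ab g that by (simp add: mult_SAut_gen mul_SAut mul_gen) (simp add: free_gen_def)
    ultimately show ?thesis
      using irr'[OF ab(1)] irr[of "fst a" b] ab by metis
  next
    case False
    then have a: "inv_letter a = (fst a, True)" by (simp add: prod_eq_iff)
    have pr: "g [inv_letter b, (fst a, True)] = foldr cons_reduce (u (inv_letter b)) (u (inv_letter a))"
      using pair[of "inv_letter b" "inv_letter a"] ab by (simp add: a)
    have "u (inv_letter a) = g (free_gen (fst a))"
      by (subst a) (simp add: u_def)
    moreover have "(g \<otimes>\<^bsub>SAut n\<^esub> lmul {..<n} (inv_letter b) (fst a)) (free_gen (fst a)) =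
        foldr cons_reduce (u (inv_letter b)) (u (inv_letter a))"
      using ab g pr by (simp add: mult_SAut_gen mul_SAut mul_gen)
    moreover have "(g \<otimes>\<^bsub>SAut n\<^esub> lmul {..<n} (inv_letter b) (fst a)) (free_gen x) = g (free_gen x)"
      if "x < n" "x \<noteq> fst a" for x
      using ab g that by (simp add: mult_SAut_gen mul_SAut mul_gen) (simp add: free_gen_def)
    ultimately have "length (inv_word (u a)) \<le> length (foldr cons_reduce (inv_word (u b)) (inv_word (u a))) \<and>
      (length (foldr cons_reduce (inv_word (u b)) (inv_word (u a))) = length (inv_word (u a)) \<longrightarrow>
       weight n (inv_word (u a)) \<le> weight n (foldr cons_reduce (inv_word (u b)) (inv_word (u a))))"
      using irr'[OF ab(1)] irr[of "fst a" "inv_letter b"] ab unfolding u_inv by (metis inv_letter_simps(2))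
    moreover have "foldr cons_reduce (inv_word (u b)) (inv_word (u a)) = inv_word (foldr cons_reduce (u a) (u b))"
      by (rule inv_word_mult[OF u_closed[OF ab(1)] u_closed[OF ab(2)], symmetric])
    ultimately show ?thesis by simp
  qed
  interpret nielsen_reduced n u
    by unfold_locales (use u_closed u_inv u_nonempty min in auto)
  have ev: "g w = ev w" if "w \<in> carrier (free_group {..<n})" for w
    using SAut_subst[OF g that] unfolding subst_def u_def[symmetric] ev_def .
  show ?thesis
    unfolding signed_perm_def
  proof (intro allI impI)
    fix x assume "x < n"
    then have x: "[(x, True)] \<in> carrier (free_group {..<n})"
      by (simp add: carrier_free_group freely_reduced_Cons)
    obtain w where w: "w \<in> carrier (free_group {..<n})" "g w = [(x, True)]"
      by (rule SAut_surj[OF g x])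
    have "length w \<le> 1"
      using length_ev[of w] w ev[OF w(1)] by (simp add: carrier_free_group)
    moreover have "w \<noteq> []" using w(2) SAut_Nil[OF g] by auto
    ultimately obtain a where a: "w = [a]" by (cases w) auto
    then have an: "fst a < n" using w(1) by (auto simp: carrier_free_group)
    have "subst_letter (\<lambda>x. g (free_gen x)) a = [(x, True)]"
      using w(2) SAut_letter[OF g an] a by simp
    then have "g (free_gen (fst a)) = [(x, True)] \<or> inv_word (g (free_gen (fst a))) = [(x, True)]"
      by (cases a) (auto split: if_splits)
    then have "g (free_gen (fst a)) = [(x, True)] \<or> g (free_gen (fst a)) = inv_word [(x, True)]"
      by (metis inv_word_simps(6))
    then show "\<exists>y<n. \<exists>b. g (free_gen y) = [(x, b)]"
      using an by (auto simp: inv_letter_def)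
  qed
qed

lemma signed_perm_mult:
  assumes g: "g \<in> carrier (SAut n)" "signed_perm n g" and h: "h \<in> carrier (SAut n)" "signed_perm n h"
  shows "signed_perm n (g \<otimes>\<^bsub>SAut n\<^esub> h)"
  unfolding signed_perm_def
proof (intro allI impI)
  fix x assume "x < n"
  then obtain y b where y: "y < n" "g (free_gen y) = [(x, b)]" using g(2) by (auto simp: signed_perm_def)
  then obtain z c where z: "z < n" "h (free_gen z) = [(y, c)]" using h(2) by (fastforce simp: signed_perm_def)
  have "(g \<otimes>\<^bsub>SAut n\<^esub> h) (free_gen z) = [(x, if c then b else \<not> b)]"
    using z y g h SAut_letter[OF g(1), of "(y, c)"] by (simp add: mult_SAut_gen inv_letter_def)
  with z(1) show "\<exists>y<n. \<exists>b. (g \<otimes>\<^bsub>SAut n\<^esub> h) (free_gen y) = [(x, b)]" by blast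
qed

lemma signed_perm_signed_swap: "i < n \<Longrightarrow> j < n \<Longrightarrow> i \<noteq> j \<Longrightarrow> signed_perm n (signed_swap n i j)"
  unfolding signed_perm_def by (metis signed_swap_gen)

text \<open>The induced matrix is diagonal with exactly one entry -1, so its determinant is
  -1.\<close>

lemma no_single_inversion:
  assumes g: "g \<in> carrier (SAut n)" and m: "m < n" "g (free_gen m) = [(m, False)]"
    and fixed: "\<And>k. k < n \<Longrightarrow> k \<noteq> m \<Longrightarrow> g (free_gen k) = [(k, True)]"
  shows False
proof -
  have "g (free_gen j) = [(j, j \<noteq> m)]" if "j < n" for j
    using m fixed that by (cases "j = m") auto
  then have "abel_matrix n g = multrow_mat n m (- 1)"
    using g by (auto simp: carrier_SAut abel_matrix_eq multrow_mat_def exponent_sum_letters intro!: cong_mat)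
  then have "det (abel_matrix n g) = - 1"
    using det_multrow_mat[OF m(1), of "- 1 :: int"] by simp
  then show False using g by (simp add: carrier_SAut)
qed

text \<open>Reduction multiplies \<open>g\<close> on the right until the identity is reached, so the
  rules infer \<open>P g\<close> from the product. Outside signed permutations the descent is
  lexicographic in total length and total weight.\<close>

theorem SAut_induct [consumes 1, case_names one lmul rmul]:
  assumes g: "g \<in> carrier (SAut n)"
    and one: "P \<one>\<^bsub>SAut n\<^esub>"
    and lmul: "\<And>g i a. g \<in> carrier (SAut n) \<Longrightarrow> i < n \<Longrightarrow> fst a < n \<Longrightarrow> fst a \<noteq> i \<Longrightarrow>
      P (g \<otimes>\<^bsub>SAut n\<^esub> lmul {..<n} a i) \<Longrightarrow> P g"
    and rmul: "\<And>g i a. g \<in> carrier (SAut n) \<Longrightarrow> i < n \<Longrightarrow> fst a < n \<Longrightarrow> fst a \<noteq> i \<Longrightarrow>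
      P (g \<otimes>\<^bsub>SAut n\<^esub> rmul {..<n} a i) \<Longrightarrow> P g"
  shows "P g"
proof -
  interpret G: group "SAut n" by (rule group_SAut)
  have wt: "P h" if h: "h \<in> carrier (SAut n)" and ij: "i < n" "j < n" "i \<noteq> j" and P: "P (h \<otimes>\<^bsub>SAut n\<^esub> signed_swap n i j)" for h i j
  proof -
    note cl = tv_closed(1)[OF ij] tv_closed(2)[OF ij] mul_SAut(2)[of j n "(i, False)"]
    have "P (h \<otimes>\<^bsub>SAut n\<^esub> right_tv n i j \<otimes>\<^bsub>SAut n\<^esub> rmul {..<n} (i, False) j \<otimes>\<^bsub>SAut n\<^esub> left_tv n i j)"
      using P h ij cl by (simp add: signed_swap_def G.m_assoc)
    then have "P (h \<otimes>\<^bsub>SAut n\<^esub> right_tv n i j \<otimes>\<^bsub>SAut n\<^esub> rmul {..<n} (i, False) j)"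
      by (rule lmul[where i = i and a = "(j, True)", folded left_tv_def, rotated 4]) (use h ij cl in auto)
    then have "P (h \<otimes>\<^bsub>SAut n\<^esub> right_tv n i j)"
      by (rule rmul[where i = j and a = "(i, False)", rotated 4]) (use h ij cl in auto)
    then show ?thesis
      by (rule rmul[where i = i and a = "(j, True)", folded right_tv_def, rotated 4]) (use h ij cl in auto)
  qed
  define N where "N h = {x \<in> {..<n}. h (free_gen x) \<noteq> [(x, True)]}" for h :: "nat letter list \<Rightarrow> nat letter list"
  \<comment> \<open>For signed permutations the descent is on the number of generators not fixed,
    with signed swaps as moves.\<close>
  have signed: "P h" if "h \<in> carrier (SAut n)" "signed_perm n h" for h
    using that
  proof (induction "card (N h)" arbitrary: h rule: less_induct)
    case less
    note h = less.prems(1)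
    have step: "P h" if ij: "i < n" "j < n" "i \<noteq> j" and N: "N (h \<otimes>\<^bsub>SAut n\<^esub> signed_swap n i j) \<subset> N h" for i j
    proof (rule wt[OF h ij], rule less.hyps)
      show "card (N (h \<otimes>\<^bsub>SAut n\<^esub> signed_swap n i j)) < card (N h)"
        using N by (intro psubset_card_mono) (simp_all add: N_def)
    qed (use h ij less.prems(2) signed_swap_closed signed_perm_signed_swap signed_perm_mult in auto)
    have neg: "h [(x, False)] = inv_word (h (free_gen x))" "h [(x, True)] = h (free_gen x)"
      if "x < n" for x
      using SAut_letter[OF h, of "(x, False)"] that by (simp_all add: free_gen_def)
    have val: "(h \<otimes>\<^bsub>SAut n\<^esub> signed_swap n i j) (free_gen x) =
        (if x = i then h (free_gen j) else if x = j then inv_word (h (free_gen i)) else h (free_gen x))"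
      if "i < n" "j < n" "i \<noteq> j" "x < n" for i j x
      using that h by (simp add: mult_SAut_gen signed_swap_closed signed_swap_gen neg)
    have psub: "N h' \<subset> N h" if "m \<in> N h" "m \<notin> N h'" "\<And>x. x \<in> N h' \<Longrightarrow> x \<in> N h" for m h'
      using that by blast
    show ?case
    proof (cases "N h = {}")
      case True
      then have "h = \<one>\<^bsub>SAut n\<^esub>"
        by (intro SAut_eqI[OF h]) (auto simp: N_def one_SAut_gen)
      then show ?thesis using one by simp
    next
      case False
      then obtain m where m: "m < n" "h (free_gen m) \<noteq> [(m, True)]" by (auto simp: N_def)
      then obtain l b where l: "l < n" "h (free_gen l) = [(m, b)]"
        using less.prems(2) by (auto simp: signed_perm_def)
      show ?thesis
      proof (cases "l = m")
        case False
        \<comment> \<open>The order of the two indices decides where the sign goes; it is chosen so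
          that \<open>m\<close> becomes fixed. The other index \<open>l\<close> was not fixed
          before, so \<open>N\<close> shrinks.\<close>
        show ?thesis
        proof (cases b)
          case True
          show ?thesis
            by (rule step[of m l, OF _ _ _ psub[of m]])
               (use m l True False in \<open>auto simp: N_def val split: if_splits\<close>)
        next
          case b: False
          show ?thesis
            by (rule step[of l m, OF _ _ _ psub[of m]])
               (use m l b False in \<open>auto simp: N_def val inv_letter_def split: if_splits\<close>)
        qed
      next
        case True
        with m l have hm: "h (free_gen m) = [(m, False)]" by (cases b) auto
        then obtain k where k: "k < n" "k \<noteq> m" "h (free_gen k) \<noteq> [(k, True)]"
          using no_single_inversion[OF h m(1)] by blast
        have mk: "m < n" "k < n" "m \<noteq> k" using m k by auto
        \<comment> \<open>The square of a signed swap inverts two generators at once. The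
          determinant guarantees a second generator \<open>k\<close> that is not fixed, so inverting
          \<open>k\<close> along with \<open>m\<close> does no harm.\<close>
        let ?h = "h \<otimes>\<^bsub>SAut n\<^esub> signed_swap n m k \<otimes>\<^bsub>SAut n\<^esub> signed_swap n m k"
        have h1: "h \<otimes>\<^bsub>SAut n\<^esub> signed_swap n m k \<in> carrier (SAut n)"
          using h signed_swap_closed[OF mk] by (rule SAut_m_closed)
        have wl: "(h \<otimes>\<^bsub>SAut n\<^esub> signed_swap n m k) [(m, False)] = inv_word (h (free_gen k))"
          using SAut_letter[OF h1, of "(m, False)"] mk by (simp add: val)
        have val2: "?h (free_gen x) = (if x = m \<or> x = k then inv_word (h (free_gen x)) else h (free_gen x))"
          if "x < n" for x
        proof -
          have "?h (free_gen x) = (h \<otimes>\<^bsub>SAut n\<^esub> signed_swap n m k) (signed_swap n m k (free_gen x))"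
            by (rule mult_SAut_gen[OF h1 signed_swap_closed[OF mk] that])
          moreover have "[(y, True)] = free_gen y" for y :: nat by (simp add: free_gen_def)
          ultimately show ?thesis
            using that mk wl by (simp add: signed_swap_gen val)
        qed
        have "N ?h \<subset> N h"
          by (rule psub[of m]) (use mk k hm in \<open>auto simp: N_def val2 inv_letter_def split: if_splits\<close>)
        then have "card (N ?h) < card (N h)"
          by (intro psubset_card_mono) (simp_all add: N_def)
        moreover have "?h \<in> carrier (SAut n)" "signed_perm n ?h"
          using h mk less.prems(2) by (auto intro!: SAut_m_closed signed_perm_mult signed_swap_closed signed_perm_signed_swap)
        ultimately have "P ?h" using less.hyps by blast
        then show ?thesis
          using wt[OF _ mk] h signed_swap_closed[OF mk] SAut_m_closed by blast
      qed
    qed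
  qed
  have "wf (inv_image (less_than <*lex*> less_than) (\<lambda>h. (total_length n h, total_weight n h)))"
    by (intro wf_inv_image wf_lex_prod wf_less_than)
  then show ?thesis
    using g
  proof (induction g rule: wf_induct_rule)
    case (less g)
    have IH: "P h" if "h \<in> carrier (SAut n)" "reducible n h g" for h
      using less.IH[of h] that by (auto simp: reducible_def)
    show ?case
    proof (cases "signed_perm n g")
      case False
      then obtain i a where ia: "i < n" "fst a < n" "fst a \<noteq> i"
        "reducible n (g \<otimes>\<^bsub>SAut n\<^esub> lmul {..<n} a i) g \<or> reducible n (g \<otimes>\<^bsub>SAut n\<^esub> rmul {..<n} a i) g"
        using irreducible_signed_perm[OF less.prems] by blast
      then show ?thesis
        using IH lmul[OF less.prems ia(1-3)] rmul[OF less.prems ia(1-3)] SAut_m_closed[OF less.prems] mul_SAut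
        by metis
    qed (rule signed[OF less.prems])
  qed
qed


section \<open>Small actions\<close>

text \<open>Members of \<open>BijGroup X\<close> are undefined outside \<open>X\<close>, whereas
  \<open>permutes\<close> and plain composition need the identity there.\<close>

definition total_action :: "'x set \<Rightarrow> ('g \<Rightarrow> 'x \<Rightarrow> 'x) \<Rightarrow> 'g \<Rightarrow> 'x \<Rightarrow> 'x" where
  "total_action X \<rho> g x = (if x \<in> X then \<rho> g x else x)"

lemma total_action_permutes:
  assumes "\<rho> \<in> hom G (BijGroup X)" "g \<in> carrier G"
  shows "total_action X \<rho> g permutes X"
proof (rule bij_imp_permutes)
  have "\<rho> g \<in> Bij X" using assms by (auto simp: hom_def BijGroup_def)
  then show "bij_betw (total_action X \<rho> g) X X"
    by (auto simp: Bij_def total_action_def cong: bij_betw_cong)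
qed (simp add: total_action_def)

lemma total_action_mult:
  assumes \<rho>: "\<rho> \<in> hom G (BijGroup X)" and g: "g \<in> carrier G" and h: "h \<in> carrier G"
  shows "total_action X \<rho> (g \<otimes>\<^bsub>G\<^esub> h) = total_action X \<rho> g \<circ> total_action X \<rho> h"
proof
  fix x
  have B: "\<rho> g \<in> Bij X" "\<rho> h \<in> Bij X" using \<rho> g h by (auto simp: hom_def BijGroup_def)
  have "\<rho> (g \<otimes>\<^bsub>G\<^esub> h) = compose X (\<rho> g) (\<rho> h)"
    using hom_mult[OF \<rho> g h] B by (simp add: BijGroup_def)
  moreover have "\<rho> h x \<in> X" if "x \<in> X"
    using B(2) that by (auto simp: Bij_def bij_betw_def)
  ultimately show "total_action X \<rho> (g \<otimes>\<^bsub>G\<^esub> h) x = (total_action X \<rho> g \<circ> total_action X \<rho> h) x"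
    by (simp add: total_action_def compose_def)
qed

lemma total_action_eq_id:
  assumes "\<rho> \<in> hom G (BijGroup X)" "g \<in> carrier G" "total_action X \<rho> g = id"
  shows "\<rho> g = \<one>\<^bsub>BijGroup X\<^esub>"
proof (rule extensionalityI)
  show "\<rho> g \<in> extensional X"
    using assms(1,2) by (auto simp: hom_def BijGroup_def Bij_def)
  show "\<one>\<^bsub>BijGroup X\<^esub> \<in> extensional X"
    by (simp add: BijGroup_def)
  show "\<rho> g x = \<one>\<^bsub>BijGroup X\<^esub> x" if "x \<in> X" for x
    using fun_cong[OF assms(3), of x] that by (simp add: total_action_def BijGroup_def)
qed

lemma total_action_one:
  assumes "group G" "\<rho> \<in> hom G (BijGroup X)"
  shows "total_action X \<rho> \<one>\<^bsub>G\<^esub> = id"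
proof -
  interpret group_hom G "BijGroup X" \<rho>
    using assms group_BijGroup by (simp add: group_hom_def group_hom_axioms_def)
  show ?thesis
    by (auto simp: total_action_def fun_eq_iff BijGroup_def)
qed

lemma mul_inverse:
  assumes "i < n" "fst a < n" "fst a \<noteq> i"
  shows "lmul {..<n} a i \<otimes>\<^bsub>SAut n\<^esub> lmul {..<n} (inv_letter a) i = \<one>\<^bsub>SAut n\<^esub>"
    and "rmul {..<n} a i \<otimes>\<^bsub>SAut n\<^esub> rmul {..<n} (inv_letter a) i = \<one>\<^bsub>SAut n\<^esub>"
proof -
  have one: "\<one>\<^bsub>SAut n\<^esub> \<in> carrier (SAut n)"
    by (rule monoid.one_closed[OF group.is_monoid[OF group_SAut]])
  show "lmul {..<n} a i \<otimes>\<^bsub>SAut n\<^esub> lmul {..<n} (inv_letter a) i = \<one>\<^bsub>SAut n\<^esub>"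
    "rmul {..<n} a i \<otimes>\<^bsub>SAut n\<^esub> rmul {..<n} (inv_letter a) i = \<one>\<^bsub>SAut n\<^esub>"
    by (rule SAut_eqI[OF _ one]; use assms in \<open>cases a; auto simp: one_SAut_gen tv_eval\<close>)+
qed

theorem theorem3p10:
  fixes X :: "'x set" and \<rho> :: "(nat letter list \<Rightarrow> nat letter list) \<Rightarrow> 'x \<Rightarrow> 'x"
  assumes "finite X" and "card X < 18"
    and "\<rho> \<in> hom (SAut 5) (BijGroup X)"
  shows "\<forall>g \<in> carrier (SAut 5). \<rho> g = \<one>\<^bsub>BijGroup X\<^esub>"
proof
  fix g assume g: "g \<in> carrier (SAut 5)"
  define \<pi> where "\<pi> = total_action X \<rho>"
  have perm: "\<pi> h permutes X" if "h \<in> carrier (SAut 5)" for h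
    unfolding \<pi>_def by (rule total_action_permutes[OF assms(3) that])
  have mult: "\<pi> (h \<otimes>\<^bsub>SAut 5\<^esub> k) = \<pi> h \<circ> \<pi> k" if "h \<in> carrier (SAut 5)" "k \<in> carrier (SAut 5)" for h k
    unfolding \<pi>_def by (rule total_action_mult[OF assms(3) that])
  have one: "\<pi> \<one>\<^bsub>SAut 5\<^esub> = id"
    unfolding \<pi>_def by (rule total_action_one[OF group_SAut assms(3)])
  have two: "\<pi> a \<circ> \<pi> b = \<pi> c \<circ> \<pi> d"
    if "a \<otimes>\<^bsub>SAut 5\<^esub> b = c \<otimes>\<^bsub>SAut 5\<^esub> d" "a \<in> carrier (SAut 5)" "b \<in> carrier (SAut 5)"
      "c \<in> carrier (SAut 5)" "d \<in> carrier (SAut 5)" for a b c d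
    by (simp only: mult[OF that(2,3), symmetric] mult[OF that(4,5), symmetric] that(1))
  have three: "\<pi> a \<circ> \<pi> b = \<pi> c \<circ> (\<pi> d \<circ> \<pi> e)"
    if "a \<otimes>\<^bsub>SAut 5\<^esub> b = c \<otimes>\<^bsub>SAut 5\<^esub> (d \<otimes>\<^bsub>SAut 5\<^esub> e)" "a \<in> carrier (SAut 5)" "b \<in> carrier (SAut 5)"
      "c \<in> carrier (SAut 5)" "d \<in> carrier (SAut 5)" "e \<in> carrier (SAut 5)" for a b c d e
    by (simp only: mult[OF that(2,3), symmetric] mult[OF that(5,6), symmetric]
        mult[OF that(4) SAut_m_closed[OF that(5,6)], symmetric] that(1))
  interpret transvection_action X "\<lambda>i j. \<pi> (left_tv 5 i j)" "\<lambda>i j. \<pi> (right_tv 5 i j)"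
  proof unfold_locales
    fix i j k :: nat assume ix: "indices [i, j, k]"
    then have w: "signed_swap 5 i j \<in> carrier (SAut 5)" by (intro signed_swap_closed) (auto simp: indices_def)
    have "\<pi> (signed_swap 5 i j) \<circ> \<pi> (left_tv 5 i k) = \<pi> (left_tv 5 j k) \<circ> \<pi> (signed_swap 5 i j)"
      "\<pi> (signed_swap 5 i j) \<circ> \<pi> (left_tv 5 k i) = \<pi> (left_tv 5 k j) \<circ> \<pi> (signed_swap 5 i j)"
      using ix by (auto intro!: two signed_swap_conj tv_closed w simp: indices_def)
    with perm[OF w]
    show "\<exists>g. g permutes X \<and> g \<circ> \<pi> (left_tv 5 i k) = \<pi> (left_tv 5 j k) \<circ> g"
      "\<exists>g. g permutes X \<and> g \<circ> \<pi> (left_tv 5 k i) = \<pi> (left_tv 5 k j) \<circ> g" by blast+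
  qed (rule assms | ((rule perm | rule two | rule three);
      rule tv_closed tv_commute_self tv_commute tv_commute_disjoint tv_steinberg;
      (simp add: indices_def; fail)))+
  have "\<pi> (left_tv 5 i j) = id" "\<pi> (right_tv 5 i j) = id" if "i < 5" "j < 5" "i \<noteq> j" for i j
  proof -
    have ij: "indices [i, j]" using that by (simp add: indices_def)
    show "\<pi> (left_tv 5 i j) = id" by (rule L_trivial[OF ij])
    \<comment> \<open>With exponent 1, triviality of all left transvections passes to the right
      ones.\<close>
    show "\<pi> (right_tv 5 i j) = id"
      using R_funpow_id[of 1, OF _ ij] L_trivial by simp
  qed
  then have pos: "\<pi> (lmul {..<5} (j, True) i) = id" "\<pi> (rmul {..<5} (j, True) i) = id"
    if "i < 5" "j < 5" "i \<noteq> j" for i j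
    using that by (simp_all add: left_tv_def right_tv_def)
  \<comment> \<open>An inverted letter gives the inverse automorphism, so it acts trivially as soon
    as the positive letter does.\<close>
  have triv: "\<pi> (lmul {..<5} a i) = id" "\<pi> (rmul {..<5} a i) = id" if "i < 5" "fst a < 5" "fst a \<noteq> i" for a i
  proof -
    obtain j b where a: "a = (j, b)" by (cases a)
    have eq: "\<pi> (lmul {..<5} (j, True) i) \<circ> \<pi> (lmul {..<5} (j, False) i) = id"
      "\<pi> (rmul {..<5} (j, True) i) \<circ> \<pi> (rmul {..<5} (j, False) i) = id"
      using that a mul_inverse[of i 5 "(j, True)"] one
        mult[OF mul_SAut(1)[of i 5 "(j, True)"] mul_SAut(1)[of i 5 "(j, False)"]]
        mult[OF mul_SAut(2)[of i 5 "(j, True)"] mul_SAut(2)[of i 5 "(j, False)"]]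
      by (simp_all add: inv_letter_def)
    show "\<pi> (lmul {..<5} a i) = id" "\<pi> (rmul {..<5} a i) = id"
      using eq pos[of i j] that a by (cases b; simp)+
  qed
  have "\<pi> g = id"
    using g
  proof (induction g rule: SAut_induct)
    case one
    show ?case by (rule \<open>\<pi> \<one>\<^bsub>SAut 5\<^esub> = id\<close>)
  next
    case (lmul g i a)
    then show ?case
      using mult[OF lmul.hyps(1) mul_SAut(1)] triv(1)[of i a] by simp
  next
    case (rmul g i a)
    then show ?case
      using mult[OF rmul.hyps(1) mul_SAut(2)] triv(2)[of i a] by simp
  qed
  then show "\<rho> g = \<one>\<^bsub>BijGroup X\<^esub>"
    using total_action_eq_id[OF assms(3) g] by (simp add: \<pi>_def)
qed

end
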